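(* There is a residual subset $\Sigma^2\subseteq \tilde{C}^2_{per}$ with the following property: if $O\subseteq C^2_{per}$ is an open bounded set such that $\deg(\mathcal{F},O,y)=m$ for some $y\in\Sigma^2$ (where $m$ is an integer and $\deg$ is the Leray–Schauder degree, assumed to be defined), then the equation $\mathcal{F}(x)=y$ has at least $m$ distinct solutions.
   Context: Fix $n\ge 2$ and $q\ge2$, and let $I=[0,1]$. Let $C^i=C^i(I,\mathbb{R}^n)$ and $C^i_{per}=\{x\in C^i: x^{(j)}(0)=x^{(j)}(1),\ 0\le j<i\}$ (so $C^0_{per}=C^0$). For $X$ any of these spaces, $\tilde X=\{x\in X:\overline{x}=0\}$, where $\overline{x}=\int_0^1x(t)\,dt$. Let $Q(x)=\overline{x}\in\mathbb{R}^n$ (viewed as a constant function), $P=\mathrm{id}-Q$, and $N(x)(t)=\frac{x(t)}{|x(t)|^{q+1}}$ for nowhere vanishing $x$. Let $D:\tilde C^2_{per}\to\tilde C^0_{per}$, $Dx=x''$, which is an isomorphism of Banach spaces. The functional $\mathcal{F}$ is defined on $\{x\in C^2_{per}: x(t)\ne0\ \forall t\}$ with values in $C^2_{per}=\mathbb{R}^n\oplus\tilde C^2_{per}$ by $$\mathcal{F}(x)=QNx+Px-D^{-1}PNx.$$ Thus $u$ solves $u''-\frac{u}{|u|^{q+1}}=\lambda h$ with periodic conditions $u(0)=u(1)$, $u'(0)=u'(1)$ (where $\overline h=0$) if and only if $\mathcal{F}(u)=-\lambda H$, where $H\in\tilde C^2_{per}$ and $H''=-h$. That the degree is defined requires in particular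 that $\overline{O}$ lies in the domain of $\mathcal{F}$ and $y\notin\mathcal{F}(\partial O)$. A residual set is one containing a countable intersection of open dense sets. *)

theory Defs
  imports "HOL-Analysis.Analysis"
begin

section \<open>The spaces \<open>C\<^sup>i\<close> and \<open>C\<^sup>i\<^sub>p\<^sub>e\<^sub>r\<close> on \<open>[0,1]\<close>\<close>

text \<open>
  A function on \<open>[0,1]\<close> is represented by its extension by zero to the whole real line, so that
  HOL equality is equality of functions on \<open>[0,1]\<close>. All derivatives are taken within \<open>[0,1]\<close>,
  i.e. they are one-sided at the end points.
\<close>

definition deriv_I :: "(real \<Rightarrow> real ^ 'n) \<Rightarrow> real \<Rightarrow> real ^ 'n" where
  "deriv_I x = (\<lambda>t. if t \<in> {0..1} then vector_derivative x (at t within {0..1}) else 0)"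

definition C_space :: "nat \<Rightarrow> (real \<Rightarrow> real ^ 'n) set" where
  "C_space i = {x. (\<forall>t. t \<notin> {0..1} \<longrightarrow> x t = 0) \<and>
     (\<forall>j<i. (deriv_I ^^ j) x differentiable_on {0..1}) \<and>
     continuous_on {0..1} ((deriv_I ^^ i) x)}"

definition C_per :: "nat \<Rightarrow> (real \<Rightarrow> real ^ 'n) set" where
  "C_per i = {x \<in> C_space i. \<forall>j<i. (deriv_I ^^ j) x 0 = (deriv_I ^^ j) x 1}"

definition mean :: "(real \<Rightarrow> real ^ 'n) \<Rightarrow> real ^ 'n" where
  "mean x = integral {0..1} x"

lemma deriv_I_power_outside:
  assumes "\<And>t. t \<notin> {0..1} \<Longrightarrow> x t = 0" "t \<notin> {0..1}"
  shows "(deriv_I ^^ j) x t = 0"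
  using assms by (cases j) (auto simp: deriv_I_def)

lemma C_space_continuous:
  assumes "x \<in> C_space i" "j \<le> i"
  shows "continuous_on {0..1} ((deriv_I ^^ j) x)"
  using assms by (cases "j = i") (auto simp: C_space_def intro!: differentiable_imp_continuous_on)

lemma C_space_has_vector_derivative:
  assumes "x \<in> C_space i" "j < i" "t \<in> {0..1}"
  shows "((deriv_I ^^ j) x has_vector_derivative (deriv_I ^^ Suc j) x t) (at t within {0..1})"
proof -
  have "(deriv_I ^^ j) x differentiable (at t within {0..1})"
    using assms by (auto simp: C_space_def differentiable_on_def)
  then show ?thesis
    unfolding vector_derivative_works using assms(3) by (simp add: deriv_I_def)
qed

lemma deriv_I_eqI:
  assumes "t \<in> {0..1}" "(x has_vector_derivative d) (at t within {0..1})"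
  shows "deriv_I x t = d"
  using vector_derivative_within_cbox[of 0 1 t x d] assms by (simp add: deriv_I_def)

lemma deriv_I_power_add:
  assumes "x \<in> C_space i" "y \<in> C_space i" "j \<le> i"
  shows "(deriv_I ^^ j) (\<lambda>t. x t + y t) = (\<lambda>t. (deriv_I ^^ j) x t + (deriv_I ^^ j) y t)"
  using assms(3)
proof (induction j)
  case (Suc j)
  show ?case
  proof
    fix t
    show "(deriv_I ^^ Suc j) (\<lambda>t. x t + y t) t
        = (deriv_I ^^ Suc j) x t + (deriv_I ^^ Suc j) y t"
    proof (cases "t \<in> {0..1}")
      case True
      have "((\<lambda>t. (deriv_I ^^ j) x t + (deriv_I ^^ j) y t) has_vector_derivative
          (deriv_I ^^ Suc j) x t + (deriv_I ^^ Suc j) y t) (at t within {0..1})"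
        using Suc.prems
        by (intro has_vector_derivative_add C_space_has_vector_derivative[OF assms(1) _ True]
              C_space_has_vector_derivative[OF assms(2) _ True]) simp_all
      from deriv_I_eqI[OF True this] show ?thesis
        using Suc.prems by (simp add: Suc.IH)
    next
      case False
      then show ?thesis by (simp add: deriv_I_def del: atLeastAtMost_iff)
    qed
  qed
qed simp

lemma deriv_I_power_scaleR:
  assumes "x \<in> C_space i" "j \<le> i"
  shows "(deriv_I ^^ j) (\<lambda>t. c *\<^sub>R x t) = (\<lambda>t. c *\<^sub>R (deriv_I ^^ j) x t)"
  using assms(2)
proof (induction j)
  case (Suc j)
  show ?case
  proof
    fix t
    show "(deriv_I ^^ Suc j) (\<lambda>t. c *\<^sub>R x t) t = c *\<^sub>R (deriv_I ^^ Suc j) x t"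
    proof (cases "t \<in> {0..1}")
      case True
      have "((deriv_I ^^ j) x has_vector_derivative (deriv_I ^^ Suc j) x t) (at t within {0..1})"
        using Suc.prems by (intro C_space_has_vector_derivative[OF assms(1) _ True]) simp
      then have "((\<lambda>t. c *\<^sub>R (deriv_I ^^ j) x t) has_vector_derivative
          c *\<^sub>R (deriv_I ^^ Suc j) x t) (at t within {0..1})"
        by (rule bounded_linear.has_vector_derivative[OF bounded_linear_scaleR_right])
      from deriv_I_eqI[OF True this] show ?thesis
        using Suc.prems by (simp add: Suc.IH)
    next
      case False
      then show ?thesis by (simp add: deriv_I_def del: atLeastAtMost_iff)
    qed
  qed
qed simp

lemma C_space_add:
  assumes "x \<in> C_space i" "y \<in> C_space i"
  shows "(\<lambda>t. x t + y t) \<in> C_space i"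
  unfolding C_space_def
proof (intro CollectI conjI allI impI)
  fix j assume "j < i"
  then show "(deriv_I ^^ j) (\<lambda>t. x t + y t) differentiable_on {0..1}"
    using assms
    by (simp add: deriv_I_power_add[OF assms]) (intro differentiable_on_add; simp add: C_space_def)
next
  show "continuous_on {0..1} ((deriv_I ^^ i) (\<lambda>t. x t + y t))"
    unfolding deriv_I_power_add[OF assms order_refl]
    by (intro continuous_on_add C_space_continuous[OF assms(1)] C_space_continuous[OF assms(2)]) simp_all
qed (use assms in \<open>simp add: C_space_def\<close>)

lemma C_space_scaleR:
  assumes "x \<in> C_space i"
  shows "(\<lambda>t. c *\<^sub>R x t) \<in> C_space i"
  unfolding C_space_def
proof (intro CollectI conjI allI impI)
  fix j assume j: "j < i"
  then have "(deriv_I ^^ j) x differentiable_on {0..1}"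
    using assms by (simp add: C_space_def)
  then have "(\<lambda>t. c *\<^sub>R (deriv_I ^^ j) x t) differentiable_on {0..1}"
    unfolding differentiable_on_def by (intro ballI differentiable_scaleR differentiable_const) simp
  then show "(deriv_I ^^ j) (\<lambda>t. c *\<^sub>R x t) differentiable_on {0..1}"
    using j by (simp add: deriv_I_power_scaleR[OF assms])
next
  show "continuous_on {0..1} ((deriv_I ^^ i) (\<lambda>t. c *\<^sub>R x t))"
    unfolding deriv_I_power_scaleR[OF assms order_refl]
    by (intro continuous_on_scaleR continuous_on_const C_space_continuous[OF assms] order_refl)
qed (use assms in \<open>simp add: C_space_def\<close>)

lemma C_per_add:
  assumes "x \<in> C_per i" "y \<in> C_per i"
  shows "(\<lambda>t. x t + y t) \<in> C_per i"
  using assms C_space_add[of x i y] deriv_I_power_add[of x i y] by (auto simp: C_per_def)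

lemma C_per_scaleR:
  assumes "x \<in> C_per i"
  shows "(\<lambda>t. c *\<^sub>R x t) \<in> C_per i"
  using assms C_space_scaleR[of x i c] deriv_I_power_scaleR[of x i _ c] by (auto simp: C_per_def)

lemma deriv_I_const:
  "deriv_I (\<lambda>t. if t \<in> {0..1} then c else 0) = (\<lambda>t. 0)"
proof
  fix t :: real
  show "deriv_I (\<lambda>t. if t \<in> {0..1} then c else 0) t = 0"
  proof (cases "t \<in> {0..1}")
    case True
    have "((\<lambda>t. if t \<in> {0..1} then c else 0) has_vector_derivative 0) (at t within {0..1})"
      by (rule has_vector_derivative_transform[OF True _ has_vector_derivative_const]) auto
    then show ?thesis by (rule deriv_I_eqI[OF True])
  qed (auto simp: deriv_I_def)
qed

lemma deriv_I_power_const: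
  "(deriv_I ^^ j) (\<lambda>t. if t \<in> {0..1} then c else 0) =
     (if j = 0 then (\<lambda>t. if t \<in> {0..1} then c else 0) else (\<lambda>t. 0))"
proof (induction j)
  case (Suc j)
  then show ?case using deriv_I_const[of c] deriv_I_const[of 0] by auto
qed auto

lemma const_in_C_per: "(\<lambda>t. if t \<in> {0..1} then c else 0) \<in> C_per i"
proof -
  let ?k = "\<lambda>t::real. if t \<in> {0..1} then c else 0"
  have "?k differentiable_on {0..1}"
    unfolding differentiable_on_def
  proof
    fix t :: real assume t: "t \<in> {0..1}"
    have "(?k has_vector_derivative 0) (at t within {0..1})"
      by (rule has_vector_derivative_transform[OF t _ has_vector_derivative_const]) auto
    then show "?k differentiable (at t within {0..1})"
      by (rule differentiableI_vector)
  qed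
  then have d: "(deriv_I ^^ j) ?k differentiable_on {0..1}" for j
    unfolding deriv_I_power_const by simp
  show ?thesis
    unfolding C_per_def C_space_def
    using d differentiable_imp_continuous_on[OF d]
    by (simp add: deriv_I_power_const del: atLeastAtMost_iff) simp
qed

lemma zero_in_C_per: "(\<lambda>t. 0) \<in> C_per i"
  using const_in_C_per[of 0 i] by simp

section \<open>\<open>C\<^sup>2\<^sub>p\<^sub>e\<^sub>r\<close> as a normed space\<close>

typedef ('n::finite) c2per = "C_per 2 :: (real \<Rightarrow> real ^ 'n) set"
  using zero_in_C_per by blast

setup_lifting type_definition_c2per

lemma Rep_c2per_C_space: "Rep_c2per x \<in> C_space 2"
  using Rep_c2per[of x] by (simp add: C_per_def)

lemma deriv_bdd:
  assumes "x \<in> C_space i" "j \<le> i"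
  shows "bdd_above ((\<lambda>t. norm ((deriv_I ^^ j) x t)) ` {0..1})"
  by (intro bounded_imp_bdd_above compact_imp_bounded compact_continuous_image
      continuous_on_norm C_space_continuous[OF assms] compact_Icc)

definition C_norm :: "nat \<Rightarrow> (real \<Rightarrow> real ^ 'n) \<Rightarrow> real" where
  "C_norm i x = (\<Sum>j\<le>i. SUP t\<in>{0..1}. norm ((deriv_I ^^ j) x t))"

lemma C_norm_summand_nonneg:
  assumes "x \<in> C_space i" "j \<le> i"
  shows "0 \<le> (SUP t\<in>{0..1}. norm ((deriv_I ^^ j) x t))"
  by (rule cSUP_upper2[OF deriv_bdd[OF assms], of 0]) auto

lemma C_norm_eq_0:
  assumes "x \<in> C_space i" "C_norm i x = 0"
  shows "x = (\<lambda>t. 0)"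
proof
  fix t
  have *: "(SUP t\<in>{0..1}. norm ((deriv_I ^^ j) x t)) = 0" if "j \<le> i" for j
    using assms(2) that C_norm_summand_nonneg[OF assms(1)]
    unfolding C_norm_def by (subst (asm) sum_nonneg_eq_0_iff) auto
  show "x t = 0"
  proof (cases "t \<in> {0..1}")
    case True
    have "norm (x t) \<le> (SUP t\<in>{0..1}. norm ((deriv_I ^^ 0) x t))"
      using cSUP_upper[OF True deriv_bdd[OF assms(1), of 0]] by simp
    then show ?thesis using *[of 0] by simp
  qed (use assms in \<open>simp add: C_space_def\<close>)
qed

lemma C_norm_triangle:
  assumes "x \<in> C_space i" "y \<in> C_space i"
  shows "C_norm i (\<lambda>t. x t + y t) \<le> C_norm i x + C_norm i y"
  unfolding C_norm_def sum.distrib[symmetric]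
proof (intro sum_mono cSUP_least)
  fix j t assume j: "j \<in> {..i}" and t: "t \<in> {0..1::real}"
  have "norm ((deriv_I ^^ j) (\<lambda>t. x t + y t) t) \<le>
      norm ((deriv_I ^^ j) x t) + norm ((deriv_I ^^ j) y t)"
    using deriv_I_power_add[OF assms] j by (simp add: norm_triangle_ineq)
  also have "\<dots> \<le> (SUP t\<in>{0..1}. norm ((deriv_I ^^ j) x t)) +
      (SUP t\<in>{0..1}. norm ((deriv_I ^^ j) y t))"
    using j t assms by (intro add_mono cSUP_upper deriv_bdd) auto
  finally show "norm ((deriv_I ^^ j) (\<lambda>t. x t + y t) t) \<le> \<dots>" .
qed auto

lemma C_norm_scaleR:
  assumes "x \<in> C_space i"
  shows "C_norm i (\<lambda>t. c *\<^sub>R x t) = \<bar>c\<bar> * C_norm i x"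
proof -
  have "(SUP t\<in>{0..1}. norm ((deriv_I ^^ j) (\<lambda>t. c *\<^sub>R x t) t)) =
      \<bar>c\<bar> * (SUP t\<in>{0..1}. norm ((deriv_I ^^ j) x t))" if "j \<le> i" for j
  proof -
    have "(SUP t\<in>{0..1}. norm ((deriv_I ^^ j) (\<lambda>t. c *\<^sub>R x t) t)) =
        (SUP s\<in>(\<lambda>t. norm ((deriv_I ^^ j) x t)) ` {0..1}. \<bar>c\<bar> * s)"
      using deriv_I_power_scaleR[OF assms that] by (simp add: image_image)
    also have "\<dots> = \<bar>c\<bar> * (SUP t\<in>{0..1}. norm ((deriv_I ^^ j) x t))"
      by (rule continuous_at_Sup_mono[symmetric])
         (use deriv_bdd[OF assms that] in \<open>auto intro!: monoI mult_left_mono continuous_intros\<close>)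
    finally show ?thesis .
  qed
  then show ?thesis by (simp add: C_norm_def sum_distrib_left)
qed

instantiation c2per :: (finite) real_vector
begin

lift_definition zero_c2per :: "'a c2per" is "\<lambda>t. 0"
  by (rule zero_in_C_per)

lift_definition plus_c2per :: "'a c2per \<Rightarrow> 'a c2per \<Rightarrow> 'a c2per" is "\<lambda>x y t. x t + y t"
  by (rule C_per_add)

lift_definition scaleR_c2per :: "real \<Rightarrow> 'a c2per \<Rightarrow> 'a c2per" is "\<lambda>c x t. c *\<^sub>R x t"
  by (rule C_per_scaleR)

definition uminus_c2per :: "'a c2per \<Rightarrow> 'a c2per" where
  "uminus_c2per x = (-1) *\<^sub>R x"

definition minus_c2per :: "'a c2per \<Rightarrow> 'a c2per \<Rightarrow> 'a c2per" where
  "minus_c2per x y = x + (-1) *\<^sub>R y"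

instance
proof
  fix x y z :: "'a c2per" and a b :: real
  show "x + y + z = x + (y + z)" by transfer (simp add: add.assoc)
  show "x + y = y + x" by transfer (simp add: add.commute)
  show "0 + x = x" by transfer simp
  show "- x + x = 0" unfolding uminus_c2per_def by transfer simp
  show "x - y = x + - y" by (simp add: uminus_c2per_def minus_c2per_def)
  show "a *\<^sub>R (x + y) = a *\<^sub>R x + a *\<^sub>R y" by transfer (simp add: algebra_simps)
  show "(a + b) *\<^sub>R x = a *\<^sub>R x + b *\<^sub>R x" by transfer (simp add: algebra_simps)
  show "a *\<^sub>R b *\<^sub>R x = (a * b) *\<^sub>R x" by transfer simp
  show "1 *\<^sub>R x = x" by transfer simp
qed

end

instantiation c2per :: (finite) real_normed_vector
begin

definition norm_c2per :: "'a c2per \<Rightarrow> real" where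
  "norm_c2per x = C_norm 2 (Rep_c2per x)"

definition dist_c2per :: "'a c2per \<Rightarrow> 'a c2per \<Rightarrow> real" where
  "dist_c2per x y = norm (x - y)"

definition sgn_c2per :: "'a c2per \<Rightarrow> 'a c2per" where
  "sgn_c2per x = x /\<^sub>R norm x"

definition uniformity_c2per :: "('a c2per \<times> 'a c2per) filter" where
  "uniformity_c2per = (INF e\<in>{0<..}. principal {(x, y). dist x y < e})"

definition open_c2per :: "'a c2per set \<Rightarrow> bool" where
  "open_c2per U \<longleftrightarrow> (\<forall>x\<in>U. \<forall>\<^sub>F (x', y) in uniformity. x' = x \<longrightarrow> y \<in> U)"

instance
proof
  fix x y :: "'a c2per" and a :: real
  show "dist x y = norm (x - y)" by (rule dist_c2per_def)
  show "sgn x = x /\<^sub>R norm x" by (rule sgn_c2per_def)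
  show "(uniformity :: ('a c2per \<times> 'a c2per) filter) =
      (INF e\<in>{0<..}. principal {(x, y). dist x y < e})"
    by (rule uniformity_c2per_def)
  show "open U \<longleftrightarrow> (\<forall>x\<in>U. \<forall>\<^sub>F (x', y) in uniformity. x' = x \<longrightarrow> y \<in> U)"
    for U :: "'a c2per set"
    by (rule open_c2per_def)
  show "(norm x = 0) = (x = 0)"
  proof
    assume "norm x = 0"
    then have "Rep_c2per x = (\<lambda>t. 0)"
      by (intro C_norm_eq_0[OF Rep_c2per_C_space]) (simp add: norm_c2per_def)
    then show "x = 0" by transfer
  next
    assume "x = 0"
    then have "x = 0 *\<^sub>R x" by transfer simp
    then have "Rep_c2per x = (\<lambda>t. 0 *\<^sub>R Rep_c2per x t)" by transfer
    then show "norm x = 0"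
      using C_norm_scaleR[OF Rep_c2per_C_space, of 0 x] by (simp add: norm_c2per_def)
  qed
  show "norm (x + y) \<le> norm x + norm y"
    using C_norm_triangle[OF Rep_c2per_C_space Rep_c2per_C_space, of x y]
    by (simp add: norm_c2per_def plus_c2per.rep_eq)
  show "norm (a *\<^sub>R x) = \<bar>a\<bar> * norm x"
    using C_norm_scaleR[OF Rep_c2per_C_space, of a x]
    by (simp add: norm_c2per_def scaleR_c2per.rep_eq)
qed

end

section \<open>The functional \<open>\<F>\<close>\<close>

definition C2per_mean0 :: "('n::finite) c2per set" where
  "C2per_mean0 = {x. mean (Rep_c2per x) = 0}"

definition C2per_nonvanishing :: "('n::finite) c2per set" where
  "C2per_nonvanishing = {x. \<forall>t\<in>{0..1}. Rep_c2per x t \<noteq> 0}"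

definition D_op :: "('n::finite) c2per \<Rightarrow> real \<Rightarrow> real ^ 'n" where
  "D_op x = deriv_I (deriv_I (Rep_c2per x))"

definition D_inv :: "(real \<Rightarrow> real ^ 'n) \<Rightarrow> ('n::finite) c2per" where
  "D_inv = the_inv_into C2per_mean0 D_op"

text \<open>The constant function \<open>Q(x)\<close>; the argument ranges over \<open>C\<^sup>0\<close>.\<close>

lift_definition Q_op :: "(real \<Rightarrow> real ^ 'n) \<Rightarrow> ('n::finite) c2per" is
  "\<lambda>x t. if t \<in> {0..1} then mean x else 0"
  by (rule const_in_C_per)

definition P_op :: "(real \<Rightarrow> real ^ 'n) \<Rightarrow> real \<Rightarrow> real ^ 'n" where
  "P_op x = (\<lambda>t. x t - Rep_c2per (Q_op x) t)"

definition N_op :: "real \<Rightarrow> (real \<Rightarrow> real ^ 'n) \<Rightarrow> real \<Rightarrow> real ^ 'n" where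
  "N_op q x = (\<lambda>t. x t /\<^sub>R (norm (x t) powr (q + 1)))"

text \<open>In the middle summand \<open>Px\<close> is taken in \<open>C\<^sup>2\<^sub>p\<^sub>e\<^sub>r\<close>, in the last one \<open>PNx\<close> is taken in \<open>C\<^sup>0\<close>.\<close>

definition F_op :: "real \<Rightarrow> ('n::finite) c2per \<Rightarrow> 'n c2per" where
  "F_op q x = Q_op (N_op q (Rep_c2per x)) + (x - Q_op (Rep_c2per x))
     - D_inv (P_op (N_op q (Rep_c2per x)))"

section \<open>Residual sets\<close>

definition residual_in :: "'a topology \<Rightarrow> 'a set \<Rightarrow> bool" where
  "residual_in X S \<longleftrightarrow> S \<subseteq> topspace X \<and>
     (\<exists>\<U>. countable \<U> \<and> (\<forall>T\<in>\<U>. openin X T \<and> X closure_of T = topspace X) \<and>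
          topspace X \<inter> \<Inter>\<U> \<subseteq> S)"

section \<open>Leray--Schauder degree\<close>

text \<open>
  Determinant of (the restriction to \<open>span B\<close> of) an endomorphism \<open>L\<close>, for a finite linearly
  independent set \<open>B\<close>: the Leibniz formula of \<^const>\<open>det\<close>, applied to the matrix of \<open>L\<close> with
  respect to \<open>B\<close>. The index set has to be a set because the dimension varies below.
\<close>

definition det_on :: "'a::real_vector set \<Rightarrow> ('a \<Rightarrow> 'a) \<Rightarrow> real" where
  "det_on B L = (\<Sum>p | p permutes B.
     of_int (sign p) * (\<Prod>b\<in>B. representation B (L b) (p b)))"

text \<open>
  Brouwer degree of \<open>f : closure W \<rightarrow> span B\<close> at \<open>y\<close>, where \<open>W\<close> is a bounded, relatively open
  subset of the finite-dimensional space \<open>span B\<close>: approximate \<open>f\<close> by a map \<open>g\<close> that is \<open>C\<^sup>1\<close> on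
  \<open>W\<close> and has \<open>y\<close> as a regular value, closer than the distance from \<open>y\<close> to \<open>f(\<partial>W)\<close>, and count
  the solutions of \<open>g x = y\<close> with the signs of the Jacobian determinants. The distance is
  expressed through a lower bound \<open>\<delta>\<close> since \<open>\<partial>W\<close> may be empty. \<open>\<partial>W\<close> is the boundary relative
  to \<open>span B\<close>, that is \<open>closure W - W\<close>.
\<close>

definition brouwer_approx ::
  "'a::real_normed_vector set \<Rightarrow> 'a set \<Rightarrow> ('a \<Rightarrow> 'a) \<Rightarrow> 'a \<Rightarrow> ('a \<Rightarrow> 'a) \<Rightarrow> ('a \<Rightarrow> 'a \<Rightarrow> 'a) \<Rightarrow> bool"
where
  "brouwer_approx B W f y g g' \<longleftrightarrow>
     continuous_on (closure W) g \<and> g ` closure W \<subseteq> span B \<and>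
     (\<forall>x\<in>W. (g has_derivative g' x) (at x within span B)) \<and>
     (\<forall>v\<in>span B. continuous_on W (\<lambda>x. g' x v)) \<and>
     (\<exists>\<delta>. (\<forall>x\<in>closure W - W. \<delta> \<le> dist (f x) y) \<and> (\<forall>x\<in>closure W. dist (g x) (f x) < \<delta>)) \<and>
     (\<forall>x\<in>W. g x = y \<longrightarrow> det_on B (g' x) \<noteq> 0)"

text \<open>
  The degree is the common value furnished by all admissible approximations; classically these
  exist and all give the same value. As with \<^const>\<open>has_integral\<close>, the degree is introduced as a
  relation which also expresses that the degree is defined.
\<close>

definition has_brouwer_degree ::
  "'a::real_normed_vector set \<Rightarrow> ('a \<Rightarrow> 'a) \<Rightarrow> 'a set \<Rightarrow> 'a \<Rightarrow> int \<Rightarrow> bool" where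
  "has_brouwer_degree B f W y d \<longleftrightarrow>
     finite B \<and> independent B \<and>
     openin (top_of_set (span B)) W \<and> bounded W \<and>
     continuous_on (closure W) f \<and> f ` closure W \<subseteq> span B \<and>
     y \<in> span B \<and> y \<notin> f ` (closure W - W) \<and>
     (\<exists>g g'. brouwer_approx B W f y g g') \<and>
     (\<forall>g g'. brouwer_approx B W f y g g' \<longrightarrow>
        (\<Sum>x | x \<in> W \<and> g x = y. sgn (det_on B (g' x))) = of_int d)"

text \<open>
  Leray--Schauder degree of \<open>F\<close> on the bounded open set \<open>U\<close> at \<open>y\<close>, where \<open>F = id - K\<close> on
  \<open>closure U\<close> with \<open>K\<close> compact: approximate \<open>K\<close> uniformly by maps \<open>K'\<close> with finite-dimensional
  range, closer than the distance from \<open>y\<close> to \<open>F(\<partial>U)\<close>, and take the Brouwer degree of \<open>id - K'\<close>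
  on \<open>U \<inter> V\<close>, for a finite-dimensional space \<open>V = span B\<close> containing \<open>y\<close> and the range of \<open>K'\<close>.
\<close>

definition ls_approx ::
  "('a::real_normed_vector \<Rightarrow> 'a) \<Rightarrow> 'a set \<Rightarrow> 'a \<Rightarrow> ('a \<Rightarrow> 'a) \<Rightarrow> 'a set \<Rightarrow> bool" where
  "ls_approx F U y K' B \<longleftrightarrow>
     finite B \<and> independent B \<and> y \<in> span B \<and>
     continuous_on (closure U) K' \<and> K' ` closure U \<subseteq> span B \<and>
     (\<exists>\<epsilon>. (\<forall>x\<in>frontier U. \<epsilon> \<le> dist (F x) y) \<and> (\<forall>x\<in>closure U. dist (K' x) (x - F x) < \<epsilon>))"

definition has_LS_degree ::
  "('a::real_normed_vector \<Rightarrow> 'a) \<Rightarrow> 'a set \<Rightarrow> 'a \<Rightarrow> int \<Rightarrow> bool" where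
  "has_LS_degree F U y d \<longleftrightarrow>
     open U \<and> bounded U \<and>
     continuous_on (closure U) (\<lambda>x. x - F x) \<and>
     compact (closure ((\<lambda>x. x - F x) ` closure U)) \<and>
     y \<notin> F ` frontier U \<and>
     (\<exists>K' B. ls_approx F U y K' B) \<and>
     (\<forall>K' B. ls_approx F U y K' B \<longrightarrow>
        has_brouwer_degree B (\<lambda>x. x - K' x) (U \<inter> span B) y d)"

lemma has_brouwer_degree_unique:
  assumes "has_brouwer_degree B f W y d" "has_brouwer_degree B f W y d'"
  shows "d = d'"
  using assms unfolding has_brouwer_degree_def by (metis of_int_eq_iff)

lemma has_LS_degree_unique:
  assumes "has_LS_degree F U y d" "has_LS_degree F U y d'"
  shows "d = d'"
  using assms has_brouwer_degree_unique unfolding has_LS_degree_def by metis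

end

theory Submission
  imports Defs "HOL-Complex_Analysis.Great_Picard" "Jordan_Normal_Form.Determinant"
begin

text \<open>
  \<open>\<F>\<close> is a compact perturbation of the identity, and \<open>x'' - mean x\<close> turns \<open>C\<^sup>2\<^sub>p\<^sub>e\<^sub>r\<close> into \<open>C\<^sup>0\<close>
  and \<open>\<F>\<close> into \<open>x'' - N x\<close>. \<open>\<Sigma>\<^sup>2\<close> consists of the regular values of \<open>\<F>\<close> with mean \<open>0\<close>. It is residual
  by a Sard--Smale argument: near a point \<open>x\<^sub>0\<close> a finite-rank operator \<open>R\<close> makes \<open>\<F>'(x\<^sub>0) + R\<close>
  invertible, and \<open>\<F> x = y + w\<close> with \<open>w\<close> in the range of \<open>R\<close> becomes an equation in finitely
  many unknowns, to which the classical Sard theorem applies. As \<open>N'(x)\<close> is pointwise invertible,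
  \<open>R\<close> can be chosen with values of mean \<open>0\<close>, so that \<open>y + w\<close> does not leave the subspace.
  At a regular value the solutions in \<open>O\<close> are nondegenerate. If the compact part \<open>id - \<F>\<close> is replaced
  by a \<open>C\<^sup>1\<close>-close map of finite rank, there remains at most one zero near each solution and none
  elsewhere, and the degree, a sum of signs over these zeros, is at most the number of solutions.
\<close>

section \<open>Determinants on a finite basis\<close>

text \<open>The degree relation speaks about every admissible approximation, so a single finite-rank
  map that is C1-close to \<open>id - F\<close> already fixes the number m. The space
  \<open>c2per\<close> enters only as a normed space: every limit comes from compactness of the part
  beside the identity. In place of an implicit function, the Sard argument uses a solution map that
  lives only on the parameters coming from critical points and is differentiated within that set.
  The nonlinearity is unbounded near functions with zeros, so all estimates are made on closed
  levels \<open>c2per_level k\<close> that exhaust the domain; the critical values of one level form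
  a closed set, and the countably many complements are the open dense sets of a residual set. A
  bounded set whose closure lies in the domain could still approach functions with zeros; the
  compactness that is part of the degree excludes this and puts the set into one level. Kernel
  elements of the linearised equation are determined by v(0) and v'(0), hence 2n parameters suffice
  at every point, and one type \<open>real ^ ('n bit0)\<close> serves throughout.\<close>

lemma det_on_eq_det:
  fixes L :: "'a::real_vector \<Rightarrow> 'a"
  assumes h: "bij_betw h {0..<n} B"
  shows "det_on B L = Determinant.det (Matrix.mat n n (\<lambda>(i, j). representation B (L (h i)) (h j)))"
proof -
  let ?h' = "inv_into {0..<n} h"
  have h': "bij_betw ?h' B {0..<n}" using h by (rule bij_betw_inv_into)
  have inj: "inj_on h {0..<n}" using h by (rule bij_betw_imp_inj_on)
  \<comment> \<open>Conjugation with the numbering \<open>h\<close> matches permutations of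
    \<open>B\<close> with permutations of the indices and preserves signs. Row i of the matrix holds
    the coordinates of \<open>L (h i)\<close>, so it is the transpose of the usual matrix of
    \<open>L\<close>.\<close>
  have "det_on B L = (\<Sum>p | p permutes {0..<n}. of_int (sign p) *
      (\<Prod>i = 0..<n. representation B (L (h i)) (h (p i))))"
    unfolding det_on_def
  proof (rule sum.reindex_bij_witness
      [of _ "map_permutation {0..<n} h" "map_permutation B ?h'"])
    fix p assume p: "p \<in> {p. p permutes B}"
    show "map_permutation {0..<n} h (map_permutation B ?h' p) = p"
      using p by (intro map_permutation_compose_inv[OF h'])
        (auto simp: f_inv_into_f[of _ h] bij_betw_imp_surj_on[OF h])
    show "map_permutation B ?h' p \<in> {p. p permutes {0..<n}}"
      using map_permutation_permutes[OF h'] p by auto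
    have fB: "finite B" using h bij_betw_finite by blast
    have s: "sign (map_permutation B ?h' p) = sign p"
      using p fB h' by (intro sign_map_permutation) (auto simp: bij_betw_def)
    have "(\<Prod>b\<in>B. representation B (L b) (p b)) =
        (\<Prod>i = 0..<n. representation B (L (h i)) (p (h i)))"
      by (rule prod.reindex_bij_betw[OF h, symmetric])
    also have "\<dots> = (\<Prod>i = 0..<n. representation B (L (h i)) (h (map_permutation B ?h' p i)))"
    proof (rule prod.cong[OF refl])
      fix i assume i: "i \<in> {0..<n}"
      then have hi: "h i \<in> B" using h bij_betwE by blast
      have "map_permutation B ?h' p (?h' (h i)) = ?h' (p (h i))"
        by (rule map_permutation_apply) (use h' hi in \<open>auto simp: bij_betw_def\<close>)
      then have "map_permutation B ?h' p i = ?h' (p (h i))"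
        using i inj by simp
      moreover have "p (h i) \<in> B" using p hi by (simp add: permutes_in_image)
      ultimately show "representation B (L (h i)) (p (h i)) =
          representation B (L (h i)) (h (map_permutation B ?h' p i))"
        using bij_betw_imp_surj_on[OF h] by (simp add: f_inv_into_f)
    qed
    finally show "of_int (sign (map_permutation B ?h' p)) *
         (\<Prod>i = 0..<n. representation B (L (h i)) (h (map_permutation B ?h' p i))) =
         of_int (sign p) * (\<Prod>b\<in>B. representation B (L b) (p b))"
      using s by simp
  next
    fix p assume p: "p \<in> {p. p permutes {0..<n}}"
    show "map_permutation B ?h' (map_permutation {0..<n} h p) = p"
      using p inj by (intro map_permutation_compose_inv[OF h]) auto
    show "map_permutation {0..<n} h p \<in> {p. p permutes B}"
      using map_permutation_permutes[OF h] p by auto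
  qed
  then show ?thesis
    by (subst det_def'[of _ n]) (auto intro!: sum.cong prod.cong simp: permutes_in_image)
qed

text \<open>If the determinant vanished, a null vector of the transposed matrix would be the
  coordinate vector of some nonzero \<open>u\<close> in the span with
  \<open>L u = 0\<close>.\<close>

lemma det_on_nonzero:
  fixes L :: "'a::real_vector \<Rightarrow> 'a"
  assumes B: "finite B" "independent B" and lin: "linear L"
    and into: "L ` span B \<subseteq> span B"
    and inj: "\<And>v. v \<in> span B \<Longrightarrow> L v = 0 \<Longrightarrow> v = 0"
  shows "det_on B L \<noteq> 0"
proof
  assume 0: "det_on B L = 0"
  obtain h where h: "bij_betw h {0..<card B} B"
    using ex_bij_betw_nat_finite[OF B(1)] by blast
  define n where "n = card B"
  define A where "A = Matrix.mat n n (\<lambda>(i, j). representation B (L (h i)) (h j))"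
  have A: "A \<in> carrier_mat n n" by (simp add: A_def)
  have "Determinant.det (transpose_mat A) = 0"
    using det_on_eq_det[OF h, of L] 0 det_transpose[OF A] by (simp add: A_def n_def)
  then obtain v where v: "v \<in> carrier_vec n" "v \<noteq> 0\<^sub>v n" "transpose_mat A *\<^sub>v v = 0\<^sub>v n"
    using det_0_iff_vec_prod_zero[of "transpose_mat A" n] A by auto
  define u where "u = (\<Sum>i<n. vec_index v i *\<^sub>R h i)"
  have hB: "h i \<in> B" if "i < n" for i
    using bij_betwE[OF h] that by (auto simp: n_def)
  have u: "u \<in> span B"
    unfolding u_def by (intro span_sum span_scale span_base hB) auto
  have Lh: "L (h i) \<in> span B" if "i < n" for i
    using into hB[OF that] span_base by blast
  have Lu: "L u = (\<Sum>i<n. vec_index v i *\<^sub>R L (h i))"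
    by (simp add: u_def linear_sum[OF lin] linear_scale[OF lin])
  have "representation B (L u) (h j) = 0" if j: "j < n" for j
  proof -
    have "representation B (L u) (h j) = (\<Sum>i<n. vec_index v i * representation B (L (h i)) (h j))"
      unfolding Lu by (subst representation_sum[OF B(2)])
        (auto simp: representation_scale[OF B(2)] Lh span_scale)
    also have "\<dots> = vec_index (transpose_mat A *\<^sub>v v) j"
      using A v(1) j by (auto simp: scalar_prod_def A_def mult.commute lessThan_atLeast0 intro!: sum.cong)
    finally show ?thesis using v(3) j by simp
  qed
  then have "representation B (L u) b = 0" if "b \<in> B" for b
    using that bij_betw_imp_surj_on[OF h] by (metis atLeastLessThan_iff imageE n_def)
  moreover have "L u \<in> span B" using into u by blast
  ultimately have "L u = 0"
    using sum_representation_eq[OF B(2) _ B(1) order_refl, of "L u"] by simp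
  then have "u = 0" using inj u by blast
  have "representation B u (h j) = vec_index v j" if j: "j < n" for j
  proof -
    have "representation B u (h j) = (\<Sum>i<n. vec_index v i * representation B (h i) (h j))"
      unfolding u_def by (subst representation_sum[OF B(2)])
        (auto simp: representation_scale[OF B(2)] span_base hB span_scale)
    also have "\<dots> = (\<Sum>i<n. if i = j then vec_index v i else 0)"
    proof (rule sum.cong[OF refl])
      fix i assume i: "i \<in> {..<n}"
      have "h i = h j \<longleftrightarrow> i = j"
        using h i j by (auto simp: bij_betw_def n_def inj_on_def)
      then show "vec_index v i * representation B (h i) (h j) = (if i = j then vec_index v i else 0)"
        using representation_basis[OF B(2) hB, of i] i by auto
    qed
    finally show ?thesis using j by simp
  qed
  then have "v = 0\<^sub>v n"
    using v(1) \<open>u = 0\<close> by (intro eq_vecI) (auto simp: representation_zero)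
  then show False using v(2) by blast
qed

section \<open>Compact perturbations of the identity\<close>

text \<open>Dimension count: a vector of the span outside the image could be added to the image of a
  basis \<open>C\<close>, giving more than \<open>card C\<close> independent vectors in
  \<open>span C\<close>. The set \<open>B\<close> may be dependent, hence the passage to
  \<open>C\<close>.\<close>

lemma linear_inj_on_span_imp_surj:
  fixes H :: "'a::real_vector \<Rightarrow> 'a"
  assumes "finite B" "linear H" and into: "H ` span B \<subseteq> span B"
    and inj: "\<And>v. v \<in> span B \<Longrightarrow> H v = 0 \<Longrightarrow> v = 0"
  shows "H ` span B = span B"
proof -
  obtain C where C: "C \<subseteq> B" "independent C" "B \<subseteq> span C"
    using maximal_independent_subset[of B] by blast
  have sp: "span C = span B"
    using C span_mono[OF C(1)] span_minimal[OF C(3) subspace_span] by blast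
  have fC: "finite C" using C(1) assms(1) finite_subset by blast
  have inj_on: "inj_on H (span C)"
    unfolding linear_inj_on_iff_eq_0[OF assms(2) subspace_span] sp using inj by blast
  have ind: "independent (H ` C)"
    by (rule linear_independent_injective_image[OF assms(2) C(2) inj_on])
  have im: "span (H ` C) = H ` span C"
    by (rule linear_span_image[OF assms(2)])
  have card: "card (H ` C) = card C"
    by (rule card_image[OF inj_on_subset[OF inj_on span_superset]])
  have "g \<in> H ` span C" if g: "g \<in> span C" for g
  proof (rule ccontr)
    assume "g \<notin> H ` span C"
    then have gn: "g \<notin> span (H ` C)" by (simp add: im)
    then have "independent (insert g (H ` C))"
      by (rule independent_insertI[OF _ ind])
    moreover have "insert g (H ` C) \<subseteq> span C"
      using g into[folded sp] span_superset[of C] by blast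
    ultimately have "card (insert g (H ` C)) \<le> card C"
      by (rule independent_span_bound[OF fC, THEN conjunct2])
    moreover have "g \<notin> H ` C" using gn span_superset[of "H ` C"] by (auto simp only: subset_iff)
    ultimately show False using card fC by simp
  qed
  then show ?thesis using into unfolding sp by blast
qed

text \<open>Otherwise there are unit vectors with images tending to 0. Compactness of
  \<open>id - T\<close>, stated by sequences, makes a subsequence of these vectors themselves
  converge, and the limit is a unit vector in the kernel.\<close>

lemma compact_perturbation_bounded_below:
  fixes T :: "'a::real_normed_vector \<Rightarrow> 'a"
  assumes T: "bounded_linear T"
    and cpt: "\<And>V :: nat \<Rightarrow> 'a. (\<And>j. norm (V j) \<le> 1) \<Longrightarrow>
      \<exists>l r. strict_mono (r :: nat \<Rightarrow> nat) \<and> (\<lambda>j. V (r j) - T (V (r j))) \<longlonglongrightarrow> l"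
    and inj: "\<And>v. T v = 0 \<Longrightarrow> v = 0"
  shows "\<exists>c>0. \<forall>v. c * norm v \<le> norm (T v)"
proof (rule ccontr)
  interpret T: bounded_linear T by (rule T)
  assume "\<not> ?thesis"
  then have "\<forall>j::nat. \<exists>v. norm (T v) < inverse (real (Suc j)) * norm v"
    by (force simp: not_le)
  then obtain u where u: "\<And>j. norm (T (u j)) < inverse (real (Suc j)) * norm (u j)" by metis
  define V where "V j = u j /\<^sub>R norm (u j)" for j
  have u0: "norm (u j) > 0" for j
    using u[of j] by (metis T.zero norm_zero mult_zero_right less_irrefl zero_less_norm_iff)
  have V1: "norm (V j) = 1" for j using u0[of j] by (simp add: V_def)
  have TV: "norm (T (V j)) \<le> inverse (real (Suc j))" for j
  proof -
    have "norm (T (V j)) = norm (T (u j)) / norm (u j)"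
      using u0[of j] by (simp add: V_def T.scaleR divide_inverse mult.commute)
    then show ?thesis using u[of j] u0[of j] by (simp add: pos_divide_le_eq)
  qed
  obtain l r where r: "strict_mono (r :: nat \<Rightarrow> nat)" "(\<lambda>j. V (r j) - T (V (r j))) \<longlonglongrightarrow> l"
    using cpt[of V] V1 by (metis order_refl)
  have "(\<lambda>j. T (V j)) \<longlonglongrightarrow> 0"
    by (rule Lim_null_comparison[OF _ LIMSEQ_inverse_real_of_nat]) (use TV in auto)
  then have T0: "(\<lambda>j. T (V (r j))) \<longlonglongrightarrow> 0"
    using LIMSEQ_subseq_LIMSEQ[OF _ r(1)] by (fastforce simp: o_def)
  have Vl: "(\<lambda>j. V (r j)) \<longlonglongrightarrow> l"
    using tendsto_add[OF r(2) T0] by simp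
  have "norm l = 1"
    using tendsto_norm[OF Vl] V1 by (simp add: LIMSEQ_const_iff)
  moreover have "T l = 0"
    using LIMSEQ_unique[OF T.tendsto[OF Vl] T0] .
  ultimately show False using inj by fastforce
qed

text \<open>Solutions of the finite-dimensional approximations converge to a solution.\<close>

lemma compact_perturbation_surj:
  fixes T :: "'a::real_normed_vector \<Rightarrow> 'a"
  assumes T: "bounded_linear T"
    and cpt: "\<And>V :: nat \<Rightarrow> 'a. (\<And>j. norm (V j) \<le> 1) \<Longrightarrow>
      \<exists>l r. strict_mono (r :: nat \<Rightarrow> nat) \<and> (\<lambda>j. V (r j) - T (V (r j))) \<longlonglongrightarrow> l"
    and inj: "\<And>v. T v = 0 \<Longrightarrow> v = 0"
    and approx: "\<And>e. e > 0 \<Longrightarrow> \<exists>G B. finite B \<and> linear G \<and> range G \<subseteq> span B \<and>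
      (\<forall>v. norm (G v - (v - T v)) \<le> e * norm v)"
  shows "surj T"
proof (rule surjI)
  interpret T: bounded_linear T by (rule T)
  obtain c where c: "c > 0" "\<And>v. c * norm v \<le> norm (T v)"
    using compact_perturbation_bounded_below[OF T cpt inj] by blast
  have ex: "\<exists>u. T u = g" for g
  proof -
    \<comment> \<open>The errors tend to 0, and staying below \<open>c / 2\<close> leaves enough of
      the lower bound \<open>c\<close> to make each approximation \<open>H\<close>
      injective.\<close>
    define e where "e j = c / 2 * inverse (real (Suc j))" for j
    have e: "e j > 0" "e j \<le> c / 2" for j using c(1) by (auto simp: e_def field_simps)
    have "\<exists>u. norm (g - T u) \<le> e j * norm u" for j
    proof -
      obtain G B where G: "finite B" "linear G" "range G \<subseteq> span B"
        "\<And>v. norm (G v - (v - T v)) \<le> e j * norm v"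
        using approx[OF e(1)] by metis
      define H where "H v = v - G v" for v
      have H: "linear H"
        unfolding H_def using G(2) by (intro linear_compose_sub linear_ident)
      have HT: "norm (H v - T v) \<le> e j * norm v" for v
        using G(4)[of v] by (simp add: H_def algebra_simps norm_minus_commute)
      \<comment> \<open>\<open>H v\<close> differs from \<open>v\<close> by an element of
        \<open>span B\<close>, so every space containing \<open>B\<close> is invariant; inserting
        \<open>g\<close> makes the equation \<open>H u = g\<close> solvable inside it.\<close>
      have "H ` span (insert g B) = span (insert g B)"
      proof (rule linear_inj_on_span_imp_surj[OF _ H])
        show "finite (insert g B)" using G(1) by simp
        show "H ` span (insert g B) \<subseteq> span (insert g B)"
          using G(3) span_mono[of B "insert g B"] by (auto simp: H_def intro!: span_diff)
        fix v assume "H v = 0"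
        then have "c * norm v \<le> e j * norm v"
          using HT[of v] c(2)[of v] by simp
        also have "\<dots> \<le> c / 2 * norm v" using e(2) by (intro mult_right_mono) auto
        finally show "v = 0" using c(1) by simp
      qed
      then obtain u where "H u = g" by (metis imageE insertI1 span_base)
      then show ?thesis using HT[of u] by auto
    qed
    then obtain u where u: "\<And>j. norm (g - T (u j)) \<le> e j * norm (u j)" by metis
    \<comment> \<open>The bound comes from \<open>c * norm (u j)\<close> being at most
      \<open>norm g + c / 2 * norm (u j)\<close>; the summand 1 makes \<open>M\<close> positive, so
      that the solutions can be scaled into the unit ball.\<close>
    define M where "M = 2 * norm g / c + 1"
    have M: "M > 0" using c(1) by (simp add: M_def add_nonneg_pos)
    have uM: "norm (u j) \<le> M" for j
    proof -
      have "c * norm (u j) \<le> norm (T (u j))" by (rule c)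
      also have "\<dots> \<le> norm g + norm (g - T (u j))" by norm
      also have "\<dots> \<le> norm g + e j * norm (u j)" using u by simp
      also have "\<dots> \<le> norm g + c / 2 * norm (u j)" using e(2) by (intro add_mono mult_right_mono) auto
      finally show ?thesis using c(1) by (simp add: M_def field_simps)
    qed
    obtain l r where r: "strict_mono (r :: nat \<Rightarrow> nat)"
      "(\<lambda>j. u (r j) /\<^sub>R M - T (u (r j) /\<^sub>R M)) \<longlonglongrightarrow> l"
      using cpt[of "\<lambda>j. u j /\<^sub>R M"] uM M by (auto simp: field_simps)
    have l: "(\<lambda>j. u (r j) - T (u (r j))) \<longlonglongrightarrow> M *\<^sub>R l"
      using tendsto_scaleR[OF tendsto_const[of M] r(2)] M
      by (simp add: T.scaleR scaleR_right_diff_distrib)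
    have "(\<lambda>j. g - T (u j)) \<longlonglongrightarrow> 0"
    proof (rule Lim_null_comparison)
      show "\<forall>\<^sub>F j in sequentially. norm (g - T (u j)) \<le> c / 2 * inverse (real (Suc j)) * M"
        using order_trans[OF u mult_left_mono[OF uM less_imp_le[OF e(1)]]] by (simp add: e_def)
      show "(\<lambda>j. c / 2 * inverse (real (Suc j)) * M) \<longlonglongrightarrow> 0"
        using tendsto_mult_left_zero[OF tendsto_mult_right_zero[OF LIMSEQ_inverse_real_of_nat]] .
    qed
    then have g: "(\<lambda>j. g - T (u (r j))) \<longlonglongrightarrow> 0"
      using LIMSEQ_subseq_LIMSEQ[OF _ r(1)] by (fastforce simp: o_def)
    have ug: "(\<lambda>j. u (r j)) \<longlonglongrightarrow> M *\<^sub>R l + g"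
      using tendsto_add[OF tendsto_diff[OF l g] tendsto_const[of g]] by simp
    have "(\<lambda>j. T (u (r j))) \<longlonglongrightarrow> g"
      using tendsto_diff[OF tendsto_const[of g] g] by simp
    then have "T (M *\<^sub>R l + g) = g"
      using LIMSEQ_unique T.tendsto[OF ug] by blast
    then show ?thesis by blast
  qed
  show "T (SOME u. T u = g) = g" for g
    by (rule someI_ex) (rule ex)
qed

text \<open>On a small ball \<open>f - f' x0\<close> is Lipschitz with constant
  \<open>c / 2\<close>, so \<open>f\<close> still expands distances by at least
  \<open>c / 2\<close>. This is the injectivity half of an inverse function theorem and uses no
  completeness.\<close>

lemma C1_locally_bounded_below:
  fixes f :: "'a::real_normed_vector \<Rightarrow> 'b::real_normed_vector"
  assumes "open U" "x0 \<in> U"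
    and der: "\<And>x. x \<in> U \<Longrightarrow> (f has_derivative f' x) (at x)"
    and cont: "\<And>e. e > 0 \<Longrightarrow> \<exists>d>0. \<forall>x\<in>ball x0 d. \<forall>v. norm (f' x v - f' x0 v) \<le> e * norm v"
    and c: "c > 0" "\<And>v. c * norm v \<le> norm (f' x0 v)"
  shows "\<exists>r>0. ball x0 r \<subseteq> U \<and>
    (\<forall>a\<in>ball x0 r. \<forall>b\<in>ball x0 r. c / 2 * norm (a - b) \<le> norm (f a - f b)) \<and>
    (\<forall>x\<in>ball x0 r. \<forall>v. c / 2 * norm v \<le> norm (f' x v))"
proof -
  obtain r0 where r0: "r0 > 0" "ball x0 r0 \<subseteq> U" using assms(1,2) open_contains_ball by blast
  obtain d where d: "d > 0" "\<And>x v. x \<in> ball x0 d \<Longrightarrow> norm (f' x v - f' x0 v) \<le> c / 2 * norm v"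
    using cont[of "c / 2"] c(1) by auto
  define r where "r = min r0 d"
  have r: "r > 0" "ball x0 r \<subseteq> ball x0 r0" "ball x0 r \<subseteq> ball x0 d" using r0 d by (auto simp: r_def)
  have bl: "bounded_linear (f' x0)" using der[OF assms(2)] has_derivative_bounded_linear by blast
  have 1: "c / 2 * norm (a - b) \<le> norm (f a - f b)" if ab: "a \<in> ball x0 r" "b \<in> ball x0 r" for a b
  proof -
    have "norm ((f a - f' x0 a) - (f b - f' x0 b)) \<le> c / 2 * norm (a - b)"
    proof (rule differentiable_bound[OF convex_ball _ _ ab(1,2)])
      fix x assume x: "x \<in> ball x0 r"
      show "((\<lambda>x. f x - f' x0 x) has_derivative (\<lambda>v. f' x v - f' x0 v)) (at x within ball x0 r)"
        using x r(2) r0(2)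
        by (intro has_derivative_diff has_derivative_at_withinI[OF der]
            has_derivative_at_withinI[OF bounded_linear_imp_has_derivative[OF bl]]) auto
      show "onorm (\<lambda>v. f' x v - f' x0 v) \<le> c / 2"
        using c(1) by (intro onorm_bound d(2)) (use x r(3) in auto)
    qed
    moreover have "(f a - f' x0 a) - (f b - f' x0 b) = (f a - f b) - f' x0 (a - b)"
      by (simp add: bounded_linear.linear[OF bl] linear_diff)
    ultimately have "norm ((f a - f b) - f' x0 (a - b)) \<le> c / 2 * norm (a - b)" by simp
    then show ?thesis using c(2)[of "a - b"]
      by (smt (verit) norm_triangle_ineq3 norm_minus_commute mult_2 field_sum_of_halves distrib_right)
  qed
  have 2: "c / 2 * norm v \<le> norm (f' x v)" if "x \<in> ball x0 r" for x v
  proof -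
    have "norm (f' x v - f' x0 v) \<le> c / 2 * norm v" using d(2) that r(3) by blast
    then show ?thesis using c(2)[of v]
      by (smt (verit) norm_triangle_ineq3 norm_minus_commute mult_2 field_sum_of_halves distrib_right)
  qed
  show ?thesis using r r0(2) 1 2 by blast
qed

text \<open>
  Writing \<open>x = X d\<close> for the solution of \<open>F x + w (\<phi> x) = y + w d\<close>, the parameters \<open>s\<close> with
  \<open>F x = y + w s\<close> are the values \<open>d - \<phi> (X d)\<close>, so the finite-dimensional Sard theorem applies.
\<close>

lemma sard_finite_rank_parameter:
  fixes F :: "'a::real_normed_vector \<Rightarrow> 'a"
    and \<phi> :: "'a \<Rightarrow> real ^ 'k::{finite,wellorder}" and w :: "real ^ ('k::{finite,wellorder}) \<Rightarrow> 'a"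
  assumes der: "\<And>x. x \<in> V \<Longrightarrow> (F has_derivative F' x) (at x)"
    and \<phi>: "bounded_linear \<phi>" and w: "bounded_linear w" and c: "c > 0"
    and bil: "\<And>a b. a \<in> V \<Longrightarrow> b \<in> V \<Longrightarrow>
      c * norm (a - b) \<le> norm ((F a + w (\<phi> a)) - (F b + w (\<phi> b)))"
    and low: "\<And>x v. x \<in> V \<Longrightarrow> c * norm v \<le> norm (F' x v + w (\<phi> v))"
    and surj: "\<And>x s. x \<in> V \<Longrightarrow> \<exists>u. F' x u + w (\<phi> u) = w s"
  shows "negligible {s. \<exists>x\<in>V. F x = y + w s \<and> (\<exists>v. v \<noteq> 0 \<and> F' x v = 0)}"
proof -
  interpret \<phi>: bounded_linear \<phi> by (rule \<phi>)
  interpret w: bounded_linear w by (rule w)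
  define \<Psi> where "\<Psi> x = F x + w (\<phi> x)" for x
  define A where "A x v = F' x v + w (\<phi> v)" for x v
  define C where "C = {x \<in> V. \<exists>v. v \<noteq> 0 \<and> F' x v = 0}"
  \<comment> \<open>Only parameters reached from critical points are collected. \<open>D\<close> may
    be an arbitrary set, since Sard's theorem is applied to maps differentiable within
    \<open>D\<close>.\<close>
  define D where "D = {d. \<exists>x\<in>C. \<Psi> x = y + w d}"
  define X where "X d = (SOME x. x \<in> C \<and> \<Psi> x = y + w d)" for d
  define U where "U x s = (SOME u. A x u = w s)" for x s
  have X: "X d \<in> C" "\<Psi> (X d) = y + w d" if "d \<in> D" for d
    using someI_ex[of "\<lambda>x. x \<in> C \<and> \<Psi> x = y + w d"] that by (auto simp: D_def X_def)
  have CV: "x \<in> V" if "x \<in> C" for x using that by (simp add: C_def)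
  have bl: "bounded_linear (A x)" if "x \<in> V" for x
    unfolding A_def using has_derivative_bounded_linear[OF der[OF that]]
    by (intro bounded_linear_add bounded_linear_compose[OF w] \<phi>)
  have der\<Psi>: "(\<Psi> has_derivative A x) (at x)" if "x \<in> V" for x
    unfolding A_def \<Psi>_def using that
    by (intro has_derivative_add der w.has_derivative \<phi>.has_derivative has_derivative_ident)
  have AU: "A x (U x s) = w s" if "x \<in> V" for x s
    using someI_ex[OF surj[OF that, of s, folded A_def]] by (simp add: U_def)
  have A_inj: "a = b" if "x \<in> V" "A x a = A x b" for x a b
  proof -
    have "A x (a - b) = 0" using that bl[OF that(1)] by (simp add: bounded_linear.linear linear_diff)
    then have "c * norm (a - b) \<le> 0" using low[OF that(1), of "a - b"] by (simp add: A_def)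
    then show ?thesis using c by (simp add: mult_le_0_iff)
  qed
  have \<Psi>_inj: "a = b" if "a \<in> V" "b \<in> V" "\<Psi> a = \<Psi> b" for a b
  proof -
    have "c * norm (a - b) \<le> 0" using bil[OF that(1,2)] that(3) by (simp add: \<Psi>_def)
    then show ?thesis using c by (simp add: mult_le_0_iff)
  qed
  obtain K where K: "K > 0" "\<And>s. norm (w s) \<le> norm s * K" using w.pos_bounded by blast
  have blU: "bounded_linear (U x)" if "x \<in> V" for x
  proof (rule bounded_linear_intro)
    interpret A: bounded_linear "A x" by (rule bl[OF that])
    show "U x (s + t) = U x s + U x t" for s t
      by (rule A_inj[OF that]) (simp add: AU[OF that] A.add w.add)
    show "U x (k *\<^sub>R s) = k *\<^sub>R U x s" for k s
      by (rule A_inj[OF that]) (simp add: AU[OF that] A.scaleR w.scaleR)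
    show "norm (U x s) \<le> norm s * (K / c)" for s
      using low[OF that, of "U x s"] AU[OF that, of s] K(2)[of s] c by (simp add: A_def field_simps)
  qed
  \<comment> \<open>The derivative is the one implicit differentiation predicts: \<open>U\<close>
    solves the linearised equation. The lower bounds on \<open>\<Psi>\<close> and \<open>A\<close>
    turn the expansion of \<open>\<Psi>\<close> at \<open>X d\<close> into one of
    \<open>X\<close>.\<close>
  have derX: "(X has_derivative U (X d)) (at d within D)" if d: "d \<in> D" for d
    unfolding has_derivative_within_alt
  proof (intro conjI allI impI)
    have XV: "X d \<in> V" using X[OF d] CV by blast
    interpret A: bounded_linear "A (X d)" by (rule bl[OF XV])
    show "bounded_linear (U (X d))" by (rule blU[OF XV])
    have lip: "norm (X d' - X d) \<le> K / c * norm (d' - d)" if d': "d' \<in> D" for d'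
    proof -
      have "c * norm (X d' - X d) \<le> norm (w (d' - d))"
        using bil[OF CV[OF X(1)[OF d']] XV] X(2)[OF d'] X(2)[OF d] by (simp add: \<Psi>_def w.diff)
      also have "\<dots> \<le> norm (d' - d) * K" by (rule K)
      finally show ?thesis using c by (simp add: field_simps)
    qed
    fix e :: real assume e: "e > 0"
    \<comment> \<open>The factor \<open>c / K\<close> cancels the Lipschitz constant
      \<open>K / c\<close> of \<open>X\<close>, the factor \<open>c\<close> the constant in the
      lower bound for \<open>A\<close>.\<close>
    define e' where "e' = e * c * (c / K)"
    have "e' > 0" using e c K by (simp add: e'_def)
    then obtain \<delta> where \<delta>: "\<delta> > 0"
      "\<And>z. norm (z - X d) < \<delta> \<Longrightarrow> norm (\<Psi> z - \<Psi> (X d) - A (X d) (z - X d)) \<le> e' * norm (z - X d)"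
      using der\<Psi>[OF XV, unfolded has_derivative_at_alt] by blast
    show "\<exists>\<delta>>0. \<forall>d'\<in>D. norm (d' - d) < \<delta> \<longrightarrow>
        norm (X d' - X d - U (X d) (d' - d)) \<le> e * norm (d' - d)"
    proof (intro exI[of _ "\<delta> * c / K"] conjI ballI impI)
      show "\<delta> * c / K > 0" using \<delta>(1) c K by simp
      fix d' assume d': "d' \<in> D" "norm (d' - d) < \<delta> * c / K"
      have "norm (X d' - X d) < \<delta>"
      proof -
        have "K / c * norm (d' - d) < \<delta>" using d'(2) c K by (simp add: field_simps)
        then show ?thesis using lip[OF d'(1)] by simp
      qed
      then have *: "norm (\<Psi> (X d') - \<Psi> (X d) - A (X d) (X d' - X d)) \<le> e' * norm (X d' - X d)"
        by (rule \<delta>(2))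
      have "A (X d) (X d' - X d - U (X d) (d' - d)) = A (X d) (X d' - X d) - w (d' - d)"
        by (simp add: A.diff[of "X d' - X d"] AU[OF XV])
      also have "\<dots> = A (X d) (X d' - X d) - (\<Psi> (X d') - \<Psi> (X d))"
        using X(2)[OF d] X(2)[OF d'(1)] by (simp add: w.diff)
      finally have "norm (A (X d) (X d' - X d - U (X d) (d' - d))) \<le> e' * norm (X d' - X d)"
        using * by (metis norm_minus_commute)
      then have "c * norm (X d' - X d - U (X d) (d' - d)) \<le> e' * norm (X d' - X d)"
        using low[OF XV, of "X d' - X d - U (X d) (d' - d)"] by (simp add: A_def)
      also have "\<dots> \<le> e' * (K / c * norm (d' - d))"
        using lip[OF d'(1)] \<open>e' > 0\<close> by (intro mult_left_mono) auto
      also have "\<dots> = c * (e * norm (d' - d))" using c K by (simp add: e'_def field_simps)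
      finally show "norm (X d' - X d - U (X d) (d' - d)) \<le> e * norm (d' - d)"
        using c by simp
    qed
  qed
  have "negligible ((\<lambda>d. d - \<phi> (X d)) ` D)"
  proof (rule baby_Sard)
    fix d assume d: "d \<in> D"
    let ?g' = "\<lambda>s. s - \<phi> (U (X d) s)"
    show der: "((\<lambda>d. d - \<phi> (X d)) has_derivative ?g') (at d within D)"
      by (rule has_derivative_diff[OF has_derivative_ident \<phi>.has_derivative[OF derX[OF d]]])
    obtain v where v: "v \<noteq> 0" "F' (X d) v = 0" using X(1)[OF d] by (auto simp: C_def)
    have XV: "X d \<in> V" using X[OF d] CV by blast
    \<comment> \<open>A kernel vector \<open>v\<close> of \<open>F' (X d)\<close> solves the
      linearised equation with right-hand side \<open>w (\<phi> v)\<close>. Hence \<open>U\<close>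
      sends \<open>\<phi> v\<close> back to \<open>v\<close>, and \<open>\<phi> v\<close> is a
      nonzero vector killed by \<open>?g'\<close>: critical points give critical parameters.\<close>
    have Av: "A (X d) v = w (\<phi> v)" using v by (simp add: A_def)
    have "U (X d) (\<phi> v) = v" by (rule A_inj[OF XV]) (simp add: AU[OF XV] Av)
    then have 0: "?g' (\<phi> v) = 0" by (simp only: diff_self)
    have "\<phi> v \<noteq> 0"
    proof
      assume "\<phi> v = 0"
      then have "A (X d) v = A (X d) 0"
        using Av linear_0[OF bounded_linear.linear[OF bl[OF XV]]] by (simp add: w.zero)
      then show False using A_inj[OF XV] v(1) by blast
    qed
    moreover have "matrix ?g' *v \<phi> v = matrix ?g' *v 0"
      by (simp only: matrix_works[OF has_derivative_linear[OF der, folded linear_matrix_vector_mul_eq]]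
          0 matrix_vector_mult_0_right)
    ultimately have "\<not> inj ((*v) (matrix ?g'))"
      by (meson injD)
    then show "rank (matrix ?g') < CARD('k)"
      by (rule less_rank_noninjective[THEN iffD2])
  qed (rule order_refl)
  moreover have "{s. \<exists>x\<in>V. F x = y + w s \<and> (\<exists>v. v \<noteq> 0 \<and> F' x v = 0)} \<subseteq> (\<lambda>d. d - \<phi> (X d)) ` D"
  proof clarify
    fix s x v assume x: "x \<in> V" "F x = y + w s" "v \<noteq> 0" "F' x v = 0"
    define d where "d = s + \<phi> x"
    have xC: "x \<in> C" using x by (auto simp: C_def)
    have \<Psi>x: "\<Psi> x = y + w d" by (simp add: \<Psi>_def x(2) d_def w.add)
    then have d: "d \<in> D" using xC by (auto simp: D_def)
    have "X d = x" by (rule \<Psi>_inj) (use X[OF d] \<Psi>x CV x in auto)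
    then show "s \<in> (\<lambda>d. d - \<phi> (X d)) ` D" using d by (intro image_eqI[of _ _ d]) (auto simp: d_def)
  qed
  ultimately show ?thesis by (rule negligible_subset)
qed

section \<open>Critical values and degree of compact perturbations of the identity\<close>

text \<open>The sets \<open>A k\<close> are closed pieces of the open domain on which compactness is
  uniform. In \<open>compact_F'\<close> the base point may move along with the vector, as limits of
  critical points require. In \<open>approx\<close> the map \<open>G\<close> is close to
  \<open>id - F\<close> on one piece only, but it is C1 with values in one span on the whole
  domain.\<close>

locale approximable_C1_map =
  fixes F :: "'a::real_normed_vector \<Rightarrow> 'a" and F' :: "'a \<Rightarrow> 'a \<Rightarrow> 'a" and A :: "nat \<Rightarrow> 'a set"
  assumes closed_A: "closed (A k)"
    and nhd_A: "x \<in> A k \<Longrightarrow> \<exists>r>0. \<exists>l. cball x r \<subseteq> A l"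
    and der: "x \<in> A k \<Longrightarrow> (F has_derivative F' x) (at x)"
    and cont: "x \<in> A k \<Longrightarrow> e > 0 \<Longrightarrow>
      \<exists>d>0. \<forall>x'\<in>ball x d. \<forall>v. norm (F' x' v - F' x v) \<le> e * norm v"
    and compact_F: "(\<And>j :: nat. X j \<in> A k) \<Longrightarrow>
      \<exists>l r. strict_mono (r :: nat \<Rightarrow> nat) \<and> (\<lambda>j. X (r j) - F (X (r j))) \<longlonglongrightarrow> l"
    and compact_F': "(\<And>j :: nat. X j \<in> A k) \<Longrightarrow> (\<And>j. norm (V j) \<le> 1) \<Longrightarrow>
      \<exists>l r. strict_mono (r :: nat \<Rightarrow> nat) \<and> (\<lambda>j. V (r j) - F' (X (r j)) (V (r j))) \<longlonglongrightarrow> l"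
    and approx: "e > 0 \<Longrightarrow> \<exists>B G G'. finite B \<and>
      (\<forall>l. \<forall>x\<in>A l. G x \<in> span B \<and> (G has_derivative G' x) (at x) \<and> range (G' x) \<subseteq> span B) \<and>
      (\<forall>v. continuous_on (\<Union>l. A l) (\<lambda>x. G' x v)) \<and>
      (\<forall>x\<in>A k. norm (G x - (x - F x)) \<le> e \<and> (\<forall>v. norm (G' x v - (v - F' x v)) \<le> e * norm v))"
begin

definition crit :: "'a \<Rightarrow> bool" where
  "crit x \<longleftrightarrow> (\<exists>v. v \<noteq> 0 \<and> F' x v = 0)"

lemma bounded_linear_F': "x \<in> A k \<Longrightarrow> bounded_linear (F' x)"
  using der has_derivative_bounded_linear by blast

lemma approxE:
  assumes "e > 0"
  obtains B G G' where "finite B" "\<And>l x. x \<in> A l \<Longrightarrow> G x \<in> span B"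
    "\<And>l x. x \<in> A l \<Longrightarrow> (G has_derivative G' x) (at x)"
    "\<And>l x v. x \<in> A l \<Longrightarrow> G' x v \<in> span B"
    "\<And>v. continuous_on (\<Union>l. A l) (\<lambda>x. G' x v)"
    "\<And>x. x \<in> A k \<Longrightarrow> norm (G x - (x - F x)) \<le> e"
    "\<And>x v. x \<in> A k \<Longrightarrow> norm (G' x v - (v - F' x v)) \<le> e * norm v"
  using approx[OF assms, of k]
proof (elim exE conjE)
  fix B G G'
  assume 1: "finite B" "\<forall>l. \<forall>x\<in>A l. G x \<in> span B \<and> (G has_derivative G' x) (at x) \<and> range (G' x) \<subseteq> span B"
    "\<forall>v. continuous_on (\<Union>l. A l) (\<lambda>x. G' x v)"
    "\<forall>x\<in>A k. norm (G x - (x - F x)) \<le> e \<and> (\<forall>v. norm (G' x v - (v - F' x v)) \<le> e * norm v)"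
  show thesis
  proof (rule that[of B G G'])
    show "G' x v \<in> span B" if "x \<in> A l" for x v l using 1(2) that rangeI[of "G' x" v] by blast
  qed (use 1 in simp_all)
qed

lemma open_dom: "open (\<Union>k. A k)"
  unfolding open_contains_cball
proof
  fix x assume "x \<in> (\<Union>k. A k)"
  then obtain k where "x \<in> A k" by blast
  from nhd_A[OF this] show "\<exists>r>0. cball x r \<subseteq> (\<Union>k. A k)" by blast
qed

text \<open>Properness of \<open>F\<close> on \<open>A k\<close>: along a subsequence both
  \<open>X - F X\<close> and \<open>F X\<close> converge, hence so does their sum
  \<open>X\<close>.\<close>

lemma convergent_preimages:
  assumes X: "\<And>j. X j \<in> A k" and y: "(\<lambda>j. F (X j)) \<longlonglongrightarrow> y"
  shows "\<exists>x r. strict_mono (r :: nat \<Rightarrow> nat) \<and> (\<lambda>j. X (r j)) \<longlonglongrightarrow> x \<and> x \<in> A k \<and> F x = y"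
proof -
  obtain l r where r: "strict_mono (r :: nat \<Rightarrow> nat)" "(\<lambda>j. X (r j) - F (X (r j))) \<longlonglongrightarrow> l"
    using compact_F[of X k, OF X] by blast
  have y': "(\<lambda>j. F (X (r j))) \<longlonglongrightarrow> y"
    using LIMSEQ_subseq_LIMSEQ[OF y r(1)] by (simp add: o_def)
  have x: "(\<lambda>j. X (r j)) \<longlonglongrightarrow> l + y" using tendsto_add[OF r(2) y'] by simp
  have xA: "l + y \<in> A k" using closed_sequentially[OF closed_A _ x] X by blast
  have "(\<lambda>j. F (X (r j))) \<longlonglongrightarrow> F (l + y)"
    using isCont_tendsto_compose[OF has_derivative_continuous[OF der[OF xA]] x] .
  then have "F (l + y) = y" using y' LIMSEQ_unique by blast
  then show ?thesis using r(1) x xA by blast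
qed

text \<open>For unit kernel vectors \<open>V j\<close> at \<open>X j\<close> the sequence
  \<open>V j - F' (X j) (V j)\<close> is \<open>V j\<close> itself, so compactness makes it
  converge; continuity of the derivative at \<open>x\<close> puts the limit into the kernel
  there.\<close>

lemma crit_limit:
  assumes X: "\<And>j. X j \<in> A k" "\<And>j. crit (X j)" and x: "X \<longlonglongrightarrow> x"
  shows "crit x"
proof -
  have xA: "x \<in> A k" using closed_sequentially[OF closed_A _ x] X by blast
  interpret bounded_linear "F' x" by (rule bounded_linear_F'[OF xA])
  have "\<exists>v. norm v = 1 \<and> F' (X j) v = 0" for j
  proof -
    obtain v where v: "v \<noteq> 0" "F' (X j) v = 0" using X(2) by (auto simp: crit_def)
    interpret Xj: bounded_linear "F' (X j)" by (rule bounded_linear_F'[OF X(1)])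
    show ?thesis using v by (intro exI[of _ "v /\<^sub>R norm v"]) (simp add: Xj.scaleR)
  qed
  then obtain V where V: "\<And>j. norm (V j) = 1" "\<And>j. F' (X j) (V j) = 0" by metis
  obtain l r where r: "strict_mono (r :: nat \<Rightarrow> nat)"
      "(\<lambda>j. V (r j) - F' (X (r j)) (V (r j))) \<longlonglongrightarrow> l"
    using compact_F'[of X, OF X(1), of V] V(1) by auto
  have Vl: "(\<lambda>j. V (r j)) \<longlonglongrightarrow> l" using r(2) by (simp add: V(2))
  have "norm l = 1" using tendsto_norm[OF Vl] V(1) by (simp add: LIMSEQ_const_iff)
  moreover have "F' x l = 0"
  proof (rule LIMSEQ_unique[OF tendsto[OF Vl]])
    show "(\<lambda>j. F' x (V (r j))) \<longlonglongrightarrow> 0"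
    proof (rule tendstoI)
      fix e :: real assume e: "e > 0"
      obtain d where d: "d > 0" "\<And>x' v. x' \<in> ball x d \<Longrightarrow> norm (F' x' v - F' x v) \<le> e / 2 * norm v"
        using cont[OF xA, of "e / 2"] e by auto
      have "\<forall>\<^sub>F j in sequentially. X (r j) \<in> ball x d"
        using LIMSEQ_subseq_LIMSEQ[OF x r(1)] d(1)
        by (auto simp: o_def dist_commute elim!: tendstoD[THEN eventually_mono])
      then show "\<forall>\<^sub>F j in sequentially. dist (F' x (V (r j))) 0 < e"
      proof eventually_elim
        case (elim j)
        have "norm (F' x (V (r j))) \<le> e / 2" using d(2)[OF elim, of "V (r j)"] V by simp
        then show ?case using e by simp
      qed
    qed
  qed
  ultimately show ?thesis unfolding crit_def by (metis norm_zero zero_neq_one)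
qed

lemma closed_critical_values:
  assumes "closed C" "C \<subseteq> A k"
  shows "closed (F ` {x \<in> C. crit x})"
  unfolding closed_sequential_limits
proof (intro allI impI)
  fix Y y assume Y: "(\<forall>j. Y j \<in> F ` {x \<in> C. crit x}) \<and> Y \<longlonglongrightarrow> y"
  then obtain X where X: "\<And>j. X j \<in> C" "\<And>j. crit (X j)" "\<And>j. Y j = F (X j)"
    unfolding image_iff by (metis (mono_tags, lifting) mem_Collect_eq)
  have XA: "X j \<in> A k" for j using X assms by blast
  obtain x r where r: "strict_mono (r :: nat \<Rightarrow> nat)" "(\<lambda>j. X (r j)) \<longlonglongrightarrow> x" "F x = y"
  proof -
    have "(\<lambda>j. F (X j)) \<longlonglongrightarrow> y" using Y by (simp add: X(3)[symmetric])
    from convergent_preimages[of X k y, OF XA this] that show ?thesis by blast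
  qed
  have "x \<in> C" using closed_sequentially[OF assms(1) _ r(2)] X by blast
  moreover have "crit x" using crit_limit[OF _ _ r(2)] XA X by blast
  ultimately show "y \<in> F ` {x \<in> C. crit x}" using r(3) by blast
qed

text \<open>Injectivity at the single point \<open>x0\<close> suffices: by compactness it is a lower
  bound, which persists on a ball, and at each point of the ball the finite-dimensional
  approximations give surjectivity. The radius does not depend on \<open>y\<close>, so the result
  can be applied at any right-hand side near a given one.\<close>

lemma sard_locally:
  fixes \<phi> :: "'a \<Rightarrow> real ^ ('k::{finite,wellorder})" and w :: "real ^ ('k::{finite,wellorder}) \<Rightarrow> 'a"
  assumes x0: "x0 \<in> A k" and \<phi>: "bounded_linear \<phi>" and w: "bounded_linear w"
    and inj: "\<And>v. F' x0 v + w (\<phi> v) = 0 \<Longrightarrow> v = 0"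
  shows "\<exists>r>0. \<forall>y. negligible {s. \<exists>x\<in>ball x0 r. F x = y + w s \<and> crit x}"
proof -
  interpret \<phi>: bounded_linear \<phi> by (rule \<phi>)
  interpret w: bounded_linear w by (rule w)
  define T where "T x v = F' x v + w (\<phi> v)" for x v
  have T: "bounded_linear (T x)" if "x \<in> A l" for x l
    unfolding T_def by (intro bounded_linear_add bounded_linear_F'[OF that] bounded_linear_compose[OF w \<phi>])
  have cpt: "\<exists>l r. strict_mono (r :: nat \<Rightarrow> nat) \<and> (\<lambda>j. V (r j) - T x (V (r j))) \<longlonglongrightarrow> l"
    if x: "x \<in> A l" and V: "\<And>j. norm (V j) \<le> 1" for x l and V :: "nat \<Rightarrow> 'a"
  proof -
    obtain p r where r: "strict_mono (r :: nat \<Rightarrow> nat)" "(\<lambda>j. V (r j) - F' x (V (r j))) \<longlonglongrightarrow> p"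
      using compact_F'[of "\<lambda>_. x", OF x, of V] V by blast
    \<comment> \<open>The added operator factors through a finite-dimensional space, where bounded
      sequences have convergent subsequences; \<open>id - T x\<close> therefore stays
      compact.\<close>
    have "bounded (range (\<lambda>j. \<phi> (V (r j))))"
    proof -
      obtain K where "\<And>v. norm (\<phi> v) \<le> norm v * K" "K > 0" using \<phi>.pos_bounded by blast
      then have "norm (\<phi> (V (r j))) \<le> K" for j
        using V[of "r j"] by (smt (verit) mult_less_cancel_right1)
      then show ?thesis by (auto simp: bounded_iff)
    qed
    then obtain q r' where r': "strict_mono (r' :: nat \<Rightarrow> nat)" "(\<lambda>j. \<phi> (V (r (r' j)))) \<longlonglongrightarrow> q"
      using bounded_imp_convergent_subsequence[of "\<lambda>j. \<phi> (V (r j))"] by (auto simp: o_def)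
    have "(\<lambda>j. V (r (r' j)) - F' x (V (r (r' j)))) \<longlonglongrightarrow> p"
      using LIMSEQ_subseq_LIMSEQ[OF r(2) r'(1)] by (simp add: o_def)
    from tendsto_diff[OF this w.tendsto[OF r'(2)]]
    have "(\<lambda>j. V ((r \<circ> r') j) - T x (V ((r \<circ> r') j))) \<longlonglongrightarrow> p - w q"
      by (simp add: T_def algebra_simps)
    then show ?thesis using strict_mono_o[OF r(1) r'(1)] by blast
  qed
  have "\<exists>c>0. \<forall>v. c * norm v \<le> norm (T x0 v)"
  proof (rule compact_perturbation_bounded_below)
    show "bounded_linear (T x0)" by (rule T[OF x0])
    show "\<exists>l r. strict_mono (r :: nat \<Rightarrow> nat) \<and> (\<lambda>j. V (r j) - T x0 (V (r j))) \<longlonglongrightarrow> l"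
      if "\<And>j. norm (V j) \<le> 1" for V :: "nat \<Rightarrow> 'a"
      by (rule cpt[OF x0 that])
    show "v = 0" if "T x0 v = 0" for v
      using that unfolding T_def by (rule inj)
  qed
  then obtain c where c: "c > 0" "\<And>v. c * norm v \<le> norm (T x0 v)" by blast
  define \<Psi> where "\<Psi> x = F x + w (\<phi> x)" for x
  have der\<Psi>: "(\<Psi> has_derivative T x) (at x)" if "x \<in> (\<Union>k. A k)" for x
    unfolding \<Psi>_def T_def using that
    by (auto intro!: has_derivative_add der w.has_derivative \<phi>.has_derivative has_derivative_ident)
  obtain r where r: "r > 0" "ball x0 r \<subseteq> (\<Union>k. A k)"
    "\<And>a b. a \<in> ball x0 r \<Longrightarrow> b \<in> ball x0 r \<Longrightarrow> c / 2 * norm (a - b) \<le> norm (\<Psi> a - \<Psi> b)"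
    "\<And>x v. x \<in> ball x0 r \<Longrightarrow> c / 2 * norm v \<le> norm (T x v)"
  proof -
    have "\<exists>d>0. \<forall>x\<in>ball x0 d. \<forall>v. norm (T x v - T x0 v) \<le> e * norm v" if "e > 0" for e
      using cont[OF x0 that] by (simp add: T_def)
    from C1_locally_bounded_below[OF open_dom _ der\<Psi> this c] x0 that
    show ?thesis by blast
  qed
  have neg: "negligible {s. \<exists>x\<in>ball x0 r. F x = y + w s \<and> (\<exists>v. v \<noteq> 0 \<and> F' x v = 0)}" for y
  proof (rule sard_finite_rank_parameter[OF _ \<phi> w, where c = "c / 2"])
    show "c / 2 > 0" using c by simp
    show "(F has_derivative F' x) (at x)" if "x \<in> ball x0 r" for x
      using that r(2) der by blast
    show "c / 2 * norm (a - b) \<le> norm (F a + w (\<phi> a) - (F b + w (\<phi> b)))"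
      if "a \<in> ball x0 r" "b \<in> ball x0 r" for a b
      using r(3)[OF that] by (simp add: \<Psi>_def)
    show low: "c / 2 * norm v \<le> norm (F' x v + w (\<phi> v))" if "x \<in> ball x0 r" for x v
      using r(4)[OF that] by (simp add: T_def)
    show "\<exists>u. F' x u + w (\<phi> u) = w s" if x: "x \<in> ball x0 r" for x s
    proof -
      obtain l where l: "x \<in> A l" using x r(2) by blast
      have "surj (T x)"
      proof (rule compact_perturbation_surj[OF T[OF l] cpt[OF l]])
        show "v = 0" if "T x v = 0" for v
          using r(4)[OF x, of v] c(1) that by (simp add: mult_le_0_iff)
        show "\<exists>G B. finite B \<and> linear G \<and> range G \<subseteq> span B \<and> (\<forall>v. norm (G v - (v - T x v)) \<le> e * norm v)"
          if e: "e > 0" for e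
        proof -
          obtain B G G' where G: "finite B" "(G has_derivative G' x) (at x)"
            "\<And>v. G' x v \<in> span B" "\<And>v. norm (G' x v - (v - F' x v)) \<le> e * norm v"
            using approxE[OF e, of l] l by metis
          show ?thesis
          proof (intro exI conjI allI)
            show "finite (B \<union> w ` Basis)" using G(1) by simp
            show "linear (\<lambda>v. G' x v - w (\<phi> v))"
              using has_derivative_linear[OF G(2)]
                bounded_linear.linear[OF bounded_linear_compose[OF w \<phi>]]
              by (intro linear_compose_sub)
            have "w t \<in> span (w ` Basis)" for t
            proof -
              have "w t = (\<Sum>b\<in>Basis. (t \<bullet> b) *\<^sub>R w b)"
                by (subst (1) euclidean_representation[symmetric]) (simp only: w.sum w.scaleR)
              also have "\<dots> \<in> span (w ` Basis)" by (intro span_sum span_scale span_base imageI)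
              finally show ?thesis .
            qed
            then show "range (\<lambda>v. G' x v - w (\<phi> v)) \<subseteq> span (B \<union> w ` Basis)"
              using G(3) span_mono[of B "B \<union> w ` Basis"] span_mono[of "w ` Basis" "B \<union> w ` Basis"]
              by (intro image_subsetI span_diff) (auto simp: subset_iff)
            show "norm (G' x v - w (\<phi> v) - (v - T x v)) \<le> e * norm v" for v
              using G(4) by (simp add: T_def algebra_simps)
          qed
        qed
      qed
      then obtain u where "w s = T x u" by (rule surjE)
      then show ?thesis by (intro exI[of _ u]) (simp add: T_def)
    qed
  qed
  then show ?thesis using r(1) unfolding crit_def by blast
qed

text \<open>By properness the fibre over \<open>y0\<close> is compact, so finitely many balls with
  Sard's theorem cover it, and values close to \<open>y0\<close> are no longer taken at critical
  points of these balls after a small shift. Critical points outside the balls cannot have values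
  accumulating at \<open>y0\<close>, since they would accumulate on the fibre. All shifts are by
  elements of the range of \<open>w\<close>, hence stay in \<open>S\<close>.\<close>

lemma regular_values_dense:
  assumes S: "subspace S"
    and trans: "\<And>x k. x \<in> A k \<Longrightarrow> \<exists>(\<phi> :: 'a \<Rightarrow> real ^ ('k::{finite,wellorder})) w.
      bounded_linear \<phi> \<and> bounded_linear w \<and> range w \<subseteq> S \<and> (\<forall>v. F' x v + w (\<phi> v) = 0 \<longrightarrow> v = 0)"
    and y0: "y0 \<in> S" and e: "e > 0"
  shows "\<exists>y\<in>S. dist y y0 < e \<and> y \<notin> F ` {x \<in> A k. crit x}"
proof -
  define K0 where "K0 = {x \<in> A k. F x = y0}"
  have loc: "\<exists>r>0. closed (F ` {x \<in> cball x0 r. crit x}) \<and>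
      (\<forall>y\<in>S. \<forall>e>0. \<exists>y'\<in>S. dist y' y < e \<and> y' \<notin> F ` {x \<in> cball x0 r. crit x})"
    if x0: "x0 \<in> K0" for x0
  proof -
    have x0A: "x0 \<in> A k" using x0 by (simp add: K0_def)
    obtain \<phi> :: "'a \<Rightarrow> real ^ ('k::{finite,wellorder})" and w where w: "bounded_linear \<phi>" "bounded_linear w" "range w \<subseteq> S"
      "\<And>v. F' x0 v + w (\<phi> v) = 0 \<Longrightarrow> v = 0"
      using trans[OF x0A] by blast
    interpret w: bounded_linear w by (rule w)
    obtain r where r: "r > 0" "\<And>y. negligible {s. \<exists>x\<in>ball x0 r. F x = y + w s \<and> crit x}"
      using sard_locally[OF x0A w(1,2,4)] by blast
    obtain r' l where r': "r' > 0" "cball x0 r' \<subseteq> A l" using nhd_A[OF x0A] by blast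
    define \<rho> where "\<rho> = min (r / 2) r'"
    have \<rho>: "\<rho> > 0" "cball x0 \<rho> \<subseteq> ball x0 r" "cball x0 \<rho> \<subseteq> A l"
      using r r' by (auto simp: \<rho>_def)
    have "\<exists>y'\<in>S. dist y' y < e \<and> y' \<notin> F ` {x \<in> cball x0 \<rho>. crit x}" if y: "y \<in> S" and e: "e > 0" for y e
    proof -
      obtain d where d: "d > 0" "\<And>s. dist s 0 < d \<Longrightarrow> dist (w s) 0 < e"
        using w.tendsto[OF tendsto_ident_at, of 0 UNIV] e
        by (metis (no_types, lifting) LIM_def w.zero dist_self dist_eq_0_iff)
      \<comment> \<open>A negligible set contains no ball, so an arbitrarily small parameter
        \<open>s\<close> avoids it.\<close>
      have "\<not> ball (0 :: real ^ ('k::{finite,wellorder})) d \<subseteq> {s. \<exists>x\<in>ball x0 r. F x = y + w s \<and> crit x}"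
        using open_not_negligible[of "ball (0 :: real ^ ('k::{finite,wellorder})) d"] negligible_subset[OF r(2)] d(1) by auto
      then obtain s where s: "s \<in> ball 0 d" "\<And>x. x \<in> ball x0 r \<Longrightarrow> crit x \<Longrightarrow> F x \<noteq> y + w s" by blast
      have "dist (y + w s) y < e" using d(2)[of s] s(1) by (simp add: dist_norm)
      moreover have "y + w s \<in> S" using subspace_add[OF S y] w(3) by blast
      moreover have "y + w s \<notin> F ` {x \<in> cball x0 \<rho>. crit x}" using s(2) \<rho>(2) by fastforce
      ultimately show ?thesis by blast
    qed
    then show ?thesis using \<rho>(1) closed_critical_values[OF closed_cball \<rho>(3)] by blast
  qed
  then have "\<forall>x0\<in>K0. \<exists>r. r > 0 \<and> closed (F ` {x \<in> cball x0 r. crit x}) \<and>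
      (\<forall>y\<in>S. \<forall>e>0. \<exists>y'\<in>S. dist y' y < e \<and> y' \<notin> F ` {x \<in> cball x0 r. crit x})"
    by simp
  from bchoice[OF this] obtain R where R: "\<And>x0. x0 \<in> K0 \<Longrightarrow> R x0 > 0"
      "\<And>x0. x0 \<in> K0 \<Longrightarrow> closed (F ` {x \<in> cball x0 (R x0). crit x})"
      "\<And>x0 y e. x0 \<in> K0 \<Longrightarrow> y \<in> S \<Longrightarrow> e > 0 \<Longrightarrow>
        \<exists>y'\<in>S. dist y' y < e \<and> y' \<notin> F ` {x \<in> cball x0 (R x0). crit x}"
    by blast
  have "compact K0"
    unfolding compact_eq_seq_compact_metric seq_compact_def
  proof (intro allI impI)
    fix X :: "nat \<Rightarrow> 'a" assume X: "\<forall>j. X j \<in> K0"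
    then have "(\<lambda>j. F (X j)) \<longlonglongrightarrow> y0" by (simp add: K0_def)
    moreover have "X j \<in> A k" for j using X by (auto simp: K0_def)
    ultimately show "\<exists>l\<in>K0. \<exists>r. strict_mono r \<and> (X \<circ> r) \<longlonglongrightarrow> l"
      using convergent_preimages[of X k y0] by (auto simp: o_def K0_def)
  qed
  then obtain I where I: "I \<subseteq> K0" "finite I" "K0 \<subseteq> (\<Union>x\<in>I. ball x (R x))"
    using R(1) by (elim compactE_image[of K0 K0 "\<lambda>x. ball x (R x)"]) auto
  let ?C = "\<lambda>x0. F ` {x \<in> cball x0 (R x0). crit x}"
  \<comment> \<open>The balls are treated one after another. Closedness of the critical values
    already avoided leaves room for the next shift, which must stay below both that room
    \<open>d\<close> and \<open>e / 2\<close>.\<close>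
  have avoid: "\<exists>y'\<in>S. dist y' y < e \<and> (\<forall>x\<in>J. y' \<notin> ?C x)"
    if "finite J" "J \<subseteq> K0" "y \<in> S" "e > 0" for J y e
    using that
  proof (induction J arbitrary: y e)
    case empty
    then show ?case by (intro bexI[of _ y]) auto
  next
    case (insert x0 J)
    obtain y' where y': "y' \<in> S" "dist y' y < e / 2" "\<forall>x\<in>J. y' \<notin> ?C x"
      using insert.IH[of y "e / 2"] insert.prems by auto
    have "closed (\<Union>x\<in>J. ?C x)"
      using insert.hyps(1) insert.prems(1) R(2) by (intro closed_UN) auto
    then obtain d where d: "d > 0" "ball y' d \<subseteq> - (\<Union>x\<in>J. ?C x)"
      using y'(3) unfolding closed_def open_contains_ball by (metis (no_types, lifting) ComplI UN_iff)
    obtain y'' where y'': "y'' \<in> S" "dist y'' y' < min d (e / 2)" "y'' \<notin> ?C x0"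
      using R(3)[of x0 y' "min d (e / 2)"] insert.prems y'(1) d(1) by auto
    have "dist y'' y < e" using y'(2) y''(2) dist_triangle[of y'' y y'] by simp
    moreover have "y'' \<in> ball y' d" using y''(2) by (simp add: dist_commute)
    ultimately show ?case using y'' d(2) by blast
  qed
  show ?thesis
  proof (rule ccontr)
    assume neg: "\<not> ?thesis"
    \<comment> \<open>If every value near \<open>y0\<close> were critical, so would be those that
      avoid all the balls; they yield critical points with values tending to \<open>y0\<close> whose
      values miss every \<open>?C z\<close>.\<close>
    have "\<forall>j. \<exists>x. x \<in> A k \<and> crit x \<and> dist (F x) y0 < inverse (real (Suc j)) \<and> (\<forall>z\<in>I. F x \<notin> ?C z)"
    proof
      fix j
      obtain y where "y \<in> S" "dist y y0 < min e (inverse (real (Suc j)))" "\<forall>z\<in>I. y \<notin> ?C z"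
        using avoid[OF I(2,1) y0, of "min e (inverse (real (Suc j)))"] e by auto
      moreover from this have "y \<in> F ` {x \<in> A k. crit x}" using neg by auto
      ultimately show "\<exists>x. x \<in> A k \<and> crit x \<and> dist (F x) y0 < inverse (real (Suc j)) \<and>
        (\<forall>z\<in>I. F x \<notin> ?C z)" by auto
    qed
    from choice[OF this] obtain X where X: "\<And>j. X j \<in> A k" "\<And>j. crit (X j)"
      "\<And>j. dist (F (X j)) y0 < inverse (real (Suc j))" "\<And>j. \<forall>z\<in>I. F (X j) \<notin> ?C z"
      by blast
    have "(\<lambda>j. dist (F (X j)) y0) \<longlonglongrightarrow> 0"
    proof (rule Lim_null_comparison[OF _ LIMSEQ_inverse_real_of_nat], intro always_eventually allI)
      show "norm (dist (F (X j)) y0) \<le> inverse (real (Suc j))" for j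
        unfolding real_norm_def abs_of_nonneg[OF zero_le_dist] by (rule less_imp_le[OF X(3)])
    qed
    then have "(\<lambda>j. F (X j)) \<longlonglongrightarrow> y0" by (rule iffD2[OF tendsto_dist_iff])
    from convergent_preimages[OF X(1) this]
    obtain x r where x: "strict_mono (r :: nat \<Rightarrow> nat)" "(\<lambda>j. X (r j)) \<longlonglongrightarrow> x" "x \<in> K0"
      unfolding K0_def by blast
    then obtain z where z: "z \<in> I" "x \<in> ball z (R z)" using I(3) by blast
    have "\<forall>\<^sub>F j in sequentially. X (r j) \<in> ball z (R z)"
      by (rule topological_tendstoD[OF x(2) open_ball z(2)])
    then obtain j where j: "X (r j) \<in> ball z (R z)"
      using eventually_happens'[OF sequentially_bot] by blast
    then have "F (X (r j)) \<in> ?C z" using X(2) ball_subset_cball by blast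
    then show False using X(4) z(1) by blast
  qed
qed

lemma regular_values_residual:
  assumes S: "subspace S"
    and trans: "\<And>x k. x \<in> A k \<Longrightarrow> \<exists>(\<phi> :: 'a \<Rightarrow> real ^ ('k::{finite,wellorder})) w.
      bounded_linear \<phi> \<and> bounded_linear w \<and> range w \<subseteq> S \<and> (\<forall>v. F' x v + w (\<phi> v) = 0 \<longrightarrow> v = 0)"
  shows "residual_in (top_of_set S) (S - F ` {x \<in> (\<Union>k. A k). crit x})"
  unfolding residual_in_def
proof (intro conjI exI[of _ "range (\<lambda>k. S - F ` {x \<in> A k. crit x})"] ballI)
  fix T assume "T \<in> range (\<lambda>k. S - F ` {x \<in> A k. crit x})"
  then obtain k where T: "T = S - F ` {x \<in> A k. crit x}" by blast
  have "open (- F ` {x \<in> A k. crit x})"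
    using closed_critical_values[OF closed_A order_refl] by (simp add: open_Compl)
  then show "openin (top_of_set S) T"
    unfolding T Diff_eq using openin_open_Int by blast
  show "top_of_set S closure_of T = topspace (top_of_set S)"
  proof
    show "topspace (top_of_set S) \<subseteq> top_of_set S closure_of T"
    proof
      fix y assume y: "y \<in> topspace (top_of_set S)"
      have "\<exists>z. z \<in> T \<and> z \<in> O'" if O': "y \<in> O'" "openin (top_of_set S) O'" for O'
      proof -
        obtain e where e: "e > 0" "ball y e \<inter> S \<subseteq> O'" using O' openin_contains_ball by metis
        obtain z where "z \<in> S" "dist z y < e" "z \<notin> F ` {x \<in> A k. crit x}"
          using regular_values_dense[OF S trans _ e(1), of "\<lambda>x k. k" y k] y by auto
        then show ?thesis using e(2) T by (auto simp: dist_commute)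
      qed
      then show "y \<in> top_of_set S closure_of T" using y by (auto simp: in_closure_of)
    qed
  qed (rule closure_of_subset_topspace)
qed auto

text \<open>Every zero of the approximation contributes a sign at most 1 to the degree, and distinct
  zeros of the approximation lie near distinct solutions.\<close>

lemma LS_degree_le_card:
  assumes deg: "has_LS_degree F U y m" and UA: "closure U \<subseteq> A k"
    and reg: "\<And>x. x \<in> U \<Longrightarrow> F x = y \<Longrightarrow> \<not> crit x"
  shows "\<exists>S \<subseteq> {x \<in> U. F x = y}. finite S \<and> m \<le> int (card S)"
proof (cases "finite {x \<in> U. F x = y}")
  case False
  \<comment> \<open>With infinitely many solutions any number of them is available; for negative m,
    \<open>nat m\<close> is 0 and the bound is trivial.\<close>
  then obtain S where "finite S" "card S = nat m" "S \<subseteq> {x \<in> U. F x = y}"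
    using infinite_arbitrarily_large by blast
  then show ?thesis by (intro exI[of _ S]) auto
next
  case True
  define Z where "Z = {x \<in> U. F x = y}"
  have finZ: "finite Z" using True by (simp add: Z_def)
  have openU: "open U" using deg by (simp add: has_LS_degree_def)
  have UA': "x \<in> A k" if "x \<in> U" for x using that UA closure_subset by blast
  have "\<exists>r. \<exists>c>0. r > 0 \<and> ball z r \<subseteq> U \<and>
      (\<forall>a\<in>ball z r. \<forall>b\<in>ball z r. c * norm (a - b) \<le> norm (F a - F b)) \<and>
      (\<forall>x\<in>ball z r. \<forall>v. c * norm v \<le> norm (F' x v))" if z: "z \<in> Z" for z
  proof -
    have zU: "z \<in> U" "\<not> crit z" using z reg by (auto simp: Z_def)
    have "\<exists>c>0. \<forall>v. c * norm v \<le> norm (F' z v)"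
    proof (rule compact_perturbation_bounded_below[OF bounded_linear_F'[OF UA'[OF zU(1)]]])
      show "\<exists>l r. strict_mono (r :: nat \<Rightarrow> nat) \<and> (\<lambda>j. V (r j) - F' z (V (r j))) \<longlonglongrightarrow> l"
        if "\<And>j. norm (V j) \<le> 1" for V :: "nat \<Rightarrow> 'a"
        by (rule compact_F'[of "\<lambda>_. z", OF UA'[OF zU(1)] that])
      show "v = 0" if "F' z v = 0" for v using zU(2) that by (auto simp: crit_def)
    qed
    then obtain c where c: "c > 0" "\<And>v. c * norm v \<le> norm (F' z v)" by blast
    have "\<exists>r>0. ball z r \<subseteq> U \<and>
      (\<forall>a\<in>ball z r. \<forall>b\<in>ball z r. c / 2 * norm (a - b) \<le> norm (F a - F b)) \<and>
      (\<forall>x\<in>ball z r. \<forall>v. c / 2 * norm v \<le> norm (F' x v))"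
      by (rule C1_locally_bounded_below[OF openU zU(1) der[OF UA'] cont[OF UA'[OF zU(1)]] c])
    then show ?thesis using half_gt_zero[OF c(1)] by blast
  qed
  then have "\<forall>z\<in>Z. \<exists>r. \<exists>c>0. r > 0 \<and> ball z r \<subseteq> U \<and>
      (\<forall>a\<in>ball z r. \<forall>b\<in>ball z r. c * norm (a - b) \<le> norm (F a - F b)) \<and>
      (\<forall>x\<in>ball z r. \<forall>v. c * norm v \<le> norm (F' x v))" by blast
  from bchoice[OF this] obtain r where "\<forall>z\<in>Z. \<exists>c>0. r z > 0 \<and> ball z (r z) \<subseteq> U \<and>
      (\<forall>a\<in>ball z (r z). \<forall>b\<in>ball z (r z). c * norm (a - b) \<le> norm (F a - F b)) \<and>
      (\<forall>x\<in>ball z (r z). \<forall>v. c * norm v \<le> norm (F' x v))" by blast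
  from bchoice[OF this] obtain c where rc: "\<And>z. z \<in> Z \<Longrightarrow> c z > 0" "\<And>z. z \<in> Z \<Longrightarrow> r z > 0"
    "\<And>z. z \<in> Z \<Longrightarrow> ball z (r z) \<subseteq> U"
    "\<And>z a b. z \<in> Z \<Longrightarrow> a \<in> ball z (r z) \<Longrightarrow> b \<in> ball z (r z) \<Longrightarrow>
      c z * norm (a - b) \<le> norm (F a - F b)"
    "\<And>z x v. z \<in> Z \<Longrightarrow> x \<in> ball z (r z) \<Longrightarrow> c z * norm v \<le> norm (F' x v)"
    by blast
  \<comment> \<open>The inserted 1 gives the minimum a value when there are no solutions.\<close>
  define c0 where "c0 = Min (insert 1 (c ` Z))"
  have c0: "c0 > 0" using finZ rc(1) by (simp add: c0_def)
  have c0_le: "c0 \<le> c z" if "z \<in> Z" for z using finZ that by (simp add: c0_def)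
  define C where "C = closure U - (\<Union>z\<in>Z. ball z (r z))"
  have closedC: "closed C" unfolding C_def by (intro closed_Diff closed_closure open_UN ballI open_ball)
  have frC: "frontier U \<subseteq> C"
    using rc(3) openU by (auto simp: C_def frontier_def interior_open)
  \<comment> \<open>By properness, points of \<open>C\<close> with values tending to
    \<open>y\<close> would accumulate at a solution in \<open>C\<close>; but the frontier contains
    none, and those in \<open>U\<close> lie in the removed balls.\<close>
  have "\<exists>\<epsilon>>0. \<forall>x\<in>C. \<epsilon> \<le> dist (F x) y"
  proof (rule ccontr)
    assume neg: "\<not> ?thesis"
    have "\<exists>x\<in>C. dist (F x) y < inverse (real (Suc j))" for j
    proof (rule ccontr)
      assume "\<not> (\<exists>x\<in>C. dist (F x) y < inverse (real (Suc j)))"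
      then have "\<forall>x\<in>C. inverse (real (Suc j)) \<le> dist (F x) y" by (simp add: not_less)
      moreover have "inverse (real (Suc j)) > 0" by simp
      ultimately show False using neg by blast
    qed
    then obtain X where X: "\<And>j. X j \<in> C" "\<And>j. dist (F (X j)) y < inverse (real (Suc j))" by metis
    have "(\<lambda>j. dist (F (X j)) y) \<longlonglongrightarrow> 0"
    proof (rule Lim_null_comparison[OF _ LIMSEQ_inverse_real_of_nat], intro always_eventually allI)
      show "norm (dist (F (X j)) y) \<le> inverse (real (Suc j))" for j
        unfolding real_norm_def abs_of_nonneg[OF zero_le_dist] by (rule less_imp_le[OF X(2)])
    qed
    then have Fy: "(\<lambda>j. F (X j)) \<longlonglongrightarrow> y" by (rule iffD2[OF tendsto_dist_iff])
    have XA: "X j \<in> A k" for j using X(1)[of j] UA by (auto simp: C_def)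
    obtain x s where x: "strict_mono (s :: nat \<Rightarrow> nat)" "(\<lambda>j. X (s j)) \<longlonglongrightarrow> x" "F x = y"
      using convergent_preimages[of X k y, OF XA Fy] by blast
    have xC: "x \<in> C" using closed_sequentially[OF closedC _ x(2)] X(1) by blast
    have "x \<notin> frontier U" using deg x(3) by (auto simp: has_LS_degree_def)
    then have "x \<in> Z" using xC x(3) openU by (auto simp: C_def Z_def frontier_def interior_open)
    then show False using xC rc(2) centre_in_ball unfolding C_def by blast
  qed
  then obtain \<epsilon> where \<epsilon>: "\<epsilon> > 0" "\<And>x. x \<in> C \<Longrightarrow> \<epsilon> \<le> dist (F x) y" by blast
  \<comment> \<open>Being below \<open>\<epsilon>\<close> keeps zeros of \<open>g\<close> out of
    \<open>C\<close>; being below \<open>c0\<close> leaves \<open>g\<close> and its derivative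
    injective on each ball.\<close>
  define e where "e = min (\<epsilon> / 2) (c0 / 2)"
  have e: "e > 0" "e < \<epsilon>" "e < c0" using \<epsilon>(1) c0 by (auto simp: e_def)
  obtain B0 G G' where G: "finite B0" "\<And>l x. x \<in> A l \<Longrightarrow> G x \<in> span B0"
    "\<And>l x. x \<in> A l \<Longrightarrow> (G has_derivative G' x) (at x)"
    "\<And>l x v. x \<in> A l \<Longrightarrow> G' x v \<in> span B0"
    "\<And>v. continuous_on (\<Union>l. A l) (\<lambda>x. G' x v)"
    "\<And>x. x \<in> A k \<Longrightarrow> norm (G x - (x - F x)) \<le> e"
    "\<And>x v. x \<in> A k \<Longrightarrow> norm (G' x v - (v - F' x v)) \<le> e * norm v"
    by (rule approxE[OF e(1), of k]) metis
  \<comment> \<open>Besides the range of \<open>G\<close>, the span has to contain the target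
    \<open>y\<close>.\<close>
  obtain B where B: "B \<subseteq> insert y B0" "independent B" "insert y B0 \<subseteq> span B"
    using maximal_independent_subset[of "insert y B0"] by blast
  have finB: "finite B" using B(1) G(1) finite_subset by blast
  have spB: "span B0 \<subseteq> span B" using B(3) by (intro span_minimal) auto
  have yB: "y \<in> span B" using B(3) by blast
  have contG: "continuous_on (closure U) G"
    using UA by (intro continuous_at_imp_continuous_on ballI has_derivative_continuous[OF G(3)]) blast
  define W where "W = U \<inter> span B"
  define g where "g x = x - G x" for x
  define g' where "g' x v = v - G' x v" for x v
  have Wcl: "closure W \<subseteq> closure U" unfolding W_def by (intro closure_mono) auto
  have gF: "dist (g x) (F x) \<le> e" if "x \<in> A k" for x
    using G(6)[OF that] by (simp add: g_def dist_norm algebra_simps norm_minus_commute)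
  have g'F: "norm (g' x v - F' x v) \<le> e * norm v" if "x \<in> A k" for x v
    using G(7)[OF that, of v] by (simp add: g'_def algebra_simps norm_minus_commute)
  have der_g: "(g has_derivative g' x) (at x)" if "x \<in> A l" for x l
    unfolding g_def g'_def by (intro has_derivative_diff has_derivative_ident G(3)[OF that])
  have "ls_approx F U y G B"
    unfolding ls_approx_def
  proof (intro conjI finB B(2) yB contG exI[of _ \<epsilon>] ballI)
    show "G ` closure U \<subseteq> span B" using G(2) UA spB by blast
    show "\<epsilon> \<le> dist (F x) y" if "x \<in> frontier U" for x using that frC \<epsilon>(2) by blast
    show "dist (G x) (x - F x) < \<epsilon>" if "x \<in> closure U" for x
      using G(6)[of x] UA that e(2) by (auto simp: dist_norm)
  qed
  then have br: "has_brouwer_degree B g W y m"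
    using deg unfolding has_LS_degree_def W_def g_def by blast
  then have gB: "g ` closure W \<subseteq> span B" by (simp add: has_brouwer_degree_def)
  have near: "\<exists>z\<in>Z. x \<in> ball z (r z)" if x: "x \<in> closure U" "g x = y" for x
  proof (rule ccontr)
    assume "\<not> ?thesis"
    then have "\<epsilon> \<le> dist (F x) y" using x(1) by (intro \<epsilon>(2)) (auto simp: C_def)
    then show False using gF[of x] x UA e(2) by (auto simp: dist_commute)
  qed
  have g'_low: "v = 0" if "z \<in> Z" "x \<in> ball z (r z)" "g' x v = 0" for z x v
  proof -
    have "x \<in> A k" using that(1,2) rc(3) UA' by blast
    then have "norm (F' x v) \<le> e * norm v" using g'F[of x v] that(3) by simp
    moreover have "c0 * norm v \<le> norm (F' x v)"
      using mult_right_mono[OF c0_le[OF that(1)] norm_ge_zero] rc(5)[OF that(1,2)] order_trans by blast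
    ultimately have "(c0 - e) * norm v \<le> 0" by (simp add: algebra_simps)
    then show ?thesis using e(3) by (simp add: mult_le_0_iff)
  qed
  \<comment> \<open>As \<open>g\<close> is already C1 with regular value \<open>y\<close>, it serves
    as its own approximation. Of the distance \<open>\<epsilon>\<close> on the frontier, the passage
    from \<open>F\<close> to \<open>g\<close> costs at most \<open>e\<close>.\<close>
  have "brouwer_approx B W g y g g'"
    unfolding brouwer_approx_def
  proof (intro conjI gB ballI impI exI[of _ "\<epsilon> - e"])
    show "continuous_on (closure W) g"
      unfolding g_def by (intro continuous_intros continuous_on_subset[OF contG Wcl])
    show "(g has_derivative g' x) (at x within span B)" if "x \<in> W" for x
      using that UA' by (intro has_derivative_at_withinI[OF der_g]) (auto simp: W_def)
    show "continuous_on W (\<lambda>x. g' x v)" for v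
      unfolding g'_def using UA'
      by (intro continuous_intros continuous_on_subset[OF G(5)]) (auto simp: W_def)
    show "\<epsilon> - e \<le> dist (g x) y" if x: "x \<in> closure W - W" for x
    proof -
      have xU: "x \<in> closure U" using x Wcl by blast
      \<comment> \<open>Writing a point of the closure as \<open>g x + G x\<close> shows that it
        stays in the span, so the boundary of \<open>W\<close> relative to the span lies in the
        frontier of \<open>U\<close>.\<close>
      have "x \<in> span B"
      proof -
        have "x = g x + G x" by (simp add: g_def)
        moreover have "g x \<in> span B" "G x \<in> span B" using x gB xU UA G(2) spB by blast+
        ultimately show ?thesis using span_add by metis
      qed
      then have "x \<in> frontier U"
        using x xU openU by (auto simp: W_def frontier_def interior_open)
      then have "\<epsilon> \<le> dist (F x) y" using frC \<epsilon>(2) by blast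
      also have "\<dots> \<le> dist (g x) y + dist (g x) (F x)"
        by (metis add.commute dist_commute dist_triangle)
      finally show ?thesis using gF[of x] xU UA by auto
    qed
    show "dist (g x) (g x) < \<epsilon> - e" for x using e(2) by simp
    show "det_on B (g' x) \<noteq> 0" if x: "x \<in> W" "g x = y" for x
    proof (rule det_on_nonzero[OF finB B(2)])
      have xA: "x \<in> A k" "x \<in> closure U" using x UA' closure_subset by (auto simp: W_def)
      show "linear (g' x)" using has_derivative_linear[OF der_g[OF xA(1)]] .
      show "g' x ` span B \<subseteq> span B"
        unfolding g'_def using G(4)[OF xA(1)] spB by (intro image_subsetI span_diff) auto
      show "v = 0" if "g' x v = 0" for v
        using near[OF xA(2) x(2)] g'_low that by blast
    qed
  qed
  then have sum: "(\<Sum>x | x \<in> W \<and> g x = y. sgn (det_on B (g' x))) = of_int m"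
    using br by (simp add: has_brouwer_degree_def)
  define Zg where "Zg = {x. x \<in> W \<and> g x = y}"
  have "\<exists>z\<in>Z. x \<in> ball z (r z)" if "x \<in> Zg" for x
    using near[of x] that closure_subset[of U] by (auto simp: Zg_def W_def)
  then obtain h where h: "\<And>x. x \<in> Zg \<Longrightarrow> h x \<in> Z" "\<And>x. x \<in> Zg \<Longrightarrow> x \<in> ball (h x) (r (h x))"
    by metis
  \<comment> \<open>On one ball \<open>F - g\<close> is Lipschitz with constant \<open>e\<close>,
    while \<open>F\<close> expands distances by at least \<open>c0 > e\<close>; two zeros of
    \<open>g\<close> in the same ball coincide.\<close>
  have inj: "inj_on h Zg"
  proof (rule inj_onI)
    fix a b assume ab: "a \<in> Zg" "b \<in> Zg" "h a = h b"
    define z where "z = h a"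
    have z: "z \<in> Z" "a \<in> ball z (r z)" "b \<in> ball z (r z)" using ab h z_def by metis+
    have "norm ((F a - g a) - (F b - g b)) \<le> e * norm (a - b)"
    proof (rule differentiable_bound[OF convex_ball _ _ z(2,3)])
      fix x assume x: "x \<in> ball z (r z)"
      then have xA: "x \<in> A k" using rc(3)[OF z(1)] UA' by blast
      show "((\<lambda>x. F x - g x) has_derivative (\<lambda>v. F' x v - g' x v)) (at x within ball z (r z))"
        by (intro has_derivative_diff has_derivative_at_withinI[OF der[OF xA]]
            has_derivative_at_withinI[OF der_g[OF xA]])
      show "onorm (\<lambda>v. F' x v - g' x v) \<le> e"
        using g'F[OF xA] e(1) by (intro onorm_bound) (auto simp: norm_minus_commute)
    qed
    moreover have "g a = g b" using ab by (simp add: Zg_def)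
    moreover have "c0 * norm (a - b) \<le> norm (F a - F b)"
      using mult_right_mono[OF c0_le[OF z(1)] norm_ge_zero] rc(4)[OF z] order_trans by blast
    ultimately have "(c0 - e) * norm (a - b) \<le> 0" by (simp add: algebra_simps)
    then show "a = b" using e(3) by (simp add: mult_le_0_iff)
  qed
  have card: "card Zg \<le> card Z" using h(1) by (intro card_inj_on_le[OF inj _ finZ]) auto
  have "of_int m = (\<Sum>x\<in>Zg. sgn (det_on B (g' x)))" using sum by (simp add: Zg_def)
  also have "\<dots> \<le> (\<Sum>x\<in>Zg. 1)" by (intro sum_mono) (simp add: sgn_real_def)
  also have "\<dots> \<le> of_int (int (card Z))" using card by simp
  finally have "m \<le> int (card Z)" by linarith
  then show ?thesis using finZ unfolding Z_def by blast
qed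

end

section \<open>The space \<open>C\<^sup>2\<^sub>p\<^sub>e\<^sub>r\<close>\<close>

lemma c2per_deriv:
  assumes "t \<in> {0..1}"
  shows "(Rep_c2per x has_vector_derivative deriv_I (Rep_c2per x) t) (at t within {0..1})"
    and "(deriv_I (Rep_c2per x) has_vector_derivative D_op x t) (at t within {0..1})"
  using C_space_has_vector_derivative[OF Rep_c2per_C_space[of x], of 0 t]
    C_space_has_vector_derivative[OF Rep_c2per_C_space[of x], of 1 t] assms
  by (simp_all add: D_op_def)

lemma c2per_continuous:
  "continuous_on {0..1} (Rep_c2per x)" "continuous_on {0..1} (deriv_I (Rep_c2per x))"
  "continuous_on {0..1} (D_op x)"
  using C_space_continuous[OF Rep_c2per_C_space[of x], of 0]
    C_space_continuous[OF Rep_c2per_C_space[of x], of 1]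
    C_space_continuous[OF Rep_c2per_C_space[of x], of 2]
  by (simp_all add: D_op_def numeral_2_eq_2)

lemma c2per_periodic:
  "Rep_c2per x 0 = Rep_c2per x 1" "deriv_I (Rep_c2per x) 0 = deriv_I (Rep_c2per x) 1"
proof -
  have "\<forall>j<2. (deriv_I ^^ j) (Rep_c2per x) 0 = (deriv_I ^^ j) (Rep_c2per x) 1"
    using Rep_c2per[of x] by (simp add: C_per_def)
  from this[rule_format, of 0] this[rule_format, of 1]
  show "Rep_c2per x 0 = Rep_c2per x 1" "deriv_I (Rep_c2per x) 0 = deriv_I (Rep_c2per x) 1"
    by simp_all
qed

lemma c2per_outside: "t \<notin> {0..1} \<Longrightarrow> Rep_c2per x t = 0"
  using Rep_c2per_C_space[of x] by (simp add: C_space_def)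

lemma linear_Rep_c2per: "linear (\<lambda>x. Rep_c2per x t)"
  by (rule linearI) (simp_all add: plus_c2per.rep_eq scaleR_c2per.rep_eq)

lemma linear_deriv_Rep_c2per: "linear (\<lambda>x. deriv_I (Rep_c2per x) t)"
proof (rule linearI)
  fix x y :: "'a c2per" and c :: real
  show "deriv_I (Rep_c2per (x + y)) t = deriv_I (Rep_c2per x) t + deriv_I (Rep_c2per y) t"
    using deriv_I_power_add[OF Rep_c2per_C_space Rep_c2per_C_space, of 1 x y]
    by (simp add: plus_c2per.rep_eq)
  show "deriv_I (Rep_c2per (c *\<^sub>R x)) t = c *\<^sub>R deriv_I (Rep_c2per x) t"
    using deriv_I_power_scaleR[OF Rep_c2per_C_space, of 1 c x]
    by (simp add: scaleR_c2per.rep_eq)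
qed

lemma linear_D_op: "linear (\<lambda>x. D_op x t)"
proof (rule linearI)
  fix x y :: "'a c2per" and c :: real
  show "D_op (x + y) t = D_op x t + D_op y t"
    using deriv_I_power_add[OF Rep_c2per_C_space Rep_c2per_C_space, of 2 x y]
    by (simp add: D_op_def plus_c2per.rep_eq numeral_2_eq_2)
  show "D_op (c *\<^sub>R x) t = c *\<^sub>R D_op x t"
    using deriv_I_power_scaleR[OF Rep_c2per_C_space, of 2 c x]
    by (simp add: D_op_def scaleR_c2per.rep_eq numeral_2_eq_2)
qed

lemma linear_mean_c2per: "linear (\<lambda>x. mean (Rep_c2per x))"
  by (rule linearI)
    (simp_all add: mean_def plus_c2per.rep_eq scaleR_c2per.rep_eq integral_add
      integrable_continuous_real c2per_continuous)

lemma norm_le_c2per: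
  assumes "t \<in> {0..1}"
  shows "norm (Rep_c2per x t) \<le> norm x" "norm (deriv_I (Rep_c2per x) t) \<le> norm x"
    "norm (D_op x t) \<le> norm x"
proof -
  let ?S = "\<lambda>j. SUP t\<in>{0..1}. norm ((deriv_I ^^ j) (Rep_c2per x) t)"
  have le: "norm ((deriv_I ^^ j) (Rep_c2per x) t) \<le> norm x" if "j \<le> 2" for j
  proof -
    have "norm ((deriv_I ^^ j) (Rep_c2per x) t) \<le> ?S j"
      by (rule cSUP_upper[OF assms deriv_bdd[OF Rep_c2per_C_space that]])
    also have "\<dots> \<le> (\<Sum>j\<le>2. ?S j)"
      using that by (intro member_le_sum C_norm_summand_nonneg[OF Rep_c2per_C_space]) auto
    finally show ?thesis by (simp add: norm_c2per_def C_norm_def)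
  qed
  from le[of 0] le[of 1] le[of 2]
  show "norm (Rep_c2per x t) \<le> norm x" "norm (deriv_I (Rep_c2per x) t) \<le> norm x"
    "norm (D_op x t) \<le> norm x"
    by (simp_all add: D_op_def numeral_2_eq_2)
qed

lemma c2per_norm_leI:
  assumes "\<And>t. t \<in> {0..1} \<Longrightarrow> norm (Rep_c2per x t) \<le> a"
    "\<And>t. t \<in> {0..1} \<Longrightarrow> norm (deriv_I (Rep_c2per x) t) \<le> b"
    "\<And>t. t \<in> {0..1} \<Longrightarrow> norm (D_op x t) \<le> c"
  shows "norm x \<le> a + b + c"
proof -
  have "(SUP t\<in>{0..1}. norm (Rep_c2per x t)) \<le> a"
    "(SUP t\<in>{0..1}. norm (deriv_I (Rep_c2per x) t)) \<le> b"
    "(SUP t\<in>{0..1}. norm (deriv_I (deriv_I (Rep_c2per x)) t)) \<le> c"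
    using assms by (auto intro!: cSUP_least simp: D_op_def)
  then show ?thesis
    by (simp add: norm_c2per_def C_norm_def numeral_2_eq_2)
qed

lemma norm_mean_le:
  assumes "continuous_on {0..1} f" "\<And>t. t \<in> {0..1} \<Longrightarrow> norm (f t) \<le> s"
  shows "norm (mean f) \<le> s"
  using integral_bound[of 0 1 f s] assms by (simp add: mean_def)

lemma mean_diff:
  "continuous_on {0..1} f \<Longrightarrow> continuous_on {0..1} g \<Longrightarrow> mean (\<lambda>t. f t - g t) = mean f - mean g"
  unfolding mean_def by (intro integral_diff integrable_continuous_real)

lemma mean_const: "mean (\<lambda>t. c) = c"
  by (simp add: mean_def)

lemma mean_cong: "(\<And>t. t \<in> {0..1} \<Longrightarrow> f t = g t) \<Longrightarrow> mean f = mean g"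
  unfolding mean_def by (rule integral_cong) auto

text \<open>\<open>f t - mean f\<close> is the average over u of \<open>f t - f u\<close>, and each
  difference is at most \<open>s\<close> because the interval has length 1.\<close>

lemma norm_diff_mean_le:
  assumes f: "\<And>t. t \<in> {0..1} \<Longrightarrow> (f has_vector_derivative f' t) (at t within {0..1})"
    and s: "\<And>t. t \<in> {0..1} \<Longrightarrow> norm (f' t) \<le> s" and t: "t \<in> {0..1}"
  shows "norm (f t - mean f) \<le> s"
proof -
  have cf: "continuous_on {0..1} f"
    using f by (meson continuous_on_eq_continuous_within has_vector_derivative_continuous)
  have s0: "s \<ge> 0" using s[OF t] norm_ge_zero order_trans by blast
  have osc: "norm (f t - f u) \<le> s" if u: "u \<in> {0..1}" for u
  proof -
    have "norm (f t - f u) \<le> s * norm (t - u)"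
    proof (rule differentiable_bound[OF convex_real_interval(5) _ _ t u])
      fix v :: real assume v: "v \<in> {0..1}"
      show "(f has_derivative (\<lambda>h. h *\<^sub>R f' v)) (at v within {0..1})"
        using f[OF v] by (simp add: has_vector_derivative_def)
      show "onorm (\<lambda>h. h *\<^sub>R f' v) \<le> s"
        using s[OF v] s0 by (intro onorm_bound) (auto simp: mult.commute[of s] intro: mult_left_mono)
    qed
    also have "\<dots> \<le> s * 1" using t u s0 by (intro mult_left_mono) auto
    finally show ?thesis by simp
  qed
  have "f t - mean f = mean (\<lambda>u. f t - f u)"
    using mean_diff[OF continuous_on_const cf, of "f t"] by (simp add: mean_const)
  also have "norm \<dots> \<le> s"
    using osc by (intro norm_mean_le continuous_intros cf)
  finally show ?thesis .
qed

lemma mean_deriv_c2per: "mean (deriv_I (Rep_c2per x)) = 0" "mean (D_op x) = 0"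
proof -
  have "(deriv_I (Rep_c2per x) has_integral (Rep_c2per x 1 - Rep_c2per x 0)) {0..1}"
    by (rule fundamental_theorem_of_calculus) (use c2per_deriv(1)[of _ x] in auto)
  then show "mean (deriv_I (Rep_c2per x)) = 0"
    using c2per_periodic(1)[of x] by (simp add: mean_def integral_unique)
  have "(D_op x has_integral (deriv_I (Rep_c2per x) 1 - deriv_I (Rep_c2per x) 0)) {0..1}"
    by (rule fundamental_theorem_of_calculus) (use c2per_deriv(2)[of _ x] in auto)
  then show "mean (D_op x) = 0"
    using c2per_periodic(2)[of x] by (simp add: mean_def integral_unique)
qed

text \<open>\<open>x \<mapsto> x'' - mean x\<close> identifies \<open>C\<^sup>2\<^sub>p\<^sub>e\<^sub>r\<close> with \<open>C\<^sup>0\<close>.\<close>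

definition E_op :: "('n::finite) c2per \<Rightarrow> real \<Rightarrow> real ^ 'n" where
  "E_op x t = D_op x t - mean (Rep_c2per x)"

lemma linear_E_op: "linear (\<lambda>x. E_op x t)"
  unfolding E_op_def by (intro linear_compose_sub linear_D_op linear_mean_c2per)

lemmas E_op_add = linear_add[OF linear_E_op]
  and E_op_diff = linear_diff[OF linear_E_op]
  and E_op_scaleR = linear_cmul[OF linear_E_op]
  and E_op_sum = linear_sum[OF linear_E_op]

lemma continuous_on_E_op: "continuous_on {0..1} (E_op x)"
  unfolding E_op_def by (intro continuous_intros c2per_continuous)

lemma mean_E_op: "mean (E_op x) = - mean (Rep_c2per x)"
  using mean_diff[OF c2per_continuous(3)[of x] continuous_on_const, of "mean (Rep_c2per x)"]
  by (simp add: E_op_def[abs_def] mean_deriv_c2per mean_const)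

lemma norm_E_op_le: "t \<in> {0..1} \<Longrightarrow> norm (E_op x t) \<le> 2 * norm x"
  using norm_triangle_ineq4[of "D_op x t" "mean (Rep_c2per x)"] norm_le_c2per(3)[of t x]
    norm_mean_le[OF c2per_continuous(1)[of x] norm_le_c2per(1)[of _ x]]
  by (simp add: E_op_def)

text \<open>The derivatives have mean 0, so \<open>E_op x\<close> determines the mean of
  \<open>x\<close>, at most \<open>s\<close>. Then x'' is at most 2s, x' at most 2s, and x itself at
  most 2s + s; the constant is 7 = 3 + 2 + 2.\<close>

lemma norm_le_E_op:
  assumes s: "\<And>t. t \<in> {0..1} \<Longrightarrow> norm (E_op x t) \<le> s"
  shows "norm x \<le> 7 * s"
proof -
  have m: "norm (mean (Rep_c2per x)) \<le> s"
    using norm_mean_le[OF continuous_on_E_op s] by (simp add: mean_E_op)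
  have D: "norm (D_op x t) \<le> 2 * s" if t: "t \<in> {0..1}" for t
    using norm_triangle_ineq[of "E_op x t" "mean (Rep_c2per x)"] s[OF t] m by (simp add: E_op_def)
  have d1: "norm (deriv_I (Rep_c2per x) t) \<le> 2 * s" if t: "t \<in> {0..1}" for t
    using norm_diff_mean_le[OF c2per_deriv(2) D t] by (simp add: mean_deriv_c2per)
  have "norm (Rep_c2per x t - mean (Rep_c2per x)) \<le> 2 * s" if t: "t \<in> {0..1}" for t
    using norm_diff_mean_le[OF c2per_deriv(1) d1 t] .
  then have d0: "norm (Rep_c2per x t) \<le> 3 * s" if t: "t \<in> {0..1}" for t
    using norm_triangle_ineq[of "Rep_c2per x t - mean (Rep_c2per x)" "mean (Rep_c2per x)"] m t
    by fastforce
  show ?thesis using c2per_norm_leI[OF d0 d1 D] by simp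
qed

lemma E_op_eqD:
  assumes "\<And>t. t \<in> {0..1} \<Longrightarrow> E_op x t = E_op y t"
  shows "x = y"
  using norm_le_E_op[of "x - y" 0] assms by (simp add: E_op_diff)

lemma c2per_exI:
  assumes u: "\<And>t. t \<in> {0..1} \<Longrightarrow> (u has_vector_derivative u' t) (at t within {0..1})"
    and u': "\<And>t. t \<in> {0..1} \<Longrightarrow> (u' has_vector_derivative u'' t) (at t within {0..1})"
    and u'': "continuous_on {0..1} u''" and per: "u 0 = u 1" "u' 0 = u' 1"
  shows "\<exists>x :: ('n::finite) c2per. \<forall>t\<in>{0..1}. Rep_c2per x t = u t \<and> D_op x t = u'' t"
proof -
  define ext where "ext f = (\<lambda>t::real. if t \<in> {0..1} then f t else (0 :: real ^ 'n))" for f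
  have vd: "(ext f has_vector_derivative f' t) (at t within {0..1})"
    if "t \<in> {0..1}" "(f has_vector_derivative f' t) (at t within {0..1})" for f f' t
    by (rule has_vector_derivative_transform[OF that(1) _ that(2)]) (simp add: ext_def)
  have dI: "deriv_I (ext f) = ext f'"
    if "\<And>t. t \<in> {0..1} \<Longrightarrow> (f has_vector_derivative f' t) (at t within {0..1})" for f f'
  proof
    fix t show "deriv_I (ext f) t = ext f' t"
      using deriv_I_eqI[OF _ vd[where f = f and f' = f']] that
      by (cases "t \<in> {0..1}") (simp_all add: ext_def deriv_I_def del: atLeastAtMost_iff)
  qed
  have pow: "(deriv_I ^^ 0) (ext u) = ext u" "(deriv_I ^^ 1) (ext u) = ext u'"
    "(deriv_I ^^ 2) (ext u) = ext u''"
    using dI[OF u] dI[OF u'] by (simp_all add: numeral_2_eq_2)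
  have diff: "ext f differentiable_on {0..1}"
    if "\<And>t. t \<in> {0..1} \<Longrightarrow> (f has_vector_derivative f' t) (at t within {0..1})" for f f'
    unfolding differentiable_on_def using vd[where f = f and f' = f'] that differentiableI_vector by blast
  have "ext u \<in> C_per 2"
    unfolding C_per_def C_space_def
  proof (intro CollectI conjI allI impI)
    fix j :: nat assume "j < 2"
    then have j: "j = 0 \<or> j = 1" by linarith
    then show "(deriv_I ^^ j) (ext u) differentiable_on {0..1}"
      using diff[OF u] diff[OF u'] pow by (elim disjE) simp_all
    show "(deriv_I ^^ j) (ext u) 0 = (deriv_I ^^ j) (ext u) 1"
      using j pow per by (elim disjE) (simp_all add: ext_def)
  next
    show "continuous_on {0..1} ((deriv_I ^^ 2) (ext u))"
      unfolding pow(3) by (rule continuous_on_eq[OF u'']) (simp add: ext_def)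
  qed (auto simp: ext_def)
  then have R: "Rep_c2per (Abs_c2per (ext u)) = ext u" by (rule Abs_c2per_inverse)
  have "D_op (Abs_c2per (ext u)) = ext u''"
    unfolding D_op_def R using pow(3) by (simp add: numeral_2_eq_2)
  then show ?thesis using R by (intro exI[of _ "Abs_c2per (ext u)"]) (simp add: ext_def)
qed

lemma E_op_surj:
  assumes f: "continuous_on {0..1} f"
  shows "\<exists>x :: ('n::finite) c2per. \<forall>t\<in>{0..1}. E_op x t = f t"
proof -
  define g where "g t = f t - mean f" for t
  have g: "continuous_on {0..1} g" unfolding g_def by (intro continuous_intros f)
  define G where "G t = integral {0..t} g" for t
  have G: "(G has_vector_derivative g t) (at t within {0..1})" if "t \<in> {0..1}" for t
    unfolding G_def by (rule integral_has_vector_derivative[OF g that])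
  have cG: "continuous_on {0..1} G"
    using G by (meson continuous_on_eq_continuous_within has_vector_derivative_continuous)
  have G1: "G 1 = 0"
    using mean_diff[OF f continuous_on_const, of "mean f"]
    by (simp add: G_def g_def[abs_def] mean_const mean_def[symmetric])
  \<comment> \<open>This integration constant makes the next primitive vanish at 1, which is the
    periodicity of \<open>u\<close>.\<close>
  define h where "h t = G t - mean G" for t
  have h: "(h has_vector_derivative g t) (at t within {0..1})" if "t \<in> {0..1}" for t
    unfolding h_def using has_vector_derivative_diff[OF G[OF that] has_vector_derivative_const] by simp
  have ch: "continuous_on {0..1} h" unfolding h_def by (intro continuous_intros cG)
  define H where "H t = integral {0..t} h" for t
  have H: "(H has_vector_derivative h t) (at t within {0..1})" if "t \<in> {0..1}" for t
    unfolding H_def by (rule integral_has_vector_derivative[OF ch that])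
  have cH: "continuous_on {0..1} H"
    using H by (meson continuous_on_eq_continuous_within has_vector_derivative_continuous)
  have H1: "H 1 = 0"
    using mean_diff[OF cG continuous_on_const, of "mean G"]
    by (simp add: H_def h_def[abs_def] mean_const mean_def[symmetric])
  \<comment> \<open>The last free constant is used to give \<open>u\<close> the mean that
    \<open>mean_E_op\<close> dictates, namely \<open>- mean f\<close>.\<close>
  define u where "u t = H t - (mean H + mean f)" for t
  have u: "(u has_vector_derivative h t) (at t within {0..1})" if "t \<in> {0..1}" for t
    unfolding u_def using has_vector_derivative_diff[OF H[OF that] has_vector_derivative_const] by simp
  have "u 0 = u 1" "h 0 = h 1" using G1 H1 by (simp_all add: u_def h_def G_def H_def)
  from c2per_exI[OF u h g this]
  obtain x :: "'n c2per" where x: "\<And>t. t \<in> {0..1} \<Longrightarrow> Rep_c2per x t = u t \<and> D_op x t = g t"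
    by blast
  have "mean (Rep_c2per x) = mean u" using x by (intro mean_cong) simp
  also have "\<dots> = - mean f"
    using mean_diff[OF cH continuous_on_const, of "mean H + mean f"]
    by (simp add: u_def[abs_def] mean_const)
  finally show ?thesis using x by (intro exI[of _ x]) (simp add: E_op_def g_def)
qed

text \<open>The inverse of \<open>E_op\<close> on continuous functions; the choice is unique by
  \<open>E_op_eqD\<close>. Only the values of \<open>f\<close> on [0,1] matter.\<close>

definition J_op :: "(real \<Rightarrow> real ^ 'n) \<Rightarrow> ('n::finite) c2per" where
  "J_op f = (SOME x. \<forall>t\<in>{0..1}. E_op x t = f t)"

lemma E_op_J_op: "continuous_on {0..1} f \<Longrightarrow> t \<in> {0..1} \<Longrightarrow> E_op (J_op f) t = f t"
  using someI_ex[OF E_op_surj[of f]] unfolding J_op_def by blast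

lemma mean_J_op:
  assumes "continuous_on {0..1} f"
  shows "mean (Rep_c2per (J_op f)) = - mean f"
proof -
  have "mean (E_op (J_op f)) = mean f"
    by (rule mean_cong[OF E_op_J_op[OF assms]])
  then show ?thesis using mean_E_op[of "J_op f"] by (metis minus_equation_iff)
qed

lemma D_op_outside: "t \<notin> {0..1} \<Longrightarrow> D_op x t = 0"
  by (simp add: D_op_def deriv_I_def del: atLeastAtMost_iff)

lemma inj_on_D_op: "inj_on D_op C2per_mean0"
proof (rule inj_onI)
  fix x y assume "x \<in> C2per_mean0" "y \<in> C2per_mean0" "D_op x = D_op y"
  then show "x = y" by (intro E_op_eqD) (simp add: E_op_def C2per_mean0_def)
qed

text \<open>\<open>the_inv_into\<close> is meaningful only on the range of \<open>D_op\<close>; the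
  preimage is found by \<open>J_op\<close>, which maps mean-free functions to mean-free ones.
  Vanishing outside [0,1] is what makes \<open>P_op f\<close> equal to a value of
  \<open>D_op\<close> as a function on the whole line.\<close>

lemma D_inv_P_op:
  assumes f: "continuous_on {0..1} f" and out: "\<And>t. t \<notin> {0..1} \<Longrightarrow> f t = 0"
  shows "D_inv (P_op f) \<in> (C2per_mean0 :: ('n::finite) c2per set)"
    and "D_op (D_inv (P_op f) :: 'n c2per) = P_op f"
proof -
  have P: "P_op f t = (if t \<in> {0..1} then f t - mean f else 0)" for t
    using out by (auto simp: P_op_def Q_op.rep_eq)
  have g: "continuous_on {0..1} (\<lambda>t. f t - mean f)" by (intro continuous_intros f)
  define u :: "'n c2per" where "u = J_op (\<lambda>t. f t - mean f)"
  have m: "mean (Rep_c2per u) = 0"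
    using mean_J_op[OF g] mean_diff[OF f continuous_on_const, of "mean f"]
    by (simp add: u_def mean_const)
  have uC: "u \<in> C2per_mean0" using m by (simp add: C2per_mean0_def)
  have D: "D_op u = P_op f"
  proof
    fix t show "D_op u t = P_op f t"
      using E_op_J_op[OF g, of t] m D_op_outside[of t u] by (auto simp: P u_def E_op_def)
  qed
  have "D_inv (P_op f) = u"
    unfolding D_inv_def by (rule the_inv_into_f_eq[OF inj_on_D_op D uC])
  then show "D_inv (P_op f) \<in> (C2per_mean0 :: 'n c2per set)"
    and "D_op (D_inv (P_op f) :: 'n c2per) = P_op f" using uC D by simp_all
qed

lemma E_op_Q_op: "t \<in> {0..1} \<Longrightarrow> E_op (Q_op f) t = - mean f"
proof -
  assume t: "t \<in> {0..1}"
  have "D_op (Q_op f) t = 0"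
    using t by (simp add: D_op_def Q_op.rep_eq deriv_I_const del: atLeastAtMost_iff)
      (use deriv_I_const[of "0 :: real ^ 'a"] in simp)
  moreover have "mean (Rep_c2per (Q_op f)) = mean f"
    using mean_cong[of "Rep_c2per (Q_op f)" "\<lambda>_. mean f"] by (simp add: Q_op.rep_eq mean_const)
  ultimately show ?thesis by (simp add: E_op_def)
qed

text \<open>Arzela-Ascoli is applied to the images under \<open>E_op\<close>; the limit in
  \<open>c2per\<close> is \<open>J_op\<close> of the uniform limit, and \<open>norm_le_E_op\<close>
  pulls the convergence back.\<close>

lemma seq_compact_c2per:
  fixes u :: "nat \<Rightarrow> ('n::finite) c2per"
  assumes bd: "\<And>j t. t \<in> {0..1} \<Longrightarrow> norm (E_op (u j) t) \<le> M"
    and equi: "\<And>e. e > 0 \<Longrightarrow> \<exists>d>0. \<forall>j. \<forall>s\<in>{0..1}. \<forall>t\<in>{0..1}.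
      \<bar>s - t\<bar> < d \<longrightarrow> norm (E_op (u j) s - E_op (u j) t) < e"
  shows "\<exists>l r. strict_mono (r :: nat \<Rightarrow> nat) \<and> (\<lambda>j. u (r j)) \<longlonglongrightarrow> l"
proof -
  obtain g r where g: "continuous_on {0..1} g" "strict_mono (r :: nat \<Rightarrow> nat)"
    "\<And>e. 0 < e \<Longrightarrow> \<exists>N. \<forall>n x. n \<ge> N \<and> x \<in> {0..1} \<longrightarrow> norm (E_op (u (r n)) x - g x) < e"
  proof (rule Arzela_Ascoli[of "{0..1::real}" "\<lambda>n. E_op (u n)" M])
    show "\<exists>d>0. \<forall>n y. y \<in> {0..1} \<and> norm (x - y) < d \<longrightarrow> norm (E_op (u n) x - E_op (u n) y) < e"
      if "x \<in> {0..1}" "0 < e" for x e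
      using equi[OF that(2)] that(1) by (metis real_norm_def)
  qed (use bd in auto)
  have "(\<lambda>j. u (r j)) \<longlonglongrightarrow> J_op g"
  proof (rule LIMSEQ_I)
    fix e :: real assume e: "e > 0"
    \<comment> \<open>\<open>e / 8\<close> leaves a strict inequality after the factor 7 of
      \<open>norm_le_E_op\<close>.\<close>
    then obtain N where N: "\<And>n x. n \<ge> N \<Longrightarrow> x \<in> {0..1} \<Longrightarrow> norm (E_op (u (r n)) x - g x) < e / 8"
      using g(3)[of "e / 8"] by auto
    have "norm (u (r n) - J_op g) < e" if "n \<ge> N" for n
    proof -
      have "norm (u (r n) - J_op g) \<le> 7 * (e / 8)"
        using N[OF that] by (intro norm_le_E_op) (simp add: E_op_diff E_op_J_op[OF g(1)] less_imp_le)
      then show ?thesis using e by simp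
    qed
    then show "\<exists>N. \<forall>n\<ge>N. norm (u (r n) - J_op g) < e" by blast
  qed
  then show ?thesis using g(2) by blast
qed

section \<open>The repulsive nonlinearity\<close>

definition repulsion :: "real \<Rightarrow> 'a::euclidean_space \<Rightarrow> 'a" where
  "repulsion q \<xi> = \<xi> /\<^sub>R (norm \<xi> powr (q + 1))"

text \<open>A symmetric operator: for \<xi> \<noteq> 0 its eigenvalue orthogonal to
  \<open>\<xi>\<close> is \<open>norm \<xi> powr - (q + 1)\<close>, and along \<open>\<xi>\<close>
  it is -q times that number.\<close>

definition repulsion_deriv :: "real \<Rightarrow> 'a::euclidean_space \<Rightarrow> 'a \<Rightarrow> 'a" where
  "repulsion_deriv q \<xi> v = norm \<xi> powr - (q + 1) *\<^sub>R v - ((q + 1) * norm \<xi> powr - (q + 3) * (\<xi> \<bullet> v)) *\<^sub>R \<xi>"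

text \<open>Compact pieces that exhaust the complement of 0; on each of them the nonlinearity and
  its derivative are bounded and uniformly continuous.\<close>

definition annulus :: "nat \<Rightarrow> 'a::euclidean_space set" where
  "annulus k = {\<xi>. inverse (real (Suc k)) \<le> norm \<xi> \<and> norm \<xi> \<le> real (Suc k)}"

lemma annulus_nonzero: "\<xi> \<in> annulus k \<Longrightarrow> \<xi> \<noteq> 0"
  by (auto simp: annulus_def not_le)

lemma compact_annulus: "compact (annulus k :: 'a::euclidean_space set)"
proof -
  have "annulus k = cball 0 (real (Suc k)) - ball 0 (inverse (real (Suc k)))"
    by (auto simp: annulus_def)
  then show ?thesis using compact_diff[OF compact_cball open_ball, of "0 :: 'a"] by metis
qed

lemma linear_repulsion_deriv: "linear (repulsion_deriv q \<xi>)"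
  by (rule linearI) (simp_all add: repulsion_deriv_def algebra_simps inner_add_right)

lemma bounded_linear_repulsion_deriv: "bounded_linear (repulsion_deriv q \<xi>)"
  by (rule linear_conv_bounded_linear[THEN iffD1, OF linear_repulsion_deriv])

lemma has_derivative_repulsion:
  assumes "\<xi> \<noteq> 0"
  shows "(repulsion q has_derivative repulsion_deriv q \<xi>) (at \<xi>)"
proof -
  have eq: "repulsion q = (\<lambda>\<xi>. norm \<xi> powr - (q + 1) *\<^sub>R \<xi>)"
    by (simp add: repulsion_def[abs_def] powr_minus[symmetric])
  have n: "(norm has_derivative (\<lambda>h. h \<bullet> sgn \<xi>)) (at \<xi>)"
    by (rule has_derivative_norm[OF assms])
  have "((\<lambda>\<xi>. norm \<xi> powr - (q + 1)) has_derivative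
      (\<lambda>h. (h \<bullet> sgn \<xi>) * (- (q + 1) * norm \<xi> powr (- (q + 1) - 1)))) (at \<xi>)"
    using has_real_derivative_powr[of "norm \<xi>" "- (q + 1)"] assms
    by (intro has_derivative_compose[OF n, of "\<lambda>z. z powr - (q + 1)"
          "\<lambda>h. h * (- (q + 1) * norm \<xi> powr (- (q + 1) - 1))"])
      (simp add: has_field_derivative_def mult.commute[of _ "- (q + 1) * _"] mult_commute_abs)
  from has_derivative_scaleR[OF this has_derivative_ident]
  have "(repulsion q has_derivative (\<lambda>h. norm \<xi> powr - (q + 1) *\<^sub>R h +
      ((h \<bullet> sgn \<xi>) * (- (q + 1) * norm \<xi> powr (- (q + 1) - 1))) *\<^sub>R \<xi>)) (at \<xi>)"
    by (simp add: eq)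
  moreover have "(h \<bullet> sgn \<xi>) * (- (q + 1) * norm \<xi> powr (- (q + 1) - 1)) =
      - ((q + 1) * norm \<xi> powr - (q + 3) * (\<xi> \<bullet> h))" for h
  proof -
    have "inverse (norm \<xi>) = norm \<xi> powr - 1" using assms by (simp add: powr_minus)
    then have "norm \<xi> powr (- (q + 1) - 1) * inverse (norm \<xi>) = norm \<xi> powr - (q + 3)"
      by (simp only: powr_add[symmetric]) (simp add: algebra_simps)
    moreover have "h \<bullet> sgn \<xi> = inverse (norm \<xi>) * (\<xi> \<bullet> h)"
      by (simp add: sgn_div_norm inner_commute)
    ultimately show ?thesis by (metis (no_types, opaque_lifting) mult.assoc mult.commute mult_minus_left)
  qed
  ultimately show ?thesis by (simp add: repulsion_deriv_def[abs_def])
qed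

lemma continuous_on_repulsion: "0 \<notin> S \<Longrightarrow> continuous_on S (repulsion q)"
  by (intro continuous_at_imp_continuous_on ballI has_derivative_continuous[OF has_derivative_repulsion]) auto

lemma continuous_on_repulsion_deriv:
  assumes f: "continuous_on S f" and g: "continuous_on S g" and "\<And>x. x \<in> S \<Longrightarrow> f x \<noteq> 0"
  shows "continuous_on S (\<lambda>x. repulsion_deriv q (f x) (g x))"
  unfolding repulsion_deriv_def using assms(3) by (intro continuous_intros f g) auto

lemma repulsion_uniformly_continuous:
  assumes "e > 0"
  shows "\<exists>d>0. \<forall>\<xi>\<in>(annulus k :: 'a::euclidean_space set). \<forall>\<eta>\<in>annulus k. norm (\<xi> - \<eta>) < d \<longrightarrow> norm (repulsion q \<xi> - repulsion q \<eta>) < e"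
proof -
  have "uniformly_continuous_on (annulus k :: 'a set) (repulsion q)"
    by (intro compact_uniformly_continuous continuous_on_repulsion compact_annulus)
      (auto dest: annulus_nonzero)
  then show ?thesis
    unfolding uniformly_continuous_on_def dist_norm using assms by (metis (no_types, lifting))
qed

lemma repulsion_deriv_uniformly_continuous:
  assumes "e > 0"
  shows "\<exists>d>0. \<forall>\<xi>\<in>(annulus k :: 'a::euclidean_space set). \<forall>\<eta>\<in>annulus k. norm (\<xi> - \<eta>) < d \<longrightarrow>
    (\<forall>v. norm (repulsion_deriv q \<xi> v - repulsion_deriv q \<eta> v) \<le> e * norm v)"
proof -
  let ?S = "annulus k \<times> cball (0::'a) 1"
  have "uniformly_continuous_on ?S (\<lambda>z. repulsion_deriv q (fst z) (snd z))"
    by (intro compact_uniformly_continuous continuous_on_repulsion_deriv continuous_intros compact_Times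
        compact_annulus compact_cball) (auto dest: annulus_nonzero)
  then obtain d where d: "d > 0" "\<And>x x'. x \<in> ?S \<Longrightarrow> x' \<in> ?S \<Longrightarrow> dist x' x < d \<Longrightarrow>
      dist (repulsion_deriv q (fst x') (snd x')) (repulsion_deriv q (fst x) (snd x)) < e"
    unfolding uniformly_continuous_on_def using assms by metis
  have "norm (repulsion_deriv q \<xi> v - repulsion_deriv q \<eta> v) \<le> e * norm v"
    if \<xi>: "\<xi> \<in> annulus k" "\<eta> \<in> annulus k" "norm (\<xi> - \<eta>) < d" for \<xi> \<eta> v :: 'a
  proof (cases "v = 0")
    case False
    define u where "u = v /\<^sub>R norm v"
    have u: "norm u = 1" "v = norm v *\<^sub>R u" using False by (simp_all add: u_def)
    have "norm (repulsion_deriv q \<xi> u - repulsion_deriv q \<eta> u) < e"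
      using d(2)[of "(\<eta>, u)" "(\<xi>, u)"] \<xi> u(1) by (simp add: dist_Pair_Pair dist_norm)
    moreover have "repulsion_deriv q \<xi> v - repulsion_deriv q \<eta> v = norm v *\<^sub>R (repulsion_deriv q \<xi> u - repulsion_deriv q \<eta> u)"
      by (subst (1 2) u(2)) (simp only: linear_cmul[OF linear_repulsion_deriv] scaleR_right_diff_distrib)
    ultimately show ?thesis
      by (simp add: mult.commute[of "norm v"] mult_right_mono)
  qed (simp add: linear_0[OF linear_repulsion_deriv])
  then show ?thesis using d(1) by blast
qed

lemma repulsion_bounded: "\<exists>M. \<forall>\<xi>\<in>(annulus k :: 'a::euclidean_space set). norm (repulsion q \<xi>) \<le> M"
proof -
  have "compact (repulsion q ` (annulus k :: 'a set))"
    by (intro compact_continuous_image continuous_on_repulsion compact_annulus) (auto dest: annulus_nonzero)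
  from compact_imp_bounded[OF this] show ?thesis by (auto simp: bounded_iff)
qed

lemma repulsion_deriv_bounded: "\<exists>M>0. \<forall>\<xi>\<in>(annulus k :: 'a::euclidean_space set). \<forall>v. norm (repulsion_deriv q \<xi> v) \<le> M * norm v"
proof -
  let ?S = "annulus k \<times> cball (0::'a) 1"
  have "compact ((\<lambda>z. repulsion_deriv q (fst z) (snd z)) ` ?S)"
    by (intro compact_continuous_image continuous_on_repulsion_deriv continuous_intros compact_Times
        compact_annulus compact_cball) (auto dest: annulus_nonzero)
  from compact_imp_bounded[OF this]
  obtain M where M: "M > 0" "\<And>\<xi> u :: 'a. \<xi> \<in> annulus k \<Longrightarrow> norm u \<le> 1 \<Longrightarrow> norm (repulsion_deriv q \<xi> u) \<le> M"
    unfolding bounded_pos by (auto simp: image_iff)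
  have "norm (repulsion_deriv q \<xi> v) \<le> M * norm v" if \<xi>: "\<xi> \<in> annulus k" for \<xi> v :: 'a
  proof (cases "v = 0")
    case False
    define u where "u = v /\<^sub>R norm v"
    have u: "norm u = 1" "v = norm v *\<^sub>R u" using False by (simp_all add: u_def)
    have "repulsion_deriv q \<xi> v = norm v *\<^sub>R repulsion_deriv q \<xi> u"
      by (subst (1) u(2)) (simp only: linear_cmul[OF linear_repulsion_deriv])
    then show ?thesis
      using mult_left_mono[OF M(2)[OF \<xi>, of u] norm_ge_zero[of v]] u(1) by (simp add: mult.commute)
  qed (simp add: linear_0[OF linear_repulsion_deriv])
  then show ?thesis using M(1) by blast
qed

text \<open>The radius allowed is half the inner radius, and \<open>Suc (2 * k + 1)\<close> is twice
  \<open>Suc k\<close>: halving the inner and doubling the outer radius stays in the family.\<close>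

lemma annulus_nhd:
  assumes "\<xi> \<in> annulus k" "norm h \<le> inverse (2 * real (Suc k))"
  shows "\<xi> + h \<in> annulus (2 * k + 1)"
proof -
  define K where "K = real (Suc k)"
  define a where "a = inverse (2 * K)"
  have K: "K \<ge> 1" by (simp add: K_def)
  have "norm \<xi> - norm h \<le> norm (\<xi> + h)" "norm (\<xi> + h) \<le> norm \<xi> + norm h"
    by (rule norm_diff_ineq) (rule norm_triangle_ineq)
  moreover have "inverse K = 2 * a" by (simp add: a_def)
  moreover have "a \<le> K"
  proof -
    have "a \<le> 1" unfolding a_def by (rule inverse_le_1_iff[THEN iffD2]) (use K in simp)
    then show ?thesis using K by simp
  qed
  moreover have "2 * a \<le> norm \<xi>" "norm \<xi> \<le> K" "norm h \<le> a"
    using assms \<open>inverse K = 2 * a\<close> by (auto simp: annulus_def K_def a_def)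
  ultimately have "a \<le> norm (\<xi> + h)" "norm (\<xi> + h) \<le> 2 * K" by linarith+
  moreover have "real (Suc (2 * k + 1)) = 2 * K" by (simp add: K_def)
  ultimately show ?thesis unfolding annulus_def a_def by simp
qed

text \<open>An annulus is not convex, so the mean value inequality is used on a ball around
  \<open>\<xi>\<close> inside the larger annulus, where the derivative is uniformly
  continuous.\<close>

lemma repulsion_uniformly_differentiable:
  assumes e: "e > 0"
  shows "\<exists>d>0. \<forall>\<xi>\<in>(annulus k :: 'a::euclidean_space set). \<forall>h. norm h < d \<longrightarrow>
    norm (repulsion q (\<xi> + h) - repulsion q \<xi> - repulsion_deriv q \<xi> h) \<le> e * norm h"
proof -
  obtain d1 where d1: "d1 > 0" "\<And>\<xi> \<eta> v. \<xi> \<in> annulus (2 * k + 1) \<Longrightarrow> \<eta> \<in> annulus (2 * k + 1) \<Longrightarrow>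
      norm (\<xi> - \<eta>) < d1 \<Longrightarrow> norm (repulsion_deriv q \<xi> v - repulsion_deriv q \<eta> v) \<le> e * norm (v :: 'a)"
    using repulsion_deriv_uniformly_continuous[OF e, of "2 * k + 1" q] by blast
  define d where "d = min d1 (inverse (2 * real (Suc k)))"
  have d: "d > 0" "d \<le> d1" "d \<le> inverse (2 * real (Suc k))" using d1(1) by (auto simp: d_def)
  have "norm (repulsion q (\<xi> + h) - repulsion q \<xi> - repulsion_deriv q \<xi> h) \<le> e * norm h"
    if \<xi>: "\<xi> \<in> annulus k" and h: "norm h < d" for \<xi> h :: 'a
  proof -
    have ann: "\<eta> \<in> annulus (2 * k + 1)" if "\<eta> \<in> ball \<xi> d" for \<eta>
      using annulus_nhd[OF \<xi>, of "\<eta> - \<xi>"] that d(3) by (simp add: dist_norm norm_minus_commute)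
    have "norm ((repulsion q (\<xi> + h) - repulsion_deriv q \<xi> (\<xi> + h)) - (repulsion q \<xi> - repulsion_deriv q \<xi> \<xi>)) \<le> e * norm ((\<xi> + h) - \<xi>)"
    proof (rule differentiable_bound[OF convex_ball[of \<xi> d]])
      fix \<eta> assume \<eta>: "\<eta> \<in> ball \<xi> d"
      show "((\<lambda>\<eta>. repulsion q \<eta> - repulsion_deriv q \<xi> \<eta>) has_derivative (\<lambda>v. repulsion_deriv q \<eta> v - repulsion_deriv q \<xi> v)) (at \<eta> within ball \<xi> d)"
        using annulus_nonzero[OF ann[OF \<eta>]]
        by (intro has_derivative_diff has_derivative_at_withinI[OF has_derivative_repulsion]
            has_derivative_at_withinI[OF bounded_linear_imp_has_derivative[OF bounded_linear_repulsion_deriv]])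
      show "onorm (\<lambda>v. repulsion_deriv q \<eta> v - repulsion_deriv q \<xi> v) \<le> e"
        using d1(2)[OF ann[OF \<eta>] ann[of \<xi>]] \<eta> d e
        by (intro onorm_bound) (auto simp: dist_norm norm_minus_commute)
    qed (use h d(1) in \<open>auto simp: dist_norm\<close>)
    then show ?thesis by (simp add: linear_add[OF linear_repulsion_deriv] algebra_simps)
  qed
  then show ?thesis using d(1) by blast
qed

lemma repulsion_deriv_symmetric: "repulsion_deriv q \<xi> v \<bullet> w = v \<bullet> repulsion_deriv q \<xi> w"
  by (simp add: repulsion_deriv_def inner_diff_left inner_diff_right inner_commute[of \<xi>])

text \<open>Pairing with \<open>\<xi>\<close> isolates the radial eigenvalue, which is nonzero for q
  \<noteq> 0, so \<open>v\<close> is orthogonal to \<open>\<xi>\<close>; there the operator is a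
  positive multiple of the identity.\<close>

lemma repulsion_deriv_inj:
  assumes "\<xi> \<noteq> 0" "q \<noteq> 0" "repulsion_deriv q \<xi> v = 0"
  shows "v = 0"
proof -
  have "norm \<xi> powr - (q + 3) * (\<xi> \<bullet> \<xi>) = norm \<xi> powr - (q + 3) * norm \<xi> powr 2"
    using assms(1) by (simp add: power2_norm_eq_inner powr_numeral)
  also have "\<dots> = norm \<xi> powr - (q + 1)"
    unfolding powr_add[symmetric] by (rule arg_cong[where f = "\<lambda>a. norm \<xi> powr a"]) simp
  finally have *: "norm \<xi> powr - (q + 3) * (\<xi> \<bullet> \<xi>) = norm \<xi> powr - (q + 1)" .
  have "\<xi> \<bullet> repulsion_deriv q \<xi> v = norm \<xi> powr - (q + 1) * (\<xi> \<bullet> v) -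
      (q + 1) * (norm \<xi> powr - (q + 3) * (\<xi> \<bullet> \<xi>)) * (\<xi> \<bullet> v)"
    by (simp add: repulsion_deriv_def inner_diff_right)
  also have "\<dots> = - q * norm \<xi> powr - (q + 1) * (\<xi> \<bullet> v)"
    unfolding * by (simp add: algebra_simps)
  finally have "\<xi> \<bullet> v = 0" using assms by simp
  then show ?thesis using assms by (simp add: repulsion_deriv_def)
qed

lemma norm_repulsion: "\<xi> \<noteq> 0 \<Longrightarrow> norm (repulsion q \<xi>) = norm \<xi> powr - q"
  by (simp add: repulsion_def powr_add powr_minus field_simps)

section \<open>The functional as a smooth compact perturbation\<close>

text \<open>The upper bound gives a common Lipschitz constant, the lower one keeps all values away
  from the singularity.\<close>

definition c2per_level :: "nat \<Rightarrow> ('n::finite) c2per set" where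
  "c2per_level k = {x. norm x \<le> real (Suc k) \<and> (\<forall>t\<in>{0..1}. inverse (real (Suc k)) \<le> norm (Rep_c2per x t))}"

text \<open>Written through \<open>J_op\<close> so that \<open>E_op\<close> of it is v'' - N'(x) v:
  the subtracted mean cancels the one contained in \<open>E_op v\<close>.\<close>

definition F_deriv :: "real \<Rightarrow> ('n::finite) c2per \<Rightarrow> 'n c2per \<Rightarrow> 'n c2per" where
  "F_deriv q x v = v - J_op (\<lambda>t. repulsion_deriv q (Rep_c2per x t) (Rep_c2per v t) - mean (Rep_c2per v))"

lemmas Rep_c2per_add = linear_add[OF linear_Rep_c2per]
  and Rep_c2per_diff = linear_diff[OF linear_Rep_c2per]
  and mean_c2per_diff = linear_diff[OF linear_mean_c2per]

lemma Rep_c2per_annulus: "x \<in> c2per_level k \<Longrightarrow> t \<in> {0..1} \<Longrightarrow> Rep_c2per x t \<in> annulus k"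
  using norm_le_c2per(1)[of t x] by (auto simp: c2per_level_def annulus_def)

lemma c2per_nonvanishing_eq: "(C2per_nonvanishing :: ('n::finite) c2per set) = (\<Union>k. c2per_level k)"
proof (intro equalityI subsetI)
  fix x :: "'n c2per" assume x: "x \<in> C2per_nonvanishing"
  obtain m where m: "m > 0" "\<And>t. t \<in> {0..1} \<Longrightarrow> m \<le> norm (Rep_c2per x t)"
  proof -
    have "continuous_on {0..1} (\<lambda>t. norm (Rep_c2per x t))"
      by (intro continuous_intros c2per_continuous)
    from continuous_attains_inf[OF compact_Icc _ this]
    obtain t0 where t0: "t0 \<in> {0..1}" "\<forall>t\<in>{0..1}. norm (Rep_c2per x t0) \<le> norm (Rep_c2per x t)"
      by auto
    show thesis
      by (rule that[of "norm (Rep_c2per x t0)"]) (use x t0 in \<open>auto simp: C2per_nonvanishing_def\<close>)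
  qed
  obtain k1 where k1: "inverse (real (Suc k1)) < m" using reals_Archimedean[OF m(1)] by blast
  obtain k2 where k2: "norm x \<le> real k2" using real_arch_simple by blast
  have le: "inverse (real (Suc (max k1 k2))) \<le> inverse (real (Suc k1))" by (intro le_imp_inverse_le) auto
  have "x \<in> c2per_level (max k1 k2)"
    unfolding c2per_level_def mem_Collect_eq
  proof (intro conjI ballI)
    show "norm x \<le> real (Suc (max k1 k2))" using k2 by simp
    show "inverse (real (Suc (max k1 k2))) \<le> norm (Rep_c2per x t)" if "t \<in> {0..1}" for t
      by (rule order_trans[OF le order_trans[OF less_imp_le[OF k1] m(2)[OF that]]])
  qed
  then show "x \<in> (\<Union>k. c2per_level k)" by blast
next
  fix x :: "'n c2per" assume "x \<in> (\<Union>k. c2per_level k)"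
  then show "x \<in> C2per_nonvanishing"
    using Rep_c2per_annulus annulus_nonzero by (auto simp: C2per_nonvanishing_def simp del: atLeastAtMost_iff) blast
qed

text \<open>All means cancel: the first \<open>Q_op\<close> contributes \<open>- mean (N x)\<close>,
  which the mean-free last summand compensates, and \<open>Q_op x\<close> compensates the mean in
  \<open>E_op x\<close>.\<close>

lemma E_op_F_op:
  assumes x: "x \<in> c2per_level k" and t: "t \<in> {0..1}"
  shows "E_op (F_op q x) t = D_op x t - repulsion q (Rep_c2per x t)"
proof -
  let ?N = "N_op q (Rep_c2per x)"
  have N: "?N = (\<lambda>t. repulsion q (Rep_c2per x t))" by (simp add: N_op_def repulsion_def)
  have cN: "continuous_on {0..1} ?N"
    unfolding N
    by (rule continuous_on_compose2[OF continuous_on_repulsion[of "- {0}"] c2per_continuous(1)])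
      (use annulus_nonzero[OF Rep_c2per_annulus[OF x]] in auto)
  have out: "?N t = 0" if "t \<notin> {0..1}" for t
    using c2per_outside[OF that, of x] by (simp add: N_op_def)
  have P: "P_op ?N t = ?N t - mean ?N" using t by (simp add: P_op_def Q_op.rep_eq)
  have "E_op (D_inv (P_op ?N) :: 'a c2per) t = ?N t - mean ?N"
    using D_inv_P_op[OF cN out] P by (simp add: E_op_def C2per_mean0_def)
  then show ?thesis
    unfolding F_op_def using t
    by (simp add: E_op_add E_op_diff E_op_Q_op) (simp add: E_op_def N)
qed

lemma continuous_on_repulsion_deriv_c2per:
  assumes "x \<in> c2per_level k"
  shows "continuous_on {0..1} (\<lambda>t. repulsion_deriv q (Rep_c2per x t) (Rep_c2per v t))"
  using Rep_c2per_annulus[OF assms] annulus_nonzero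
  by (intro continuous_on_repulsion_deriv c2per_continuous) blast

lemma E_op_F_deriv:
  assumes x: "x \<in> c2per_level k" and t: "t \<in> {0..1}"
  shows "E_op (F_deriv q x v) t = D_op v t - repulsion_deriv q (Rep_c2per x t) (Rep_c2per v t)"
proof -
  have "continuous_on {0..1} (\<lambda>t. repulsion_deriv q (Rep_c2per x t) (Rep_c2per v t) - mean (Rep_c2per v))"
    by (intro continuous_intros continuous_on_repulsion_deriv_c2per[OF x])
  from E_op_J_op[OF this t] show ?thesis
    by (simp add: F_deriv_def E_op_diff) (simp add: E_op_def)
qed

lemma bounded_linear_via_E_op:
  fixes L :: "('n::finite) c2per \<Rightarrow> 'n c2per"
  assumes L: "\<And>v t. t \<in> {0..1} \<Longrightarrow> E_op (L v) t = l t v"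
    and lin: "\<And>t. t \<in> {0..1} \<Longrightarrow> linear (l t)"
    and M: "\<And>t v. t \<in> {0..1} \<Longrightarrow> norm (l t v) \<le> M * norm v"
  shows "bounded_linear L"
proof (rule bounded_linear_intro)
  show "L (v + w) = L v + L w" for v w
    by (rule E_op_eqD) (simp only: L E_op_add linear_add[OF lin])
  show "L (c *\<^sub>R v) = c *\<^sub>R L v" for c v
    by (rule E_op_eqD) (simp only: L E_op_scaleR linear_cmul[OF lin])
  show "norm (L v) \<le> norm v * (7 * M)" for v
    using norm_le_E_op[of "L v" "M * norm v"] M by (simp add: L mult.commute mult.left_commute)
qed

lemma c2per_lipschitz:
  assumes "s \<in> {0..1}" "t \<in> {0..1}"
  shows "norm (Rep_c2per x s - Rep_c2per x t) \<le> norm x * \<bar>s - t\<bar>"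
proof -
  have "norm (Rep_c2per x s - Rep_c2per x t) \<le> norm x * norm (s - t)"
  proof (rule differentiable_bound[OF convex_real_interval(5) _ _ assms])
    fix v :: real assume v: "v \<in> {0..1}"
    show "(Rep_c2per x has_derivative (\<lambda>h. h *\<^sub>R deriv_I (Rep_c2per x) v)) (at v within {0..1})"
      using c2per_deriv(1)[OF v] by (simp add: has_vector_derivative_def)
    show "onorm (\<lambda>h. h *\<^sub>R deriv_I (Rep_c2per x) v) \<le> norm x"
      using norm_le_c2per(2)[OF v, of x]
      by (intro onorm_bound) (auto simp: mult.commute[of "norm x"] intro: mult_left_mono)
  qed
  then show ?thesis by simp
qed

lemma bounded_linear_Rep_c2per: "bounded_linear (\<lambda>x. Rep_c2per x t)"
proof (rule bounded_linear_intro[where K = 1])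
  show "norm (Rep_c2per x t) \<le> norm x * 1" for x :: "'a c2per"
    using norm_le_c2per(1)[of t x] c2per_outside[of t x] by (cases "t \<in> {0..1}") auto
qed (simp_all add: Rep_c2per_add linear_cmul[OF linear_Rep_c2per])

lemma closed_c2per_level: "closed (c2per_level k)"
proof -
  have "c2per_level k = {x :: 'a c2per. norm x \<le> real (Suc k)} \<inter>
      (\<Inter>t\<in>{0..1}. {x. inverse (real (Suc k)) \<le> norm (Rep_c2per x t)})"
    by (auto simp: c2per_level_def)
  moreover have "closed {x :: 'a c2per. norm x \<le> real (Suc k)}"
    by (intro closed_Collect_le continuous_intros)
  moreover have "closed {x :: 'a c2per. inverse (real (Suc k)) \<le> norm (Rep_c2per x t)}" for t
    by (intro closed_Collect_le continuous_intros linear_continuous_on[OF bounded_linear_Rep_c2per])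
  ultimately show ?thesis by (simp add: closed_Int closed_INT)
qed

lemma c2per_level_nhd:
  assumes x: "x \<in> c2per_level k" and y: "norm (y - x) \<le> inverse (2 * real (Suc k))"
  shows "y \<in> c2per_level (2 * k + 1)"
proof -
  have "Rep_c2per y t \<in> annulus (2 * k + 1)" if t: "t \<in> {0..1}" for t
    using annulus_nhd[OF Rep_c2per_annulus[OF x t], of "Rep_c2per (y - x) t"]
      norm_le_c2per(1)[OF t, of "y - x"] y by (simp add: Rep_c2per_diff)
  moreover have "norm y \<le> real (Suc (2 * k + 1))"
  proof -
    have "inverse (2 * real (Suc k)) \<le> 1" by (rule inverse_le_1_iff[THEN iffD2]) simp
    then have "norm y \<le> norm x + 1" using norm_triangle_sub[of y x] y by linarith
    then show ?thesis using x by (simp add: c2per_level_def)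
  qed
  ultimately show ?thesis by (simp add: c2per_level_def annulus_def)
qed

text \<open>A modulus of continuity for N'(x(t)) v(t), uniform over a level and linear in
  \<open>norm v\<close>. Moving the base point x(t) costs \<open>e\<close>, moving the argument v(t)
  costs \<open>M\<close> times the distance, as \<open>v\<close> is Lipschitz with constant
  \<open>norm v\<close>.\<close>

lemma norm_repulsion_deriv_c2per_diff:
  fixes x v :: "('n::finite) c2per"
  assumes M: "\<And>\<xi> v :: real ^ 'n. \<xi> \<in> annulus k \<Longrightarrow> norm (repulsion_deriv q \<xi> v) \<le> M * norm v" "M > 0"
    and d: "\<And>\<xi> \<eta> v :: real ^ 'n. \<xi> \<in> annulus k \<Longrightarrow> \<eta> \<in> annulus k \<Longrightarrow> norm (\<xi> - \<eta>) < d \<Longrightarrow>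
      norm (repulsion_deriv q \<xi> v - repulsion_deriv q \<eta> v) \<le> e * norm v"
    and x: "x \<in> c2per_level k" and st: "s \<in> {0..1}" "t \<in> {0..1}" "\<bar>s - t\<bar> < d / real (Suc k)"
    and e: "e > 0"
  shows "norm (repulsion_deriv q (Rep_c2per x s) (Rep_c2per v s) - repulsion_deriv q (Rep_c2per x t) (Rep_c2per v t))
    \<le> (e + M * \<bar>s - t\<bar>) * norm v"
proof -
  let ?x = "Rep_c2per x" and ?v = "Rep_c2per v"
  have "norm (?x s - ?x t) \<le> norm x * \<bar>s - t\<bar>" by (rule c2per_lipschitz[OF st(1,2)])
  also have "\<dots> \<le> real (Suc k) * \<bar>s - t\<bar>" using x by (intro mult_right_mono) (auto simp: c2per_level_def)
  also have "\<dots> < d" using st(3) by (simp add: field_simps)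
  finally have 1: "norm (repulsion_deriv q (?x s) (?v s) - repulsion_deriv q (?x t) (?v s)) \<le> e * norm (?v s)"
    by (intro d Rep_c2per_annulus[OF x] st)
  have 2: "e * norm (?v s) \<le> e * norm v" using norm_le_c2per(1)[OF st(1)] e by (simp add: mult_left_mono)
  have 3: "norm (repulsion_deriv q (?x t) (?v s - ?v t)) \<le> M * norm (?v s - ?v t)"
    by (intro M Rep_c2per_annulus[OF x] st)
  have 4: "M * norm (?v s - ?v t) \<le> M * (norm v * \<bar>s - t\<bar>)"
    using c2per_lipschitz[OF st(1,2), of v] M(2) by (intro mult_left_mono) auto
  have "repulsion_deriv q (?x s) (?v s) - repulsion_deriv q (?x t) (?v t) =
      (repulsion_deriv q (?x s) (?v s) - repulsion_deriv q (?x t) (?v s)) + repulsion_deriv q (?x t) (?v s - ?v t)"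
    by (simp add: linear_diff[OF linear_repulsion_deriv])
  then have "norm (repulsion_deriv q (?x s) (?v s) - repulsion_deriv q (?x t) (?v t)) \<le>
      norm (repulsion_deriv q (?x s) (?v s) - repulsion_deriv q (?x t) (?v s)) + norm (repulsion_deriv q (?x t) (?v s - ?v t))"
    by (simp only: norm_triangle_ineq)
  then show ?thesis using 1 2 3 4 by (simp add: algebra_simps)
qed

text \<open>Seen through \<open>E_op\<close>, the remainder at t is up to sign the Taylor remainder
  of \<open>repulsion\<close> at x(t), which is uniform on the annulus. The 7 of
  \<open>norm_le_E_op\<close> is the origin of \<open>e / 7\<close> here and below.\<close>

lemma has_derivative_F_op:
  assumes x: "x \<in> c2per_level k"
  shows "(F_op q has_derivative F_deriv q x) (at x)"
  unfolding has_derivative_at_alt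
proof (intro conjI allI impI)
  obtain M where M: "M > 0" "\<And>\<xi> v. \<xi> \<in> annulus k \<Longrightarrow> norm (repulsion_deriv q \<xi> v :: real ^ 'a) \<le> M * norm v"
    using repulsion_deriv_bounded[of k q] by blast
  show "bounded_linear (F_deriv q x)"
  proof (rule bounded_linear_via_E_op[OF E_op_F_deriv[OF x]])
    show "linear (\<lambda>v. D_op v t - repulsion_deriv q (Rep_c2per x t) (Rep_c2per v t))" for t
      by (intro linear_compose_sub linear_D_op
          linear_compose[OF linear_Rep_c2per linear_repulsion_deriv, unfolded o_def])
    show "norm (D_op v t - repulsion_deriv q (Rep_c2per x t) (Rep_c2per v t)) \<le> (1 + M) * norm v"
      if t: "t \<in> {0..1}" for t v
    proof -
      have "norm (repulsion_deriv q (Rep_c2per x t) (Rep_c2per v t)) \<le> M * norm v"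
        using M(2)[OF Rep_c2per_annulus[OF x t], of "Rep_c2per v t"]
          mult_left_mono[OF norm_le_c2per(1)[OF t, of v] less_imp_le[OF M(1)]] by (rule order_trans)
      then show ?thesis
        using norm_le_c2per(3)[OF t, of v]
          norm_triangle_ineq4[of "D_op v t" "repulsion_deriv q (Rep_c2per x t) (Rep_c2per v t)"]
        by (simp add: algebra_simps)
    qed
  qed
  fix e :: real assume e: "e > 0"
  obtain d where d: "d > 0" "\<And>\<xi> h. \<xi> \<in> annulus k \<Longrightarrow> norm h < d \<Longrightarrow>
      norm (repulsion q (\<xi> + h) - repulsion q \<xi> - repulsion_deriv q \<xi> h :: real ^ 'a) \<le> e / 7 * norm h"
    using repulsion_uniformly_differentiable[of "e / 7" k q] e by (metis divide_pos_pos zero_less_numeral)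
  show "\<exists>d>0. \<forall>y. norm (y - x) < d \<longrightarrow> norm (F_op q y - F_op q x - F_deriv q x (y - x)) \<le> e * norm (y - x)"
  proof (intro exI[of _ "min d (inverse (2 * real (Suc k)))"] conjI allI impI)
    show "0 < min d (inverse (2 * real (Suc k)))" using d by simp
    fix y assume y: "norm (y - x) < min d (inverse (2 * real (Suc k)))"
    have yl: "y \<in> c2per_level (2 * k + 1)" using y by (intro c2per_level_nhd[OF x]) simp
    have "norm (F_op q y - F_op q x - F_deriv q x (y - x)) \<le> 7 * (e / 7 * norm (y - x))"
    proof (rule norm_le_E_op)
      fix t :: real assume t: "t \<in> {0..1}"
      let ?h = "Rep_c2per (y - x) t" and ?\<xi> = "Rep_c2per x t"
      have h: "norm ?h \<le> norm (y - x)" by (rule norm_le_c2per[OF t])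
      have "E_op (F_op q y - F_op q x - F_deriv q x (y - x)) t =
          - (repulsion q (?\<xi> + ?h) - repulsion q ?\<xi> - repulsion_deriv q ?\<xi> ?h)"
        by (simp add: E_op_diff E_op_F_op[OF yl t] E_op_F_op[OF x t] E_op_F_deriv[OF x t]
            linear_diff[OF linear_D_op] Rep_c2per_diff)
      then have "norm (E_op (F_op q y - F_op q x - F_deriv q x (y - x)) t) =
          norm (repulsion q (?\<xi> + ?h) - repulsion q ?\<xi> - repulsion_deriv q ?\<xi> ?h)" by (simp only: norm_minus_cancel)
      also have "\<dots> \<le> e / 7 * norm ?h" using h y by (intro d Rep_c2per_annulus[OF x t]) simp
      also have "\<dots> \<le> e / 7 * norm (y - x)" using h e by (intro mult_left_mono) auto
      finally show "norm (E_op (F_op q y - F_op q x - F_deriv q x (y - x)) t) \<le> e / 7 * norm (y - x)" .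
    qed
    then show "norm (F_op q y - F_op q x - F_deriv q x (y - x)) \<le> e * norm (y - x)" by simp
  qed
qed

lemma continuous_F_deriv:
  fixes x :: "('n::finite) c2per"
  assumes x: "x \<in> c2per_level k" and e: "e > 0"
  shows "\<exists>d>0. \<forall>x'\<in>ball x d. \<forall>v. norm (F_deriv q x' v - F_deriv q x v) \<le> e * norm v"
proof -
  obtain d where d: "d > 0" "\<And>\<xi> \<eta> v. \<xi> \<in> annulus (2 * k + 1) \<Longrightarrow> \<eta> \<in> annulus (2 * k + 1) \<Longrightarrow>
      norm (\<xi> - \<eta>) < d \<Longrightarrow> norm (repulsion_deriv q \<xi> v - repulsion_deriv q \<eta> v :: real ^ 'n) \<le> e / 7 * norm v"
    using repulsion_deriv_uniformly_continuous[of "e / 7" "2 * k + 1" q] e by (metis divide_pos_pos zero_less_numeral)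
  show ?thesis
  proof (intro exI[of _ "min d (inverse (2 * real (Suc k)))"] conjI ballI allI)
    show "0 < min d (inverse (2 * real (Suc k)))" using d by simp
    fix y v assume "y \<in> ball x (min d (inverse (2 * real (Suc k))))"
    then have y: "norm (y - x) < min d (inverse (2 * real (Suc k)))" by (simp add: dist_norm norm_minus_commute)
    have yl: "y \<in> c2per_level (2 * k + 1)" using y by (intro c2per_level_nhd[OF x]) simp
    have xl: "x \<in> c2per_level (2 * k + 1)" by (intro c2per_level_nhd[OF x]) simp
    have "norm (F_deriv q y v - F_deriv q x v) \<le> 7 * (e / 7 * norm v)"
    proof (rule norm_le_E_op)
      fix t :: real assume t: "t \<in> {0..1}"
      have h: "norm (Rep_c2per y t - Rep_c2per x t) \<le> norm (y - x)"
        using norm_le_c2per(1)[OF t, of "y - x"] by (simp add: Rep_c2per_diff)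
      have "norm (E_op (F_deriv q y v - F_deriv q x v) t) =
          norm (repulsion_deriv q (Rep_c2per y t) (Rep_c2per v t) - repulsion_deriv q (Rep_c2per x t) (Rep_c2per v t))"
        by (simp add: E_op_diff E_op_F_deriv[OF yl t] E_op_F_deriv[OF x t] norm_minus_commute)
      also have "\<dots> \<le> e / 7 * norm (Rep_c2per v t)"
        using h y by (intro d Rep_c2per_annulus[OF xl t] Rep_c2per_annulus[OF yl t]) simp
      also have "\<dots> \<le> e / 7 * norm v" using norm_le_c2per(1)[OF t, of v] e by (intro mult_left_mono) auto
      finally show "norm (E_op (F_deriv q y v - F_deriv q x v) t) \<le> e / 7 * norm v" .
    qed
    then show "norm (F_deriv q y v - F_deriv q x v) \<le> e * norm v" by simp
  qed
qed

text \<open>The second derivative cancels in \<open>x - F_op q x\<close>: its image under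
  \<open>E_op\<close> is N x minus the mean of x, which is bounded and equicontinuous on a
  level.\<close>

lemma compact_F_op:
  fixes X :: "nat \<Rightarrow> ('n::finite) c2per"
  assumes X: "\<And>j. X j \<in> c2per_level k"
  shows "\<exists>l r. strict_mono (r :: nat \<Rightarrow> nat) \<and> (\<lambda>j. X (r j) - F_op q (X (r j))) \<longlonglongrightarrow> l"
proof -
  obtain M where M: "\<And>\<xi>. \<xi> \<in> annulus k \<Longrightarrow> norm (repulsion q \<xi> :: real ^ 'n) \<le> M"
    using repulsion_bounded[of k q] by blast
  have E: "E_op (X j - F_op q (X j)) t = repulsion q (Rep_c2per (X j) t) - mean (Rep_c2per (X j))"
    if "t \<in> {0..1}" for j t
    by (simp add: E_op_diff E_op_F_op[OF X that]) (simp add: E_op_def)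
  show ?thesis
  proof (rule seq_compact_c2per[of "\<lambda>j. X j - F_op q (X j)" "M + real (Suc k)"])
    fix j and t :: real assume t: "t \<in> {0..1}"
    have "norm (mean (Rep_c2per (X j))) \<le> real (Suc k)"
      using norm_mean_le[OF c2per_continuous(1) norm_le_c2per(1), of "X j"] X[of j]
      by (simp add: c2per_level_def)
    then show "norm (E_op (X j - F_op q (X j)) t) \<le> M + real (Suc k)"
      using M[OF Rep_c2per_annulus[OF X t], of j] norm_triangle_ineq4[of "repulsion q (Rep_c2per (X j) t)" "mean (Rep_c2per (X j))"]
      by (simp add: E[OF t])
  next
    fix e :: real assume "e > 0"
    then obtain d where d: "d > 0" "\<And>\<xi> \<eta>. \<xi> \<in> annulus k \<Longrightarrow> \<eta> \<in> annulus k \<Longrightarrow> norm (\<xi> - \<eta>) < d \<Longrightarrow>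
        norm (repulsion q \<xi> - repulsion q \<eta> :: real ^ 'n) < e"
      using repulsion_uniformly_continuous[of e k q] by blast
    have "norm (E_op (X j - F_op q (X j)) s - E_op (X j - F_op q (X j)) t) < e"
      if st: "s \<in> {0..1}" "t \<in> {0..1}" "\<bar>s - t\<bar> < d / real (Suc k)" for j s t
    proof -
      have "norm (Rep_c2per (X j) s - Rep_c2per (X j) t) \<le> norm (X j) * \<bar>s - t\<bar>"
        by (rule c2per_lipschitz[OF st(1,2)])
      also have "\<dots> \<le> real (Suc k) * \<bar>s - t\<bar>"
        using X[of j] by (intro mult_right_mono) (auto simp: c2per_level_def)
      also have "\<dots> < d" using st(3) by (simp add: field_simps)
      finally show ?thesis
        using d(2)[OF Rep_c2per_annulus[OF X st(1)] Rep_c2per_annulus[OF X st(2)], of j j]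
        by (simp add: E[OF st(1)] E[OF st(2)])
    qed
    then show "\<exists>d>0. \<forall>j. \<forall>s\<in>{0..1}. \<forall>t\<in>{0..1}. \<bar>s - t\<bar> < d \<longrightarrow>
        norm (E_op (X j - F_op q (X j)) s - E_op (X j - F_op q (X j)) t) < e"
      using d(1) by (intro exI[of _ "d / real (Suc k)"]) auto
  qed
qed

lemma compact_F_deriv:
  fixes X :: "nat \<Rightarrow> ('n::finite) c2per"
  assumes X: "\<And>j. X j \<in> c2per_level k" and V: "\<And>j. norm (V j) \<le> 1"
  shows "\<exists>l r. strict_mono (r :: nat \<Rightarrow> nat) \<and> (\<lambda>j. V (r j) - F_deriv q (X (r j)) (V (r j))) \<longlonglongrightarrow> l"
proof -
  obtain M where M: "M > 0" "\<And>\<xi> v. \<xi> \<in> annulus k \<Longrightarrow> norm (repulsion_deriv q \<xi> v :: real ^ 'n) \<le> M * norm v"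
    using repulsion_deriv_bounded[of k q] by blast
  have E: "E_op (V j - F_deriv q (X j) (V j)) t =
      repulsion_deriv q (Rep_c2per (X j) t) (Rep_c2per (V j) t) - mean (Rep_c2per (V j))"
    if "t \<in> {0..1}" for j t
    by (simp add: E_op_diff E_op_F_deriv[OF X that]) (simp add: E_op_def)
  show ?thesis
  proof (rule seq_compact_c2per[of "\<lambda>j. V j - F_deriv q (X j) (V j)" "M + 1"])
    fix j and t :: real assume t: "t \<in> {0..1}"
    have "norm (mean (Rep_c2per (V j))) \<le> 1"
      using norm_mean_le[OF c2per_continuous(1) norm_le_c2per(1), of "V j"] V[of j] by simp
    moreover have "norm (Rep_c2per (V j) t) \<le> 1" using norm_le_c2per(1)[OF t, of "V j"] V[of j] by simp
    then have "norm (repulsion_deriv q (Rep_c2per (X j) t) (Rep_c2per (V j) t)) \<le> M * 1"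
      using M(2)[OF Rep_c2per_annulus[OF X t], of j "Rep_c2per (V j) t"] M(1)
      by (meson less_imp_le mult_left_mono order_trans)
    ultimately show "norm (E_op (V j - F_deriv q (X j) (V j)) t) \<le> M + 1"
      using norm_triangle_ineq4[of "repulsion_deriv q (Rep_c2per (X j) t) (Rep_c2per (V j) t)" "mean (Rep_c2per (V j))"]
      by (simp add: E[OF t])
  next
    fix e :: real assume e: "e > 0"
    then obtain d where d: "d > 0" "\<And>\<xi> \<eta> v. \<xi> \<in> annulus k \<Longrightarrow> \<eta> \<in> annulus k \<Longrightarrow> norm (\<xi> - \<eta>) < d \<Longrightarrow>
        norm (repulsion_deriv q \<xi> v - repulsion_deriv q \<eta> v :: real ^ 'n) \<le> e / 3 * norm v"
      using repulsion_deriv_uniformly_continuous[of "e / 3" k q] by (metis divide_pos_pos zero_less_numeral)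
    define \<delta> where "\<delta> = min (d / real (Suc k)) (e / (3 * M))"
    have \<delta>: "\<delta> > 0" "\<delta> \<le> d / real (Suc k)" "\<delta> \<le> e / (3 * M)" using d(1) e M(1) by (auto simp: \<delta>_def)
    have "norm (E_op (V j - F_deriv q (X j) (V j)) s - E_op (V j - F_deriv q (X j) (V j)) t) < e"
      if st: "s \<in> {0..1}" "t \<in> {0..1}" "\<bar>s - t\<bar> < \<delta>" for j s t
    proof -
      have "M * \<bar>s - t\<bar> \<le> M * (e / (3 * M))" using st(3) \<delta>(3) M(1) by (intro mult_left_mono) auto
      also have "\<dots> = e / 3" using M(1) by simp
      finally have "M * \<bar>s - t\<bar> \<le> e / 3" .
      then have "(e / 3 + M * \<bar>s - t\<bar>) * norm (V j) \<le> (e / 3 + e / 3) * 1"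
        using V[of j] e by (intro mult_mono) auto
      then show ?thesis
        using norm_repulsion_deriv_c2per_diff[OF M(2,1) _ X st(1,2), where d = d and e = "e / 3" and v = "V j", of j]
          d(2) st(3) \<delta>(2) e
        by (simp add: E[OF st(1)] E[OF st(2)])
    qed
    then show "\<exists>d>0. \<forall>j. \<forall>s\<in>{0..1}. \<forall>t\<in>{0..1}. \<bar>s - t\<bar> < d \<longrightarrow>
        norm (E_op (V j - F_deriv q (X j) (V j)) s - E_op (V j - F_deriv q (X j) (V j)) t) < e"
      using \<delta>(1) by (intro exI[of _ \<delta>]) auto
  qed
qed

section \<open>Finite-rank approximation by sampling\<close>

lemma partition_of_unity_Icc:
  assumes "\<delta> > (0::real)"
  obtains T and \<psi> :: "real \<Rightarrow> real \<Rightarrow> real" where "finite T" "T \<subseteq> {0..1}"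
    "\<And>\<tau>. \<tau> \<in> T \<Longrightarrow> continuous_on {0..1} (\<psi> \<tau>)" "\<And>\<tau> t. 0 \<le> \<psi> \<tau> t"
    "\<And>t. t \<in> {0..1} \<Longrightarrow> (\<Sum>\<tau>\<in>T. \<psi> \<tau> t) = 1" "\<And>\<tau> t. \<psi> \<tau> t \<noteq> 0 \<Longrightarrow> \<bar>\<tau> - t\<bar> < \<delta>"
proof -
  obtain T where T: "T \<subseteq> {0..1::real}" "finite T" "{0..1} \<subseteq> (\<Union>\<tau>\<in>T. ball \<tau> \<delta>)"
    by (rule compactE_image[of "{0..1::real}" "{0..1}" "\<lambda>\<tau>. ball \<tau> \<delta>"])
      (use assms in \<open>auto simp del: atLeastAtMost_iff\<close>)
  define h where "h \<tau> t = max 0 (\<delta> - \<bar>\<tau> - t\<bar>)" for \<tau> t :: real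
  define s where "s t = (\<Sum>\<tau>\<in>T. h \<tau> t)" for t
  have h0: "h \<tau> t \<ge> 0" for \<tau> t by (simp add: h_def)
  have s0: "s t > 0" if t: "t \<in> {0..1}" for t
  proof -
    obtain \<tau> where "\<tau> \<in> T" "t \<in> ball \<tau> \<delta>" using T(3) t by blast
    then show ?thesis
      unfolding s_def by (intro sum_pos2[OF T(2), of \<tau>] h0) (auto simp: h_def dist_real_def)
  qed
  have hc: "continuous_on {0..1} (h \<tau>)" for \<tau>
    unfolding h_def by (intro continuous_intros)
  have sc: "continuous_on {0..1} s"
    unfolding s_def by (intro continuous_on_sum hc)
  show thesis
  proof (rule that[of T "\<lambda>\<tau> t. h \<tau> t / s t"])
    show "continuous_on {0..1} (\<lambda>t. h \<tau> t / s t)" for \<tau>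
      using s0 by (intro continuous_on_divide hc sc) fastforce
    show "0 \<le> h \<tau> t / s t" for \<tau> t
      using h0 by (simp add: s_def sum_nonneg)
    show "(\<Sum>\<tau>\<in>T. h \<tau> t / s t) = 1" if "t \<in> {0..1}" for t
      using s0[OF that] by (simp add: sum_divide_distrib[symmetric] s_def)
    show "\<bar>\<tau> - t\<bar> < \<delta>" if "h \<tau> t / s t \<noteq> 0" for \<tau> t
      using that by (auto simp: h_def max_def split: if_splits)
  qed (use T in auto)
qed

lemma norm_convex_combination_diff_le:
  fixes a :: "'i \<Rightarrow> 'b::real_normed_vector"
  assumes "\<And>i. i \<in> I \<Longrightarrow> 0 \<le> c i" "sum c I = 1" "\<And>i. i \<in> I \<Longrightarrow> c i \<noteq> 0 \<Longrightarrow> norm (a i - b) \<le> e"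
  shows "norm ((\<Sum>i\<in>I. c i *\<^sub>R a i) - b) \<le> e"
proof -
  have "(\<Sum>i\<in>I. c i *\<^sub>R a i) - b = (\<Sum>i\<in>I. c i *\<^sub>R a i) - (\<Sum>i\<in>I. c i) *\<^sub>R b"
    using assms(2) by simp
  also have "\<dots> = (\<Sum>i\<in>I. c i *\<^sub>R (a i - b))"
    by (simp add: scaleR_sum_left sum_subtractf scaleR_diff_right)
  also have "norm \<dots> \<le> (\<Sum>i\<in>I. c i * e)"
  proof (rule sum_norm_le)
    fix i assume "i \<in> I"
    then show "norm (c i *\<^sub>R (a i - b)) \<le> c i * e"
      using assms(1,3)[of i] by (cases "c i = 0") (auto intro: mult_left_mono)
  qed
  also have "\<dots> = e" using assms(2) by (simp add: sum_distrib_right[symmetric])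
  finally show ?thesis .
qed

text \<open>Before \<open>J_op\<close> is applied, N x is replaced by the interpolation of its
  values at finitely many nodes; the mean of x already has finite rank. The same recipe with N'(x) v
  gives the derivative. Interpolated values are convex combinations, so pointwise estimates at the
  nodes carry over uniformly.\<close>

lemma F_op_approx:
  fixes e :: real
  assumes e: "e > 0"
  shows "\<exists>(B :: ('n::finite) c2per set) G G'. finite B \<and>
    (\<forall>l. \<forall>x\<in>c2per_level l. G x \<in> span B \<and> (G has_derivative G' x) (at x) \<and> range (G' x) \<subseteq> span B) \<and>
    (\<forall>v. continuous_on (\<Union>l. c2per_level l) (\<lambda>x. G' x v)) \<and>
    (\<forall>x\<in>c2per_level k. norm (G x - (x - F_op q x)) \<le> e \<and>
      (\<forall>v. norm (G' x v - (v - F_deriv q x v)) \<le> e * norm v))"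
proof -
  obtain M where M: "M > 0" "\<And>\<xi> v. \<xi> \<in> annulus k \<Longrightarrow> norm (repulsion_deriv q \<xi> v :: real ^ 'n) \<le> M * norm v"
    using repulsion_deriv_bounded[of k q] by blast
  obtain d1 where d1: "d1 > 0" "\<And>\<xi> \<eta>. \<xi> \<in> annulus k \<Longrightarrow> \<eta> \<in> annulus k \<Longrightarrow> norm (\<xi> - \<eta>) < d1 \<Longrightarrow>
      norm (repulsion q \<xi> - repulsion q \<eta> :: real ^ 'n) < e / 7"
    using repulsion_uniformly_continuous[of "e / 7" k q] e by (metis divide_pos_pos zero_less_numeral)
  obtain d2 where d2: "d2 > 0" "\<And>\<xi> \<eta> v. \<xi> \<in> annulus k \<Longrightarrow> \<eta> \<in> annulus k \<Longrightarrow> norm (\<xi> - \<eta>) < d2 \<Longrightarrow>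
      norm (repulsion_deriv q \<xi> v - repulsion_deriv q \<eta> v :: real ^ 'n) \<le> e / 14 * norm v"
    using repulsion_deriv_uniformly_continuous[of "e / 14" k q] e by (metis divide_pos_pos zero_less_numeral)
  \<comment> \<open>Functions of level k are Lipschitz with constant \<open>Suc k\<close>, hence the
    division of \<open>d1\<close> and \<open>d2\<close>. The error \<open>e / 7\<close> of the
    derivative is split into \<open>e / 14\<close> from the base point and \<open>e / 14\<close>
    from the argument, the latter requiring \<open>\<delta>\<close> times \<open>M\<close> to be
    small.\<close>
  define \<delta> where "\<delta> = min (min d1 d2 / real (Suc k)) (e / 14 / M)"
  have \<delta>: "\<delta> > 0" "\<delta> \<le> d1 / real (Suc k)" "\<delta> \<le> d2 / real (Suc k)" "\<delta> \<le> e / 14 / M"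
    using d1(1) d2(1) e M(1) by (auto simp: \<delta>_def min_le_iff_disj divide_right_mono)
  obtain T and \<psi> :: "real \<Rightarrow> real \<Rightarrow> real" where T: "finite T" "T \<subseteq> {0..1}"
    "\<And>\<tau>. \<tau> \<in> T \<Longrightarrow> continuous_on {0..1} (\<psi> \<tau>)" "\<And>\<tau> t. 0 \<le> \<psi> \<tau> t"
    "\<And>t. t \<in> {0..1} \<Longrightarrow> (\<Sum>\<tau>\<in>T. \<psi> \<tau> t) = 1" "\<And>\<tau> t. \<psi> \<tau> t \<noteq> 0 \<Longrightarrow> \<bar>\<tau> - t\<bar> < \<delta>"
    using partition_of_unity_Icc[OF \<delta>(1)] by metis
  define S where "S a c = J_op (\<lambda>t. (\<Sum>\<tau>\<in>T. \<psi> \<tau> t *\<^sub>R a \<tau>) - c)" for a :: "real \<Rightarrow> real ^ 'n" and c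
  have E: "E_op (S a c) t = (\<Sum>\<tau>\<in>T. \<psi> \<tau> t *\<^sub>R a \<tau>) - c" if "t \<in> {0..1}" for a c t
    unfolding S_def by (rule E_op_J_op[OF _ that]) (intro continuous_intros T(3))
  define B :: "'n c2per set" where
    "B = (\<lambda>(\<tau>, b). J_op (\<lambda>t. \<psi> \<tau> t *\<^sub>R b)) ` (T \<times> Basis) \<union> (\<lambda>b. J_op (\<lambda>t. b)) ` Basis"
  have finB: "finite B" using T(1) by (simp add: B_def)
  have SB: "S a c \<in> span B" for a c
  proof -
    have "S a c = (\<Sum>\<tau>\<in>T. \<Sum>b\<in>Basis. (a \<tau> \<bullet> b) *\<^sub>R J_op (\<lambda>t. \<psi> \<tau> t *\<^sub>R b)) -
        (\<Sum>b\<in>Basis. (c \<bullet> b) *\<^sub>R J_op (\<lambda>t. b))" (is "_ = ?R")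
    proof (rule E_op_eqD)
      fix t :: real assume t: "t \<in> {0..1}"
      have "E_op ?R t = (\<Sum>\<tau>\<in>T. \<Sum>b\<in>Basis. (a \<tau> \<bullet> b) *\<^sub>R \<psi> \<tau> t *\<^sub>R b) - (\<Sum>b\<in>Basis. (c \<bullet> b) *\<^sub>R b)"
        using t T(3) by (simp add: E_op_diff E_op_sum E_op_scaleR E_op_J_op continuous_intros
            del: euclidean_representation cong: sum.cong)
      also have "(\<Sum>\<tau>\<in>T. \<Sum>b\<in>Basis. (a \<tau> \<bullet> b) *\<^sub>R \<psi> \<tau> t *\<^sub>R b) = (\<Sum>\<tau>\<in>T. \<psi> \<tau> t *\<^sub>R (\<Sum>b\<in>Basis. (a \<tau> \<bullet> b) *\<^sub>R b))"
        by (simp add: scaleR_sum_right mult.commute del: euclidean_representation)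
      finally show "E_op (S a c) t = E_op ?R t" by (simp add: E[OF t] euclidean_representation)
    qed
    also have "\<dots> \<in> span B"
      by (intro span_diff span_sum span_scale span_base) (auto simp: B_def)
    finally show ?thesis .
  qed
  define G where "G x = S (\<lambda>\<tau>. repulsion q (Rep_c2per x \<tau>)) (mean (Rep_c2per x))" for x
  define G' where "G' x v = S (\<lambda>\<tau>. repulsion_deriv q (Rep_c2per x \<tau>) (Rep_c2per v \<tau>)) (mean (Rep_c2per v))" for x v
  have comb: "norm (\<Sum>\<tau>\<in>T. \<psi> \<tau> t *\<^sub>R a \<tau>) \<le> s"
    if "t \<in> {0..1}" "\<And>\<tau>. \<tau> \<in> {0..1} \<Longrightarrow> norm (a \<tau>) \<le> s" for t s and a :: "real \<Rightarrow> real ^ 'n"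
    using norm_convex_combination_diff_le[of T "\<lambda>\<tau>. \<psi> \<tau> t" a 0 s, OF T(4) T(5)[OF that(1)]]
      that(2) subsetD[OF T(2)] by simp
  have blG': "bounded_linear (G' x)" if x: "x \<in> c2per_level l" for x l
  proof -
    obtain M where M: "M > 0" "\<And>\<xi> v. \<xi> \<in> annulus l \<Longrightarrow> norm (repulsion_deriv q \<xi> v :: real ^ 'n) \<le> M * norm v"
      using repulsion_deriv_bounded[of l q] by blast
    show ?thesis
    proof (rule bounded_linear_via_E_op)
      show "E_op (G' x v) t = (\<Sum>\<tau>\<in>T. \<psi> \<tau> t *\<^sub>R repulsion_deriv q (Rep_c2per x \<tau>) (Rep_c2per v \<tau>)) - mean (Rep_c2per v)"
        if "t \<in> {0..1}" for v t
        unfolding G'_def by (rule E[OF that])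
      show "linear (\<lambda>v. (\<Sum>\<tau>\<in>T. \<psi> \<tau> t *\<^sub>R repulsion_deriv q (Rep_c2per x \<tau>) (Rep_c2per v \<tau>)) - mean (Rep_c2per v))" for t
        by (intro linear_compose_sub linear_mean_c2per linear_compose_sum ballI linear_compose_scale_right
            linear_compose[OF linear_Rep_c2per linear_repulsion_deriv, unfolded o_def])
      show "norm ((\<Sum>\<tau>\<in>T. \<psi> \<tau> t *\<^sub>R repulsion_deriv q (Rep_c2per x \<tau>) (Rep_c2per v \<tau>)) - mean (Rep_c2per v))
          \<le> (M + 1) * norm v" if t: "t \<in> {0..1}" for t v
      proof -
        have "norm (\<Sum>\<tau>\<in>T. \<psi> \<tau> t *\<^sub>R repulsion_deriv q (Rep_c2per x \<tau>) (Rep_c2per v \<tau>)) \<le> M * norm v"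
        proof (rule comb[OF t])
          fix \<tau> :: real assume \<tau>: "\<tau> \<in> {0..1}"
          show "norm (repulsion_deriv q (Rep_c2per x \<tau>) (Rep_c2per v \<tau>)) \<le> M * norm v"
            using M(2)[OF Rep_c2per_annulus[OF x \<tau>], of "Rep_c2per v \<tau>"]
              mult_left_mono[OF norm_le_c2per(1)[OF \<tau>, of v] less_imp_le[OF M(1)]] by (rule order_trans)
        qed
        moreover have "norm (mean (Rep_c2per v)) \<le> norm v"
          using norm_mean_le[OF c2per_continuous(1) norm_le_c2per(1)] by blast
        ultimately show ?thesis
          using norm_triangle_ineq4[of "\<Sum>\<tau>\<in>T. \<psi> \<tau> t *\<^sub>R repulsion_deriv q (Rep_c2per x \<tau>) (Rep_c2per v \<tau>)"
              "mean (Rep_c2per v)"]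
          by (simp add: algebra_simps)
      qed
    qed
  qed
  have derG: "(G has_derivative G' x) (at x)" if x: "x \<in> c2per_level l" for x l
    unfolding has_derivative_at_alt
  proof (intro conjI allI impI blG'[OF x])
    fix e :: real assume e: "e > 0"
    obtain d where d: "d > 0" "\<And>\<xi> h. \<xi> \<in> annulus l \<Longrightarrow> norm h < d \<Longrightarrow>
        norm (repulsion q (\<xi> + h) - repulsion q \<xi> - repulsion_deriv q \<xi> h :: real ^ 'n) \<le> e / 7 * norm h"
      using repulsion_uniformly_differentiable[of "e / 7" l q] e by (metis divide_pos_pos zero_less_numeral)
    have "norm (G y - G x - G' x (y - x)) \<le> e * norm (y - x)" if y: "norm (y - x) < d" for y :: "'n c2per"
    proof -
      have "norm (G y - G x - G' x (y - x)) \<le> 7 * (e / 7 * norm (y - x))"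
      proof (rule norm_le_E_op)
        fix t :: real assume t: "t \<in> {0..1}"
        let ?x = "Rep_c2per x" and ?h = "Rep_c2per (y - x)"
        have "E_op (G y - G x - G' x (y - x)) t =
            (\<Sum>\<tau>\<in>T. \<psi> \<tau> t *\<^sub>R (repulsion q (?x \<tau> + ?h \<tau>) - repulsion q (?x \<tau>) - repulsion_deriv q (?x \<tau>) (?h \<tau>)))"
          by (simp add: E_op_diff G_def G'_def E[OF t] mean_c2per_diff Rep_c2per_diff
              scaleR_diff_right sum_subtractf)
        also have "norm \<dots> \<le> e / 7 * norm (y - x)"
        proof (rule comb[OF t])
          fix \<tau> :: real assume \<tau>: "\<tau> \<in> {0..1}"
          have h: "norm (?h \<tau>) \<le> norm (y - x)" by (rule norm_le_c2per[OF \<tau>])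
          then have "norm (repulsion q (?x \<tau> + ?h \<tau>) - repulsion q (?x \<tau>) - repulsion_deriv q (?x \<tau>) (?h \<tau>)) \<le> e / 7 * norm (?h \<tau>)"
            using y by (intro d Rep_c2per_annulus[OF x \<tau>]) simp
          also have "\<dots> \<le> e / 7 * norm (y - x)" using h e by (intro mult_left_mono) auto
          finally show "norm (repulsion q (?x \<tau> + ?h \<tau>) - repulsion q (?x \<tau>) - repulsion_deriv q (?x \<tau>) (?h \<tau>))
            \<le> e / 7 * norm (y - x)" .
        qed
        finally show "norm (E_op (G y - G x - G' x (y - x)) t) \<le> e / 7 * norm (y - x)" .
      qed
      then show ?thesis by simp
    qed
    then show "\<exists>d>0. \<forall>y. norm (y - x) < d \<longrightarrow> norm (G y - G x - G' x (y - x)) \<le> e * norm (y - x)"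
      using d(1) by blast
  qed
  have contG': "continuous_on (\<Union>l. c2per_level l) (\<lambda>x. G' x v)" for v
    unfolding continuous_on_iff
  proof (intro ballI allI impI)
    fix x :: "'n c2per" and e :: real assume "x \<in> (\<Union>l. c2per_level l)" and e: "e > 0"
    then obtain l where x: "x \<in> c2per_level l" by blast
    \<comment> \<open>The added 1 avoids dividing by 0, and 8 exceeds the factor 7 of
      \<open>norm_le_E_op\<close>.\<close>
    define e' where "e' = e / (8 * (norm v + 1))"
    have e': "e' > 0" using e by (simp add: e'_def add_nonneg_pos)
    obtain d where d: "d > 0" "\<And>\<xi> \<eta> v. \<xi> \<in> annulus (2 * l + 1) \<Longrightarrow> \<eta> \<in> annulus (2 * l + 1) \<Longrightarrow>
        norm (\<xi> - \<eta>) < d \<Longrightarrow> norm (repulsion_deriv q \<xi> v - repulsion_deriv q \<eta> v :: real ^ 'n) \<le> e' * norm v"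
      using repulsion_deriv_uniformly_continuous[OF e', of "2 * l + 1" q] by metis
    have "dist (G' y v) (G' x v) < e" if y: "dist y x < min d (inverse (2 * real (Suc l)))" for y :: "'n c2per"
    proof -
      have yl: "y \<in> c2per_level (2 * l + 1)" using y by (intro c2per_level_nhd[OF x]) (simp add: dist_norm)
      have xl: "x \<in> c2per_level (2 * l + 1)" by (intro c2per_level_nhd[OF x]) simp
      have "norm (G' y v - G' x v) \<le> 7 * (e' * norm v)"
      proof (rule norm_le_E_op)
        fix t :: real assume t: "t \<in> {0..1}"
        have "E_op (G' y v - G' x v) t =
            (\<Sum>\<tau>\<in>T. \<psi> \<tau> t *\<^sub>R (repulsion_deriv q (Rep_c2per y \<tau>) (Rep_c2per v \<tau>) - repulsion_deriv q (Rep_c2per x \<tau>) (Rep_c2per v \<tau>)))"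
          by (simp add: E_op_diff G'_def E[OF t] scaleR_diff_right sum_subtractf)
        also have "norm \<dots> \<le> e' * norm v"
        proof (rule comb[OF t])
          fix \<tau> :: real assume \<tau>: "\<tau> \<in> {0..1}"
          have "norm (Rep_c2per y \<tau> - Rep_c2per x \<tau>) \<le> norm (y - x)"
            using norm_le_c2per(1)[OF \<tau>, of "y - x"] by (simp add: Rep_c2per_diff)
          then have "norm (repulsion_deriv q (Rep_c2per y \<tau>) (Rep_c2per v \<tau>) - repulsion_deriv q (Rep_c2per x \<tau>) (Rep_c2per v \<tau>))
              \<le> e' * norm (Rep_c2per v \<tau>)"
            using y by (intro d Rep_c2per_annulus[OF xl \<tau>] Rep_c2per_annulus[OF yl \<tau>]) (simp add: dist_norm)
          also have "\<dots> \<le> e' * norm v" using norm_le_c2per(1)[OF \<tau>, of v] e' by (intro mult_left_mono) auto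
          finally show "norm (repulsion_deriv q (Rep_c2per y \<tau>) (Rep_c2per v \<tau>) - repulsion_deriv q (Rep_c2per x \<tau>) (Rep_c2per v \<tau>))
              \<le> e' * norm v" .
        qed
        finally show "norm (E_op (G' y v - G' x v) t) \<le> e' * norm v" .
      qed
      also have "\<dots> < 8 * (e' * (norm v + 1))"
        using e' by (simp add: distrib_left add_nonneg_pos)
      also have "\<dots> = e" using norm_ge_zero[of v] by (simp add: e'_def field_simps add_nonneg_eq_0_iff)
      finally show ?thesis by (simp add: dist_norm)
    qed
    then show "\<exists>d>0. \<forall>x'\<in>\<Union>l. c2per_level l. dist x' x < d \<longrightarrow> dist (G' x' v) (G' x v) < e"
      using d(1) by (intro exI[of _ "min d (inverse (2 * real (Suc l)))"]) auto
  qed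
  have near: "norm (G x - (x - F_op q x)) \<le> e" if x: "x \<in> c2per_level k" for x
  proof -
    have "norm (G x - (x - F_op q x)) \<le> 7 * (e / 7)"
    proof (rule norm_le_E_op)
      fix t :: real assume t: "t \<in> {0..1}"
      have "E_op (G x - (x - F_op q x)) t =
          (\<Sum>\<tau>\<in>T. \<psi> \<tau> t *\<^sub>R repulsion q (Rep_c2per x \<tau>)) - repulsion q (Rep_c2per x t)"
        by (simp add: E_op_diff G_def E[OF t] E_op_F_op[OF x t]) (simp add: E_op_def)
      also have "norm \<dots> \<le> e / 7"
      proof (rule norm_convex_combination_diff_le[OF T(4) T(5)[OF t]])
        fix \<tau> assume \<tau>: "\<tau> \<in> T" "\<psi> \<tau> t \<noteq> 0"
        then have \<tau>1: "\<tau> \<in> {0..1}" using T(2) by blast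
        have "norm (Rep_c2per x \<tau> - Rep_c2per x t) \<le> norm x * \<bar>\<tau> - t\<bar>" by (rule c2per_lipschitz[OF \<tau>1 t])
        also have "\<dots> \<le> real (Suc k) * \<bar>\<tau> - t\<bar>" using x by (intro mult_right_mono) (auto simp: c2per_level_def)
        also have "\<dots> < real (Suc k) * (d1 / real (Suc k))" using T(6)[OF \<tau>(2)] \<delta>(2) by (intro mult_strict_left_mono) auto
        finally have "norm (Rep_c2per x \<tau> - Rep_c2per x t) < d1" by simp
        then show "norm (repulsion q (Rep_c2per x \<tau>) - repulsion q (Rep_c2per x t)) \<le> e / 7"
          by (intro less_imp_le d1 Rep_c2per_annulus[OF x] \<tau>1 t)
      qed
      finally show "norm (E_op (G x - (x - F_op q x)) t) \<le> e / 7" .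
    qed
    then show ?thesis by simp
  qed
  have near': "norm (G' x v - (v - F_deriv q x v)) \<le> e * norm v" if x: "x \<in> c2per_level k" for x v
  proof -
    have "norm (G' x v - (v - F_deriv q x v)) \<le> 7 * (e / 7 * norm v)"
    proof (rule norm_le_E_op)
      fix t :: real assume t: "t \<in> {0..1}"
      have "E_op (G' x v - (v - F_deriv q x v)) t =
          (\<Sum>\<tau>\<in>T. \<psi> \<tau> t *\<^sub>R repulsion_deriv q (Rep_c2per x \<tau>) (Rep_c2per v \<tau>)) - repulsion_deriv q (Rep_c2per x t) (Rep_c2per v t)"
        by (simp add: E_op_diff G'_def E[OF t] E_op_F_deriv[OF x t]) (simp add: E_op_def)
      also have "norm \<dots> \<le> e / 7 * norm v"
      proof (rule norm_convex_combination_diff_le[OF T(4) T(5)[OF t]])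
        fix \<tau> assume \<tau>: "\<tau> \<in> T" "\<psi> \<tau> t \<noteq> 0"
        then have \<tau>1: "\<tau> \<in> {0..1}" using T(2) by blast
        have "norm (repulsion_deriv q (Rep_c2per x \<tau>) (Rep_c2per v \<tau>) - repulsion_deriv q (Rep_c2per x t) (Rep_c2per v t))
            \<le> (e / 14 + M * \<bar>\<tau> - t\<bar>) * norm v"
          using T(6)[OF \<tau>(2)] \<delta>(3) e by (intro norm_repulsion_deriv_c2per_diff[OF M(2,1) d2(2) x \<tau>1 t]) auto
        also have "\<dots> \<le> (e / 14 + e / 14) * norm v"
        proof (intro mult_right_mono add_left_mono norm_ge_zero)
          have "M * \<bar>\<tau> - t\<bar> \<le> M * (e / 14 / M)" using T(6)[OF \<tau>(2)] \<delta>(4) M(1) by (intro mult_left_mono) auto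
          then show "M * \<bar>\<tau> - t\<bar> \<le> e / 14" using M(1) by simp
        qed
        finally show "norm (repulsion_deriv q (Rep_c2per x \<tau>) (Rep_c2per v \<tau>) - repulsion_deriv q (Rep_c2per x t) (Rep_c2per v t))
          \<le> e / 7 * norm v" by simp
      qed
      finally show "norm (E_op (G' x v - (v - F_deriv q x v)) t) \<le> e / 7 * norm v" .
    qed
    then show ?thesis by simp
  qed
  show ?thesis
    using finB SB derG contG' near near' unfolding G_def[symmetric] G'_def[symmetric]
    by (intro exI[of _ B] exI[of _ G] exI[of _ G']) (auto simp: G_def G'_def)
qed

lemma approximable_C1_map_F_op:
  "approximable_C1_map (F_op q) (F_deriv q) (c2per_level :: nat \<Rightarrow> ('n::finite) c2per set)"
proof
  show "\<exists>r>0. \<exists>l. cball x r \<subseteq> c2per_level l" if "x \<in> c2per_level k" for x :: "'n c2per" and k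
    using c2per_level_nhd[OF that]
    by (intro exI[of _ "inverse (2 * real (Suc k))"] conjI exI[of _ "2 * k + 1"] subsetI)
      (auto simp: dist_norm norm_minus_commute)
qed (fact closed_c2per_level has_derivative_F_op continuous_F_deriv compact_F_op compact_F_deriv F_op_approx)+

section \<open>Transversality and the main result\<close>

text \<open>A basis of \<open>K\<close> padded by zeros: the index type is the same for all kernels,
  whatever their dimension.\<close>

lemma finite_dim_spanning_family:
  fixes \<iota> :: "'a::real_vector \<Rightarrow> 'b::euclidean_space"
  assumes K: "subspace K" and \<iota>: "linear \<iota>" and inj: "\<And>v. v \<in> K \<Longrightarrow> \<iota> v = 0 \<Longrightarrow> v = 0"
    and card: "DIM('b) \<le> CARD('k::finite)"
  shows "\<exists>e :: 'k \<Rightarrow> 'a. range e \<subseteq> K \<and> K \<subseteq> span (range e)"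
proof -
  obtain B where B: "B \<subseteq> K" "independent B" "K \<subseteq> span B"
    using maximal_independent_subset[of K] by blast
  have sp: "span B = K"
    using B(3) span_minimal[OF B(1) K] by (rule equalityI[rotated])
  have inj_on: "inj_on \<iota> (span B)"
    unfolding sp linear_inj_on_iff_eq_0[OF \<iota> K] using inj by blast
  have "independent (\<iota> ` B)"
    by (rule linear_independent_injective_image[OF \<iota> B(2) inj_on])
  then have fc: "finite (\<iota> ` B)" "card (\<iota> ` B) \<le> DIM('b)"
    using independent_bound by blast+
  have injB: "inj_on \<iota> B" by (rule inj_on_subset[OF inj_on span_superset])
  have "finite B" using fc(1) injB by (rule finite_imageD)
  moreover have "card B \<le> card (UNIV :: 'k set)" using fc(2) card card_image[OF injB] by simp
  ultimately obtain f :: "'a \<Rightarrow> 'k" where f: "inj_on f B"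
    using card_le_inj[of B "UNIV :: 'k set"] by auto
  define e where "e i = (if i \<in> f ` B then inv_into B f i else 0)" for i
  have "e (f b) = b" if "b \<in> B" for b using that f by (simp add: e_def)
  then have "B \<subseteq> range e" by (metis rangeI subsetI)
  then have "K \<subseteq> span (range e)" using B(3) span_mono by blast
  moreover have "range e \<subseteq> K"
    using B(1) subspace_0[OF K] inv_into_into[of _ f B] by (auto simp: e_def)
  ultimately show ?thesis by blast
qed

section \<open>The L2 pairing and the linearised equation\<close>

definition ip_I :: "(real \<Rightarrow> real ^ 'n) \<Rightarrow> (real \<Rightarrow> real ^ 'n) \<Rightarrow> real" where
  "ip_I f g = integral {0..1} (\<lambda>t. f t \<bullet> g t)"

lemma ip_I_cong:
  "(\<And>t. t \<in> {0..1} \<Longrightarrow> f t \<bullet> g t = f' t \<bullet> g' t) \<Longrightarrow> ip_I f g = ip_I f' g'"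
  unfolding ip_I_def by (rule integral_cong) auto

lemma ip_I_add:
  assumes "continuous_on {0..1} f" "continuous_on {0..1} g" "continuous_on {0..1} h"
  shows "ip_I (\<lambda>t. f t + g t) h = ip_I f h + ip_I g h"
  unfolding ip_I_def inner_add_left
  by (intro integral_add integrable_continuous_real continuous_intros assms)

lemma ip_I_diff:
  assumes "continuous_on {0..1} f" "continuous_on {0..1} g" "continuous_on {0..1} h"
  shows "ip_I (\<lambda>t. f t - g t) h = ip_I f h - ip_I g h"
  unfolding ip_I_def inner_diff_left
  by (intro integral_diff integrable_continuous_real continuous_intros assms)

lemma ip_I_commute: "ip_I f g = ip_I g f"
  by (simp add: ip_I_def inner_commute)

lemma ip_I_self_eq_0:
  assumes "continuous_on {0..1} f" "ip_I f f = 0" "t \<in> {0..1}"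
  shows "f t = 0"
proof -
  have "continuous_on {0..1} (\<lambda>t. f t \<bullet> f t)" by (intro continuous_intros assms(1))
  from integral_eq_0_iff[OF this] assms(2,3) show ?thesis by (simp add: ip_I_def del: atLeastAtMost_iff)
qed

lemma ip_I_const: "continuous_on {0..1} f \<Longrightarrow> ip_I f (\<lambda>_. c) = mean f \<bullet> c"
  using integral_linear[OF integrable_continuous_real bounded_linear_inner_left, of 0 1 f c]
  by (simp add: ip_I_def mean_def o_def)

lemma bounded_linear_ip_I: "bounded_linear (\<lambda>v. ip_I (Rep_c2per v) (Rep_c2per u))"
proof (rule bounded_linear_intro)
  show "ip_I (Rep_c2per (v + w)) (Rep_c2per u) = ip_I (Rep_c2per v) (Rep_c2per u) + ip_I (Rep_c2per w) (Rep_c2per u)"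
    for v w
    using ip_I_add[OF c2per_continuous(1) c2per_continuous(1) c2per_continuous(1), of v w u]
    by (simp add: Rep_c2per_add[abs_def])
  show "ip_I (Rep_c2per (c *\<^sub>R v)) (Rep_c2per u) = c *\<^sub>R ip_I (Rep_c2per v) (Rep_c2per u)" for c v
    by (simp add: ip_I_def scaleR_c2per.rep_eq)
  show "norm (ip_I (Rep_c2per v) (Rep_c2per u)) \<le> norm v * norm u" for v
  proof -
    have "norm (ip_I (Rep_c2per v) (Rep_c2per u)) \<le> norm v * norm u * (1 - 0)"
      unfolding ip_I_def
    proof (rule integral_bound)
      show "continuous_on {0..1} (\<lambda>t. Rep_c2per v t \<bullet> Rep_c2per u t)"
        by (intro continuous_intros c2per_continuous)
      show "norm (Rep_c2per v t \<bullet> Rep_c2per u t) \<le> norm v * norm u" if t: "t \<in> {0..1}" for t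
        using Cauchy_Schwarz_ineq2[of "Rep_c2per v t" "Rep_c2per u t"]
          mult_mono[OF norm_le_c2per(1)[OF t, of v] norm_le_c2per(1)[OF t, of u]] by simp
    qed simp
    then show ?thesis by simp
  qed
qed

text \<open>The Wronskian \<open>?W\<close> is a primitive of the difference of the integrands, and
  its boundary values agree by periodicity.\<close>

lemma ip_I_D_op_symmetric: "ip_I (D_op v) (Rep_c2per u) = ip_I (Rep_c2per v) (D_op u)"
proof -
  let ?v = "Rep_c2per v" and ?u = "Rep_c2per u"
  let ?W = "\<lambda>t. deriv_I ?v t \<bullet> ?u t - ?v t \<bullet> deriv_I ?u t"
  have "((\<lambda>t. D_op v t \<bullet> ?u t - ?v t \<bullet> D_op u t) has_integral (?W 1 - ?W 0)) {0..1}"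
  proof (rule fundamental_theorem_of_calculus)
    fix t :: real assume t: "t \<in> {0..1}"
    note bb = bounded_bilinear.has_vector_derivative[OF bounded_bilinear_inner]
    have "(?W has_vector_derivative (deriv_I ?v t \<bullet> deriv_I ?u t + D_op v t \<bullet> ?u t) -
        (?v t \<bullet> D_op u t + deriv_I ?v t \<bullet> deriv_I ?u t)) (at t within {0..1})"
      by (intro has_vector_derivative_diff bb c2per_deriv t)
    then show "(?W has_vector_derivative D_op v t \<bullet> ?u t - ?v t \<bullet> D_op u t) (at t within {0..1})"
      by (simp add: algebra_simps)
  qed simp
  then have "integral {0..1} (\<lambda>t. D_op v t \<bullet> ?u t - ?v t \<bullet> D_op u t) = 0"
    using c2per_periodic[of u] c2per_periodic[of v] by (simp add: integral_unique)
  moreover have "integral {0..1} (\<lambda>t. D_op v t \<bullet> ?u t - ?v t \<bullet> D_op u t) =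
      ip_I (D_op v) ?u - ip_I ?v (D_op u)"
    unfolding ip_I_def by (intro integral_diff integrable_continuous_real continuous_intros c2per_continuous)
  ultimately show ?thesis by simp
qed

text \<open>Gronwall for the energy \<omega> = |v|^2 + |v'|^2: its derivative is at most
  \<open>(1 + M) * \<omega>\<close>, so the energy with an exponential weight cannot rise from its
  initial value 0.\<close>

lemma linear_ode_unique:
  fixes v :: "('n::finite) c2per"
  assumes M: "\<And>t. t \<in> {0..1} \<Longrightarrow> norm (D_op v t) \<le> M * norm (Rep_c2per v t)" and "M \<ge> 0"
    and 0: "Rep_c2per v 0 = 0" "deriv_I (Rep_c2per v) 0 = 0"
  shows "v = 0"
proof -
  let ?v = "Rep_c2per v"
  define \<omega> where "\<omega> t = ?v t \<bullet> ?v t + deriv_I ?v t \<bullet> deriv_I ?v t" for t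
  define \<omega>' where "\<omega>' t = 2 * (?v t \<bullet> deriv_I ?v t) + 2 * (deriv_I ?v t \<bullet> D_op v t)" for t
  note bb = bounded_bilinear.has_vector_derivative[OF bounded_bilinear_inner]
  have d\<omega>: "(\<omega> has_vector_derivative \<omega>' t) (at t within {0..1})" if t: "t \<in> {0..1}" for t
  proof -
    have "(\<omega> has_vector_derivative (?v t \<bullet> deriv_I ?v t + deriv_I ?v t \<bullet> ?v t) +
        (deriv_I ?v t \<bullet> D_op v t + D_op v t \<bullet> deriv_I ?v t)) (at t within {0..1})"
      unfolding \<omega>_def by (intro has_vector_derivative_add bb c2per_deriv t)
    then show ?thesis by (simp add: \<omega>'_def inner_commute)
  qed
  have \<omega>'_le: "\<omega>' t \<le> (1 + M) * \<omega> t" if t: "t \<in> {0..1}" for t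
  proof -
    let ?a = "norm (?v t)" and ?b = "norm (deriv_I ?v t)"
    have "?v t \<bullet> deriv_I ?v t \<le> ?a * ?b" by (rule norm_cauchy_schwarz)
    moreover have "deriv_I ?v t \<bullet> D_op v t \<le> ?b * (M * ?a)"
      using norm_cauchy_schwarz[of "deriv_I ?v t" "D_op v t"] mult_left_mono[OF M[OF t] norm_ge_zero[of "deriv_I ?v t"]]
      by linarith
    ultimately have "\<omega>' t \<le> (1 + M) * (2 * ?a * ?b)" by (simp add: \<omega>'_def algebra_simps)
    also have "\<dots> \<le> (1 + M) * (?a\<^sup>2 + ?b\<^sup>2)"
      using \<open>M \<ge> 0\<close> sum_squares_bound[of ?a ?b] by (intro mult_left_mono) auto
    finally show ?thesis by (simp add: \<omega>_def power2_norm_eq_inner)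
  qed
  define g where "g t = exp (- (1 + M) * t) * \<omega> t" for t
  have c\<omega>: "continuous_on {0..1} \<omega>" unfolding \<omega>_def by (intro continuous_intros c2per_continuous)
  have "g t \<le> g 0" if t: "t \<in> {0..1}" for t
  proof (rule DERIV_nonpos_imp_decreasing_open[of 0 t g])
    show "0 \<le> t" using t by simp
    show "continuous_on {0..t} g"
      unfolding g_def using t by (intro continuous_intros continuous_on_subset[OF c\<omega>]) auto
    fix s assume s: "0 < s" "s < t"
    then have s1: "s \<in> {0..1}" "s \<in> interior {0..1}" using t by (auto simp: interior_atLeastAtMost_real)
    have "(\<omega> has_real_derivative \<omega>' s) (at s)"
      using d\<omega>[OF s1(1)] at_within_interior[OF s1(2)]
      by (simp add: has_real_derivative_iff_has_vector_derivative)
    then have "(g has_real_derivative exp (- (1 + M) * s) * (\<omega>' s - (1 + M) * \<omega> s)) (at s)"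
      unfolding g_def by (auto intro!: derivative_eq_intros simp: algebra_simps)
    moreover have "exp (- (1 + M) * s) * (\<omega>' s - (1 + M) * \<omega> s) \<le> 0"
      using \<omega>'_le[OF s1(1)] by (intro mult_nonneg_nonpos) auto
    ultimately show "\<exists>y. (g has_real_derivative y) (at s) \<and> y \<le> 0" by blast
  qed
  then have "\<omega> t \<le> 0" if "t \<in> {0..1}" for t
    using that 0 by (fastforce simp: g_def \<omega>_def mult_le_0_iff)
  then have "?v t \<bullet> ?v t \<le> 0" if "t \<in> {0..1}" for t
    using that inner_ge_zero[of "deriv_I ?v t"] unfolding \<omega>_def by (smt (verit))
  then have v0: "?v t = 0" if "t \<in> {0..1}" for t
    using that inner_ge_zero[of "?v t"] inner_eq_zero_iff[of "?v t"] by (meson order_antisym)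
  then have "D_op v t = 0" if "t \<in> {0..1}" for t using M[OF that] that by simp
  moreover have "mean ?v = 0" using mean_cong[of ?v "\<lambda>_. 0"] v0 by (simp add: mean_const)
  ultimately show ?thesis by (intro E_op_eqD) (simp add: E_op_def linear_0[OF linear_D_op] linear_0[OF linear_mean_c2per])
qed

lemma subspace_C2per_mean0: "subspace C2per_mean0"
  unfolding C2per_mean0_def by (rule linear_subspace_kernel[OF linear_mean_c2per])

text \<open>
  The perturbation is \<open>v \<mapsto> \<Sum>i. \<langle>v, e i\<rangle> P (e i)\<close> with \<open>e\<close> spanning the kernel of the self-adjoint
  operator \<open>v'' - N'(x) v\<close>. No kernel element other than \<open>0\<close> is constant, so nothing is lost by
  passing from \<open>e i\<close> to \<open>P (e i)\<close>.
\<close>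

lemma F_deriv_transversal:
  fixes x :: "('n::finite) c2per"
  assumes x: "x \<in> c2per_level k" and q: "q \<noteq> 0"
  shows "\<exists>(\<phi> :: 'n c2per \<Rightarrow> real ^ ('n bit0)) w. bounded_linear \<phi> \<and> bounded_linear w \<and>
    range w \<subseteq> C2per_mean0 \<and> (\<forall>v. F_deriv q x v + w (\<phi> v) = 0 \<longrightarrow> v = 0)"
proof -
  let ?R = "Rep_c2per :: 'n c2per \<Rightarrow> _"
  have lin: "linear (F_deriv q x)" by (rule has_derivative_linear[OF has_derivative_F_op[OF x]])
  define K where "K = {v. F_deriv q x v = 0}"
  have K: "subspace K" unfolding K_def by (rule linear_subspace_kernel[OF lin])
  have D: "D_op v t = repulsion_deriv q (?R x t) (?R v t)" if "v \<in> K" "t \<in> {0..1}" for v t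
    using E_op_F_deriv[OF x that(2), of q v] that(1) by (simp add: K_def linear_0[OF linear_E_op])
  obtain M where M: "M > 0" "\<And>\<xi> v. \<xi> \<in> annulus k \<Longrightarrow> norm (repulsion_deriv q \<xi> v :: real ^ 'n) \<le> M * norm v"
    using repulsion_deriv_bounded[of k q] by blast
  \<comment> \<open>\<open>'n bit0\<close> has twice as many elements as \<open>'n\<close>, the
    dimension of the initial data (v(0), v'(0)) that determine a kernel element.\<close>
  have "\<exists>e :: 'n bit0 \<Rightarrow> 'n c2per. range e \<subseteq> K \<and> K \<subseteq> span (range e)"
  proof (rule finite_dim_spanning_family[OF K, where \<iota> = "\<lambda>v. (?R v 0, deriv_I (?R v) 0)"])
    show "linear (\<lambda>v. (?R v 0, deriv_I (?R v) 0))"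
      by (rule linearI) (simp_all add: linear_add[OF linear_Rep_c2per] linear_cmul[OF linear_Rep_c2per]
          linear_add[OF linear_deriv_Rep_c2per] linear_cmul[OF linear_deriv_Rep_c2per])
    show "v = 0" if "v \<in> K" "(?R v 0, deriv_I (?R v) 0) = 0" for v
      using that M D[OF that(1)] Rep_c2per_annulus[OF x]
      by (intro linear_ode_unique[of v M]) (auto simp: zero_prod_def simp del: atLeastAtMost_iff)
  qed simp
  then obtain e :: "'n bit0 \<Rightarrow> 'n c2per" where e: "\<And>i. e i \<in> K" "K \<subseteq> span (range e)" by blast
  define \<phi> where "\<phi> v = (\<Sum>i\<in>UNIV. ip_I (?R v) (?R (e i)) *\<^sub>R axis i (1::real))" for v
  \<comment> \<open>The mean-free part of \<open>e i\<close> is the image of \<open>p i\<close>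
    under \<open>E_op\<close>: the perturbation is added after the passage to functions in C^0, and
    \<open>J_op\<close> keeps it in the subspace of mean 0.\<close>
  define p where "p i = J_op (\<lambda>t. ?R (e i) t - mean (?R (e i)))" for i
  define w where "w s = (\<Sum>i\<in>UNIV. (s $ i) *\<^sub>R p i)" for s :: "real ^ ('n bit0)"
  have bl\<phi>: "bounded_linear \<phi>"
    unfolding \<phi>_def
    by (intro bounded_linear_sum bounded_linear_compose[OF bounded_linear_scaleR_left bounded_linear_ip_I])
  have \<phi>_nth: "\<phi> v $ i = ip_I (?R v) (?R (e i))" for v i
    by (simp add: \<phi>_def axis_def if_distrib cong: if_cong)
  have blw: "bounded_linear w"
    unfolding w_def
    by (intro bounded_linear_sum bounded_linear_compose[OF bounded_linear_scaleR_left bounded_linear_vec_nth])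
  have ce: "continuous_on {0..1} (\<lambda>t. ?R (e i) t - mean (?R (e i)))" for i
    by (intro continuous_intros c2per_continuous)
  have p0: "p i \<in> C2per_mean0" for i
    using mean_J_op[OF ce, of i] mean_diff[OF c2per_continuous(1) continuous_on_const, of "e i" "mean (?R (e i))"]
    by (simp add: p_def C2per_mean0_def mean_const)
  have rw: "range w \<subseteq> C2per_mean0"
    unfolding w_def by (intro image_subsetI subspace_sum subspace_scale subspace_C2per_mean0 p0)
  have "v = 0" if v: "F_deriv q x v + w (\<phi> v) = 0" for v
  proof -
    define u where "u = (\<Sum>i\<in>UNIV. (\<phi> v $ i) *\<^sub>R e i)"
    have uK: "u \<in> K" unfolding u_def by (intro subspace_sum subspace_scale K e)
    have Ru: "?R u t = (\<Sum>i\<in>UNIV. (\<phi> v $ i) *\<^sub>R ?R (e i) t)" for t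
      by (simp add: u_def linear_sum[OF linear_Rep_c2per] linear_cmul[OF linear_Rep_c2per])
    have mu: "mean (?R u) = (\<Sum>i\<in>UNIV. (\<phi> v $ i) *\<^sub>R mean (?R (e i)))"
      by (simp add: u_def linear_sum[OF linear_mean_c2per] linear_cmul[OF linear_mean_c2per])
    have Ew: "E_op (w (\<phi> v)) t = ?R u t - mean (?R u)" if t: "t \<in> {0..1}" for t
      by (simp add: w_def E_op_sum E_op_scaleR p_def E_op_J_op[OF ce t] Ru mu
          scaleR_diff_right sum_subtractf)
    let ?L = "\<lambda>t. D_op v t - repulsion_deriv q (?R x t) (?R v t)"
    have eq: "?L t + (?R u t - mean (?R u)) = 0" if t: "t \<in> {0..1}" for t
      using arg_cong[OF v, of "\<lambda>z. E_op z t"]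
      by (simp add: E_op_add E_op_F_deriv[OF x t] Ew[OF t] linear_0[OF linear_E_op])
    have cL: "continuous_on {0..1} ?L"
      by (intro continuous_intros c2per_continuous continuous_on_repulsion_deriv_c2per[OF x])
    have cu: "continuous_on {0..1} (\<lambda>t. ?R u t - mean (?R u))"
      by (intro continuous_intros c2per_continuous)
    \<comment> \<open>The equation is paired with the kernel element \<open>u\<close>.
      Self-adjointness removes the term with \<open>v\<close>, which leaves the squared L2 norm of
      \<open>u\<close> minus its mean; so \<open>u\<close> is constant.\<close>
    have "ip_I ?L (?R u) = ip_I (D_op v) (?R u) - ip_I (\<lambda>t. repulsion_deriv q (?R x t) (?R v t)) (?R u)"
      by (intro ip_I_diff c2per_continuous continuous_on_repulsion_deriv_c2per[OF x])
    also have "ip_I (\<lambda>t. repulsion_deriv q (?R x t) (?R v t)) (?R u) = ip_I (?R v) (D_op u)"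
      by (rule ip_I_cong) (simp add: repulsion_deriv_symmetric D[OF uK])
    finally have Lu: "ip_I ?L (?R u) = 0" by (simp add: ip_I_D_op_symmetric)
    have "ip_I (\<lambda>t. ?L t + (?R u t - mean (?R u))) (?R u) = 0"
      using ip_I_cong[of "\<lambda>t. ?L t + (?R u t - mean (?R u))" "?R u" "\<lambda>_. 0" "\<lambda>_. 0"] eq
      by (simp add: ip_I_def)
    then have Pu: "ip_I (\<lambda>t. ?R u t - mean (?R u)) (?R u) = 0"
      using ip_I_add[OF cL cu c2per_continuous(1), of u] Lu by simp
    have "ip_I (\<lambda>t. ?R u t - mean (?R u)) (\<lambda>t. ?R u t - mean (?R u)) =
        ip_I (?R u) (\<lambda>t. ?R u t - mean (?R u)) - ip_I (\<lambda>_. mean (?R u)) (\<lambda>t. ?R u t - mean (?R u))"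
      by (intro ip_I_diff c2per_continuous cu continuous_on_const)
    also have "ip_I (?R u) (\<lambda>t. ?R u t - mean (?R u)) = 0" using Pu by (simp only: ip_I_commute)
    also have "ip_I (\<lambda>_. mean (?R u)) (\<lambda>t. ?R u t - mean (?R u)) = 0"
      using ip_I_const[OF cu, of "mean (?R u)"]
        mean_diff[OF c2per_continuous(1) continuous_on_const, of u "mean (?R u)"]
      by (simp add: ip_I_commute mean_const)
    finally have const: "?R u t = mean (?R u)" if "t \<in> {0..1}" for t
      using ip_I_self_eq_0[OF cu _ that] by simp
    have "?R u = (\<lambda>t. if t \<in> {0..1} then mean (?R u) else 0)"
      using const c2per_outside[of _ u] by (auto simp: fun_eq_iff simp del: atLeastAtMost_iff)
    \<comment> \<open>For a constant kernel element u'' = 0, hence N'(x) u = 0, and pointwise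
      invertibility of N'(x) gives u = 0.\<close>
    then have "deriv_I (?R u) = (\<lambda>t. 0)" using deriv_I_const[of "mean (?R u)"] by metis
    then have "D_op u = (\<lambda>t. 0)" using deriv_I_const[of "0 :: real ^ 'n"] by (simp add: D_op_def)
    then have u0: "?R u t = 0" if "t \<in> {0..1}" for t
      using D[OF uK that] repulsion_deriv_inj[OF annulus_nonzero[OF Rep_c2per_annulus[OF x that]] q] by simp
    have "mean (?R u) = 0" using const[of 0] u0[of 0] by simp
    then have "F_deriv q x v = 0"
      using eq u0 by (intro E_op_eqD) (simp add: E_op_F_deriv[OF x] linear_0[OF linear_E_op])
    then have vK: "v \<in> K" by (simp add: K_def)
    \<comment> \<open>The pairing of \<open>u\<close> with \<open>v\<close> is the sum of the
      squares of the coordinates of \<open>\<phi> v\<close>. So \<open>v\<close> is orthogonal to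
      the whole kernel and lies in it.\<close>
    have "0 = ip_I (?R u) (?R v)"
      using ip_I_cong[of "?R u" "?R v" "\<lambda>_. 0" "\<lambda>_. 0"] u0 by (simp add: ip_I_def)
    also have "\<dots> = (\<Sum>i\<in>UNIV. (\<phi> v $ i) * ip_I (?R (e i)) (?R v))"
      unfolding u_def
      by (simp add: linear_sum[OF bounded_linear.linear[OF bounded_linear_ip_I]]
          linear_cmul[OF bounded_linear.linear[OF bounded_linear_ip_I]])
    also have "\<dots> = (\<Sum>i\<in>UNIV. (\<phi> v $ i)\<^sup>2)"
      by (simp add: \<phi>_nth ip_I_commute[of "?R v"] power2_eq_square)
    finally have \<phi>0: "ip_I (?R (e i)) (?R v) = 0" for i
      by (simp add: sum_nonneg_eq_0_iff \<phi>_nth ip_I_commute[of "?R v"])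
    have "subspace {z. ip_I (?R z) (?R v) = 0}"
      by (rule linear_subspace_kernel[OF bounded_linear.linear[OF bounded_linear_ip_I]])
    then have "span (range e) \<subseteq> {z. ip_I (?R z) (?R v) = 0}"
      using \<phi>0 by (intro span_minimal) auto
    then have "ip_I (?R v) (?R v) = 0" using vK e(2) by blast
    then have v0: "?R v t = 0" if "t \<in> {0..1}" for t
      using ip_I_self_eq_0[OF c2per_continuous(1) _ that] by blast
    then have "?R v = (\<lambda>t. 0)" using c2per_outside[of _ v] by (auto simp: fun_eq_iff)
    then show "v = 0" by (simp add: Rep_c2per_inject[symmetric] zero_c2per.rep_eq)
  qed
  then show ?thesis using bl\<phi> blw rw by blast
qed

section \<open>Uniform distance from the singularity and conclusion\<close>

text \<open>Pointwise nonvanishing of each member gives no common lower bound. The bound on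
  \<open>x - F_op q x\<close> does: through \<open>E_op\<close> it bounds N x, whose norm at t is
  |x(t)| to the power -q and would blow up near a zero.\<close>

lemma subset_c2per_level:
  fixes U :: "('n::finite) c2per set"
  assumes "q > 0" and U: "bounded U" "U \<subseteq> C2per_nonvanishing" and b: "bounded ((\<lambda>x. x - F_op q x) ` U)"
  shows "\<exists>k. U \<subseteq> c2per_level k"
proof -
  obtain R where R: "\<And>x. x \<in> U \<Longrightarrow> norm x \<le> R" using U(1) by (auto simp: bounded_iff)
  obtain C where C: "\<And>x. x \<in> U \<Longrightarrow> norm (x - F_op q x) \<le> C" using b by (auto simp: bounded_iff)
  \<comment> \<open>\<open>2 * C\<close> comes from \<open>norm_E_op_le\<close> and \<open>R\<close>
    bounds the mean; the 1 makes \<open>S\<close> positive for the negative power.\<close>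
  define S where "S = max 1 (2 * C + R)"
  have S: "S > 0" by (simp add: S_def)
  have low: "S powr (- 1 / q) \<le> norm (Rep_c2per x t)" if x: "x \<in> U" and t: "t \<in> {0..1}" for x t
  proof -
    obtain l where l: "x \<in> c2per_level l" using x U(2) c2per_nonvanishing_eq by blast
    have nz: "Rep_c2per x t \<noteq> 0" by (rule annulus_nonzero[OF Rep_c2per_annulus[OF l t]])
    have "repulsion q (Rep_c2per x t) = E_op (x - F_op q x) t + mean (Rep_c2per x)"
      by (simp add: E_op_diff E_op_F_op[OF l t]) (simp add: E_op_def)
    also have "norm \<dots> \<le> 2 * C + R"
      using norm_triangle_ineq[of "E_op (x - F_op q x) t" "mean (Rep_c2per x)"]
        norm_E_op_le[OF t, of "x - F_op q x"] C[OF x] R[OF x]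
        norm_mean_le[OF c2per_continuous(1) norm_le_c2per(1), of x] by simp
    finally have "norm (Rep_c2per x t) powr - q \<le> S" by (simp add: norm_repulsion[OF nz] S_def)
    then have "S powr (- 1 / q) \<le> (norm (Rep_c2per x t) powr - q) powr (- 1 / q)"
      using assms(1) nz by (intro powr_mono2') auto
    also have "\<dots> = norm (Rep_c2per x t)" using assms(1) nz by (simp add: powr_powr)
    finally show ?thesis .
  qed
  obtain k1 where k1: "inverse (real (Suc k1)) < S powr (- 1 / q)"
    using reals_Archimedean[of "S powr (- 1 / q)"] S by auto
  obtain k2 where k2: "R \<le> real k2" using real_arch_simple by blast
  have le: "inverse (real (Suc (max k1 k2))) \<le> inverse (real (Suc k1))" by (intro le_imp_inverse_le) auto
  have "x \<in> c2per_level (max k1 k2)" if x: "x \<in> U" for x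
    unfolding c2per_level_def mem_Collect_eq
  proof (intro conjI ballI)
    show "norm x \<le> real (Suc (max k1 k2))" using k2 R[OF x] by simp
    show "inverse (real (Suc (max k1 k2))) \<le> norm (Rep_c2per x t)" if "t \<in> {0..1}" for t
      by (rule order_trans[OF le order_trans[OF less_imp_le[OF k1] low[OF x that]]])
  qed
  then show ?thesis by blast
qed

theorem theorem3p1:
  fixes q :: real
  assumes "CARD('n::finite) \<ge> 2" and "q \<ge> 2"
  shows "\<exists>\<Sigma> :: 'n c2per set.
    residual_in (top_of_set C2per_mean0) \<Sigma> \<and>
    (\<forall>U. \<forall>y\<in>\<Sigma>. \<forall>m::int.
       open U \<and> bounded U \<and> closure U \<subseteq> C2per_nonvanishing \<and>
       has_LS_degree (F_op q) U y m \<longrightarrow>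
       (\<exists>S \<subseteq> {x \<in> C2per_nonvanishing. F_op q x = y}. finite S \<and> m \<le> int (card S)))"
proof -
  interpret F: approximable_C1_map "F_op q" "F_deriv q" "c2per_level :: nat \<Rightarrow> 'n c2per set"
    by (rule approximable_C1_map_F_op)
  have q: "q \<noteq> 0" "q > 0" using assms(2) by auto
  define \<Sigma> where "\<Sigma> = C2per_mean0 - F_op q ` {x :: 'n c2per. x \<in> (\<Union>k. c2per_level k) \<and> F.crit x}"
  have "residual_in (top_of_set C2per_mean0) \<Sigma>"
    unfolding \<Sigma>_def
    by (rule F.regular_values_residual[OF subspace_C2per_mean0 F_deriv_transversal[OF _ q(1)]])
  moreover have "\<exists>S \<subseteq> {x \<in> C2per_nonvanishing. F_op q x = y}. finite S \<and> m \<le> int (card S)"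
    if y: "y \<in> \<Sigma>" and U: "bounded U" "closure U \<subseteq> C2per_nonvanishing" "has_LS_degree (F_op q) U y m"
    for U and y :: "'n c2per" and m :: int
  proof -
    \<comment> \<open>That the degree is defined includes compactness of \<open>id - F\<close> on
      the closure; this is the bound by which the closure fits into one level.\<close>
    have "bounded ((\<lambda>x. x - F_op q x) ` closure U)"
      using U(3) closure_subset compact_imp_bounded bounded_subset unfolding has_LS_degree_def by metis
    then obtain k where k: "closure U \<subseteq> c2per_level k"
      using subset_c2per_level[OF q(2) bounded_closure[OF U(1)] U(2)] by blast
    have Uk: "x \<in> c2per_level k" if "x \<in> U" for x using that k closure_subset by blast
    have "\<not> F.crit x" if "x \<in> U" "F_op q x = y" for x
      using y that Uk by (auto simp: \<Sigma>_def)
    from F.LS_degree_le_card[OF U(3) k this]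
    obtain S where S: "S \<subseteq> {x \<in> U. F_op q x = y}" "finite S" "m \<le> int (card S)" by blast
    moreover have "U \<subseteq> C2per_nonvanishing" using U(2) closure_subset by blast
    ultimately show ?thesis by (intro exI[of _ S]) auto
  qed
  ultimately show ?thesis by blast
qed

end
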